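(* Let $\bigl((\Omega[i],\mathcal F[i],P[i])_{i=1}^\infty,\mathcal A\bigr)$ be a dyadic coarse factorization and let $x\in L_2(\mathcal A)$. Then the sequence $(\mu_x[i])_{i=1}^\infty$ of spectral measures, regarded as Borel measures on the Polish space $\mathcal C[\infty]$ of compact subsets of $\mathbb R$, converges weakly to some finite positive Borel measure $\mu_x[\infty]$ on $\mathcal C[\infty]$.
   Context: **Coarse $\sigma$-fields.** Let $(\Omega[i],\mathcal F[i],P[i])_{i=1}^\infty$ be a sequence of probability spaces (all probability spaces are Lebesgue–Rokhlin), and $\Omega[\mathrm{all}]=\Omega[1]\uplus\Omega[2]\uplus\cdots$ (disjoint union). For $A\subset\Omega[\mathrm{all}]$ put $A[i]=A\cap\Omega[i]$. A set $\mathcal A$ of subsets of $\Omega[\mathrm{all}]$ is a coarse $\sigma$-field if: (a) $A[i]\in\mathcal F[i]$ for all $A\in\mathcal A$ and all $i$; (b) $A,B\in\mathcal A$ implies $A\cap B,\ A\cup B,\ \Omega[\mathrm{all}]\setminus A\in\mathcal A$; (c) $\mathcal A$ contains every $A\subset\Omega[\mathrm{all}]$ such that $A[i]\in\mathcal F[i]$ for all $i$ and $P[i](A[i])\to0$ as $i\to\infty$; (d) $\bigcup_{k}A_k\in\mathcal A$ for all pairwise disjoint $A_1,A_2,\dots\in\mathcal A$ with $\sum_k\sup_iP[i](A_k[i])<\infty$; (e) $\lim_iP[i](A[i])$ exists for every $A\in\mathcal A$; (f) some finite or countable subset $\mathcal A_1\subset\mathcal A$ generates $\mathcal A$, i.e.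 the least subset of $\mathcal A$ containing $\mathcal A_1$ and satisfying (b)–(d) is $\mathcal A$. The pair (sequence of probability spaces, $\mathcal A$) is then called a coarse probability space. For two coarse probability spaces with coarse $\sigma$-fields $\mathcal A_1,\mathcal A_2$, the product $\mathcal A_1\otimes\mathcal A_2$ is the smallest coarse $\sigma$-field on the sequence of product probability spaces $\Omega_1[i]\times\Omega_2[i]$ that contains all $A_1\times A_2$ ($A_k\in\mathcal A_k$), where $(A_1\times A_2)[i]=A_1[i]\times A_2[i]$. **Dyadic coarse sample space.** $\Omega[i]$ is the space of all maps $\frac1i\mathbb Z\to\{-1,+1\}$ with the product $\sigma$-field $\mathcal F[i]$ and the product measure $P[i]$ of uniform measures on $\{-1,+1\}$; $\tau_m$ ($m\in\frac1i\mathbb Z$) denote the coordinate functions (independent random signs). **Coarse time intervals.** A coarse instant is a sequence $t=(t[i])_{i=1}^\infty$ with $t[i]\in\frac1i\mathbb Z$ converging to some $t[\infty]\in\mathbb R$. A coarse time interval is a pair $(s,t)$ of coarse instants with $s[i]\le t[i]$ for all $i$ (written $s\le t$). For such $(s,t)$, $(\Omega_{s,t}[i],\mathcal F_{s,t}[i],P_{s,t}[i])$ is the space of all maps $\frac1i\mathbb Z\cap[s[i],t[i])\to\{-1,+1\}$ with its natural $\sigma$-field and uniform product measure; restriction gives a canonical measure preserving map $\Omega[i]\to\Omega_{s,t}[i]$. Given a coarse $\sigma$-field $\mathcal A$ on the dyadic coarse sample space, $\mathcal A_{s,t}$ is the coarse $\sigma$-field of all $A\subset\Omega_{s,t}[\mathrm{all}]$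 whose inverse image in $\Omega[\mathrm{all}]$ belongs to $\mathcal A$. **Dyadic coarse factorization.** A coarse probability space $\bigl((\Omega[i],\mathcal F[i],P[i])_{i=1}^\infty,\mathcal A\bigr)$ over the dyadic coarse sample space such that $\mathcal A_{r,t}=\mathcal A_{r,s}\otimes\mathcal A_{s,t}$ for all coarse instants $r\le s\le t$ (using the natural identification $\Omega_{r,t}[i]=\Omega_{r,s}[i]\times\Omega_{s,t}[i]$), and $\mathcal A$ is generated (in the sense of (b)–(d)) by the union, over all coarse time intervals $(s,t)$, of the $\mathcal A_{s,t}$ (identified with their inverse images in $\Omega[\mathrm{all}]$). **$L_2(\mathcal A)$.** The completion of the linear span of indicators $\mathbf 1_A$, $A\in\mathcal A$ (functions on $\Omega[\mathrm{all}]$), in the norm $\|f\|=\sup_i\|f[i]\|_{L_2(\Omega[i],\mathcal F[i],P[i])}$, where $f[i]=f|_{\Omega[i]}$. An element $x\in L_2(\mathcal A)$ is identified with a sequence of $x[i]\in L_2(\Omega[i],\mathcal F[i],P[i])$. **Spectral measures.** $\mathcal C[i]$ is the set of all finite subsets $M\subset\frac1i\mathbb Z$, and $\tau_M=\prod_{m\in M}\tau_m$; the $\tau_M$ form an orthonormal basis of $L_2(\Omega[i],\mathcal F[i],P[i])$. For $f=\sum_M\hat f_M\tau_M$, the spectral measure of $f$ is $\mu_f(\mathcal M)=\sum_{M\in\mathcal M}|\hat f_M|^2$, $\mathcal M\subset\mathcal C[i]$. For $x\in L_2(\mathcal A)$, $\mu_x[i]$ is the spectral measure of $x[i]$. $\mathcal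 C[\infty]$ is the space of all compact subsets of $\mathbb R$ (including $\emptyset$) with the Hausdorff metric $\mathrm{dist}(M_1,M_2)=\sup_{x\in\mathbb R}\bigl|\min_{y\in M_1}|x-y|-\min_{y\in M_2}|x-y|\bigr|$ for nonempty $M_1,M_2$, and $\mathrm{dist}(\emptyset,M)=1$ for $M\ne\emptyset$. Since $\mathcal C[i]\subset\mathcal C[\infty]$, each $\mu_x[i]$ is also a measure on $\mathcal C[\infty]$. *)

theory Defs
  imports "HOL-Probability.Probability"
begin

section \<open>Coarse sigma-fields\<close>

text \<open>
  A sequence of probability spaces is a function \<open>M :: nat \<Rightarrow> 'a measure\<close> of which only the
  members \<open>M i\<close> with \<open>i \<ge> 1\<close> matter. The disjoint union of the spaces is a set of pairs
  \<open>(i, \<omega>)\<close>, and the \<open>i\<close>-th section of \<open>A\<close> is the relational image \<open>A `` {i}\<close>.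
\<close>

definition coarse_union :: "(nat \<Rightarrow> 'a measure) \<Rightarrow> (nat \<times> 'a) set" where
  "coarse_union M = (SIGMA i:{1..}. space (M i))"

definition coarse_set :: "(nat \<Rightarrow> 'a measure) \<Rightarrow> (nat \<times> 'a) set \<Rightarrow> bool" where
  "coarse_set M A \<longleftrightarrow> A \<subseteq> coarse_union M \<and> (\<forall>i\<ge>1. A `` {i} \<in> sets (M i))"

text \<open>
  Closure under finite Boolean operations, under adjoining asymptotically negligible sets, and under
  countable disjoint unions that converge uniformly in \<open>i\<close>.
\<close>

definition coarse_closed :: "(nat \<Rightarrow> 'a measure) \<Rightarrow> (nat \<times> 'a) set set \<Rightarrow> bool" where
  "coarse_closed M \<A> \<longleftrightarrow>
     (\<forall>A\<in>\<A>. \<forall>B\<in>\<A>. A \<inter> B \<in> \<A> \<and> A \<union> B \<in> \<A> \<and> coarse_union M - A \<in> \<A>) \<and>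
     (\<forall>A. coarse_set M A \<and> (\<lambda>i. measure (M i) (A `` {i})) \<longlonglongrightarrow> 0 \<longrightarrow> A \<in> \<A>) \<and>
     (\<forall>A :: nat \<Rightarrow> (nat \<times> 'a) set.
        range A \<subseteq> \<A> \<and> disjoint_family A \<and>
        summable (\<lambda>k. SUP i\<in>{1..}. measure (M i) (A k `` {i}))
        \<longrightarrow> (\<Union>k. A k) \<in> \<A>)"

text \<open>
  The collection generated by \<open>\<G>\<close> is the least closed one containing \<open>\<G>\<close>, written
  \<open>coarse_closed M hull \<G>\<close>; closedness is preserved by intersections, and if \<open>\<G> \<subseteq> \<A>\<close> with \<open>\<A>\<close>
  closed, then this hull is a subset of \<open>\<A>\<close>.
\<close>

definition coarse_sigma_field :: "(nat \<Rightarrow> 'a measure) \<Rightarrow> (nat \<times> 'a) set set \<Rightarrow> bool" where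
  "coarse_sigma_field M \<A> \<longleftrightarrow>
     (\<forall>A\<in>\<A>. coarse_set M A) \<and>
     coarse_closed M \<A> \<and>
     (\<forall>A\<in>\<A>. convergent (\<lambda>i. measure (M i) (A `` {i}))) \<and>
     (\<exists>\<G>\<subseteq>\<A>. countable \<G> \<and> coarse_closed M hull \<G> = \<A>)"

definition coarse_prob_space :: "(nat \<Rightarrow> 'a measure) \<Rightarrow> (nat \<times> 'a) set set \<Rightarrow> bool" where
  "coarse_prob_space M \<A> \<longleftrightarrow> (\<forall>i\<ge>1. prob_space (M i)) \<and> coarse_sigma_field M \<A>"

definition coarse_times ::
    "(nat \<times> 'a) set \<Rightarrow> (nat \<times> 'b) set \<Rightarrow> (nat \<times> 'a \<times> 'b) set" where
  "coarse_times A B = {(i, \<omega>\<^sub>1, \<omega>\<^sub>2). (i, \<omega>\<^sub>1) \<in> A \<and> (i, \<omega>\<^sub>2) \<in> B}"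

text \<open>The hull is the intersection of all coarse sigma-fields containing the rectangles.\<close>

definition coarse_prod ::
    "(nat \<Rightarrow> 'a measure) \<Rightarrow> (nat \<times> 'a) set set \<Rightarrow> (nat \<Rightarrow> 'b measure) \<Rightarrow> (nat \<times> 'b) set set
      \<Rightarrow> (nat \<times> 'a \<times> 'b) set set" where
  "coarse_prod M\<^sub>1 \<A>\<^sub>1 M\<^sub>2 \<A>\<^sub>2 =
     coarse_sigma_field (\<lambda>i. M\<^sub>1 i \<Otimes>\<^sub>M M\<^sub>2 i) hull
       {coarse_times A B |A B. A \<in> \<A>\<^sub>1 \<and> B \<in> \<A>\<^sub>2}"


section \<open>The dyadic coarse sample space\<close>

definition grid :: "nat \<Rightarrow> real set" where
  "grid i = range (\<lambda>k :: int. real_of_int k / real i)"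

definition sign_space :: "real measure" where
  "sign_space = uniform_count_measure {-1, 1}"

definition dyadic_space :: "nat \<Rightarrow> (real \<Rightarrow> real) measure" where
  "dyadic_space i = (\<Pi>\<^sub>M m\<in>grid i. sign_space)"

definition coarse_instant :: "(nat \<Rightarrow> real) \<Rightarrow> bool" where
  "coarse_instant t \<longleftrightarrow> (\<forall>i\<ge>1. t i \<in> grid i) \<and> convergent t"

definition coarse_time_interval :: "(nat \<Rightarrow> real) \<Rightarrow> (nat \<Rightarrow> real) \<Rightarrow> bool" where
  "coarse_time_interval s t \<longleftrightarrow> coarse_instant s \<and> coarse_instant t \<and> (\<forall>i\<ge>1. s i \<le> t i)"

definition window :: "(nat \<Rightarrow> real) \<Rightarrow> (nat \<Rightarrow> real) \<Rightarrow> nat \<Rightarrow> real set" where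
  "window s t i = grid i \<inter> {s i..<t i}"

definition window_space ::
    "(nat \<Rightarrow> real) \<Rightarrow> (nat \<Rightarrow> real) \<Rightarrow> nat \<Rightarrow> (real \<Rightarrow> real) measure" where
  "window_space s t i = (\<Pi>\<^sub>M m\<in>window s t i. sign_space)"

definition window_preimage ::
    "(nat \<Rightarrow> real) \<Rightarrow> (nat \<Rightarrow> real) \<Rightarrow> (nat \<times> (real \<Rightarrow> real)) set
      \<Rightarrow> (nat \<times> (real \<Rightarrow> real)) set" where
  "window_preimage s t A =
     {(i, \<omega>) \<in> coarse_union dyadic_space. (i, restrict \<omega> (window s t i)) \<in> A}"

definition window_field ::
    "(nat \<times> (real \<Rightarrow> real)) set set \<Rightarrow> (nat \<Rightarrow> real) \<Rightarrow> (nat \<Rightarrow> real)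
      \<Rightarrow> (nat \<times> (real \<Rightarrow> real)) set set" where
  "window_field \<A> s t = {A. A \<subseteq> coarse_union (window_space s t) \<and> window_preimage s t A \<in> \<A>}"

text \<open>
  For \<open>r \<le> s \<le> t\<close> the map \<open>\<omega> \<mapsto> (restrict \<omega> (window r s i), restrict \<omega> (window s t i))\<close> is the
  natural bijection from the space over \<open>[r, t)\<close> to the product of the spaces over \<open>[r, s)\<close> and
  \<open>[s, t)\<close>. The following transports a subset of the product back along it.
\<close>

definition window_glue ::
    "(nat \<Rightarrow> real) \<Rightarrow> (nat \<Rightarrow> real) \<Rightarrow> (nat \<Rightarrow> real)
      \<Rightarrow> (nat \<times> (real \<Rightarrow> real) \<times> (real \<Rightarrow> real)) set \<Rightarrow> (nat \<times> (real \<Rightarrow> real)) set" where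
  "window_glue r s t C =
     {(i, \<omega>) \<in> coarse_union (window_space r t).
        (i, restrict \<omega> (window r s i), restrict \<omega> (window s t i)) \<in> C}"

definition dyadic_coarse_factorization :: "(nat \<times> (real \<Rightarrow> real)) set set \<Rightarrow> bool" where
  "dyadic_coarse_factorization \<A> \<longleftrightarrow>
     coarse_prob_space dyadic_space \<A> \<and>
     (\<forall>r s t. coarse_time_interval r s \<and> coarse_time_interval s t \<longrightarrow>
        window_field \<A> r t =
          window_glue r s t `
            coarse_prod (window_space r s) (window_field \<A> r s)
                        (window_space s t) (window_field \<A> s t)) \<and>
     coarse_closed dyadic_space hull
       {window_preimage s t A |s t A. coarse_time_interval s t \<and> A \<in> window_field \<A> s t} = \<A>"


section \<open>Square integrable elements\<close>

definition square_integrable :: "'a measure \<Rightarrow> ('a \<Rightarrow> complex) \<Rightarrow> bool" where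
  "square_integrable M f \<longleftrightarrow> f \<in> borel_measurable M \<and> integrable M (\<lambda>\<omega>. (cmod (f \<omega>))\<^sup>2)"

definition l2_norm :: "'a measure \<Rightarrow> ('a \<Rightarrow> complex) \<Rightarrow> real" where
  "l2_norm M f = sqrt (\<integral>\<omega>. (cmod (f \<omega>))\<^sup>2 \<partial>M)"

definition coarse_norm :: "(nat \<Rightarrow> 'a measure) \<Rightarrow> (nat \<Rightarrow> 'a \<Rightarrow> complex) \<Rightarrow> ereal" where
  "coarse_norm M f = (SUP i\<in>{1..}. ereal (l2_norm (M i) (f i)))"

definition indicator_span :: "(nat \<times> 'a) set set \<Rightarrow> (nat \<Rightarrow> 'a \<Rightarrow> complex) set" where
  "indicator_span \<A> =
     {(\<lambda>i \<omega>. \<Sum>A\<in>S. c A * indicator A (i, \<omega>)) |S c. finite S \<and> S \<subseteq> \<A>}"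

text \<open>
  The norm-bounded sequences of square integrable functions form, modulo null functions, a complete
  space, so the completion of the span is its closure there. Elements are represented by sequences
  of functions, not of equivalence classes. The scalars are complex; the real-valued elements are
  a special case.
\<close>

definition coarse_L2 ::
    "(nat \<Rightarrow> 'a measure) \<Rightarrow> (nat \<times> 'a) set set \<Rightarrow> (nat \<Rightarrow> 'a \<Rightarrow> complex) set" where
  "coarse_L2 M \<A> =
     {x. (\<forall>i\<ge>1. square_integrable (M i) (x i)) \<and>
         (\<forall>\<epsilon>>0. \<exists>f\<in>indicator_span \<A>. coarse_norm M (\<lambda>i \<omega>. x i \<omega> - f i \<omega>) < ereal \<epsilon>)}"


section \<open>The space of compact subsets of the line\<close>

typedef compacts = "{K :: real set. compact K}"
  morphisms set_of_compacts Compacts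
  by (rule exI[of _ "{}"]) simp

text \<open>
  On nonempty compact sets the infimum in \<^const>\<open>infdist\<close> is a minimum. Note that, since nonempty
  sets may be more than 2 apart while each is at distance 1 from the empty set, the triangle
  inequality fails across the empty set. The induced topology, in which the empty set is isolated
  from the metric space of nonempty compact sets, is unaffected.
\<close>

definition compacts_dist :: "compacts \<Rightarrow> compacts \<Rightarrow> real" where
  "compacts_dist K L =
     (let A = set_of_compacts K; B = set_of_compacts L in
      if A = {} \<and> B = {} then 0
      else if A = {} \<or> B = {} then 1
      else (SUP x. \<bar>infdist x A - infdist x B\<bar>))"

instantiation compacts :: topological_space
begin

definition open_compacts :: "compacts set \<Rightarrow> bool" where
  "open_compacts U \<longleftrightarrow> (\<forall>K\<in>U. \<exists>e>0. \<forall>L. compacts_dist K L < e \<longrightarrow> L \<in> U)"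

instance
proof
  show "open (UNIV :: compacts set)"
    by (auto simp: open_compacts_def intro: exI[of _ 1])
next
  fix S T :: "compacts set"
  assume S: "open S" and T: "open T"
  show "open (S \<inter> T)"
    unfolding open_compacts_def
  proof
    fix K assume "K \<in> S \<inter> T"
    with S T obtain d e where "d > 0" "\<forall>L. compacts_dist K L < d \<longrightarrow> L \<in> S"
      and "e > 0" "\<forall>L. compacts_dist K L < e \<longrightarrow> L \<in> T"
      unfolding open_compacts_def by blast
    then show "\<exists>e>0. \<forall>L. compacts_dist K L < e \<longrightarrow> L \<in> S \<inter> T"
      by (intro exI[of _ "min d e"]) auto
  qed
next
  fix \<U> :: "compacts set set"
  assume "\<forall>S\<in>\<U>. open S"
  then show "open (\<Union>\<U>)"
    unfolding open_compacts_def by (meson UnionE UnionI)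
qed

end


section \<open>Spectral measures\<close>

definition finite_subsets :: "nat \<Rightarrow> real set set" where
  "finite_subsets i = {M. finite M \<and> M \<subseteq> grid i}"

definition walsh :: "real set \<Rightarrow> (real \<Rightarrow> real) \<Rightarrow> complex" where
  "walsh M \<omega> = complex_of_real (\<Prod>m\<in>M. \<omega> m)"

text \<open>
  The coefficient of \<open>f\<close> with respect to \<open>walsh M\<close> in the orthonormal basis
  \<open>{walsh M | M. M \<in> finite_subsets i}\<close> of the complex \<open>L\<^sub>2\<close> space over \<open>dyadic_space i\<close>;
  \<open>walsh M\<close> is real-valued, so no conjugation is needed.
\<close>

definition walsh_coeff :: "nat \<Rightarrow> ((real \<Rightarrow> real) \<Rightarrow> complex) \<Rightarrow> real set \<Rightarrow> complex" where
  "walsh_coeff i f M = (\<integral>\<omega>. f \<omega> * walsh M \<omega> \<partial>dyadic_space i)"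

definition spectral_measure :: "nat \<Rightarrow> ((real \<Rightarrow> real) \<Rightarrow> complex) \<Rightarrow> real set measure" where
  "spectral_measure i f =
     point_measure (finite_subsets i) (\<lambda>M. ennreal ((cmod (walsh_coeff i f M))\<^sup>2))"

definition spectral_borel_measure ::
    "nat \<Rightarrow> ((real \<Rightarrow> real) \<Rightarrow> complex) \<Rightarrow> compacts measure" where
  "spectral_borel_measure i f = distr (spectral_measure i f) borel Compacts"

text \<open>\<^const>\<open>weak_conv_m\<close> covers only measures on the real line.\<close>

definition weakly_converges ::
    "(nat \<Rightarrow> 'a :: topological_space measure) \<Rightarrow> 'a measure \<Rightarrow> bool" where
  "weakly_converges \<mu> \<nu> \<longleftrightarrow>
     (\<forall>g :: 'a \<Rightarrow> real. continuous_on UNIV g \<and> bounded (range g) \<longrightarrow>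
        (\<lambda>i. \<integral>K. g K \<partial>\<mu> i) \<longlonglongrightarrow> (\<integral>K. g K \<partial>\<nu>))"

end

theory Submission
  imports Defs
begin

text \<open>
  The elements of a coarse \<open>\<sigma>\<close>-field generated by an algebra are its limits in the pseudometric
  \<open>limsup\<^sub>i P[i](A[i] \<triangle> B[i])\<close>. Hence \<open>\<A>\<^sub>r\<^sub>,\<^sub>s \<otimes> \<A>\<^sub>s\<^sub>,\<^sub>t\<close> consists of limits of finite unions of
  rectangles, and \<open>\<A>\<close> of limits of sets that depend on a bounded window.

  For a union \<open>E\<close> of dyadic cells, \<open>\<mu>\<^sub>x[i]{M. M \<subseteq> E}\<close> is the squared norm of the projection of \<open>x[i]\<close>
  to the functions of the signs in \<open>E\<close>. The associated sesquilinear form factorizes over products of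
  functions of disjoint windows; on a single cell it is an inner product or a product of two means,
  so it converges there, and by the factorization property and density it converges on all of
  \<open>L\<^sub>2(\<A>)\<close>. Approximating \<open>x\<close> by functions of a bounded window also gives tightness.

  By inclusion-exclusion, the \<open>\<mu>\<^sub>x[i]\<close>-probability that \<open>M\<close> meets exactly a given set of dyadic cells
  of level \<open>n\<close> converges. The limits are the weights of a tree, which is realized by nested intervals
  in \<open>[0, c)\<close>; a point of \<open>[0, c)\<close> thus selects a consistent sequence of cell patterns, hence a
  compact set, and the image of Lebesgue measure is the limit measure.
\<close>

section \<open>Approximation in coarse sigma-fields\<close>

text \<open>The product coarse \<sigma>-field is given only as an intersection. Density of the
  rectangle algebra in it is therefore obtained by exhibiting a competitor: the limits of that
  algebra form a coarse \<sigma>-field. The delicate condition is countable generation, since a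
  countable family generating \<open>\<A>\<close> need not contain sets that depend on a given
  window; nearby window sets are chosen instead, as for subspaces of separable metric spaces. All
  approximation of \<open>x\<close> takes place in the L2 norm. The square root of a spectral mass
  is the norm of a projection, so it is 1-Lipschitz there, uniformly in \<open>i\<close>; this
  explains the square roots in the estimates. Half-open cells give disjoint windows and match the
  floor function, but limits of sets require closed cells. The two meet in the notion of a set that
  fits a pattern: two sets fitting one pattern of level \<open>n\<close> are within
  \<open>1 / 2 ^ n\<close> of each other, on whichever side of a cell boundary their points lie.
  Tightness ensures that on each level the limit weights sum to the limit of the total masses, so
  that no mass escapes.\<close>

lemma convergent_approx:
  fixes y :: "nat \<Rightarrow> 'a::banach"
  assumes "\<And>\<epsilon>. \<epsilon> > 0 \<Longrightarrow> \<exists>z. convergent z \<and> (\<forall>\<^sub>F i in sequentially. norm (y i - z i) \<le> \<epsilon>)"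
  shows "convergent y"
proof -
  have "Cauchy y"
  proof (rule metric_CauchyI)
    fix e :: real assume e: "e > 0"
    then obtain z where z: "convergent z" "\<forall>\<^sub>F i in sequentially. norm (y i - z i) \<le> e / 4"
      using assms[of "e/4"] by auto
    obtain N1 where N1: "\<And>i. i \<ge> N1 \<Longrightarrow> norm (y i - z i) \<le> e / 4"
      using z(2) by (auto simp: eventually_sequentially)
    have "Cauchy z" using z(1) by (rule convergent_Cauchy)
    then obtain N2 where N2: "\<And>i j. i \<ge> N2 \<Longrightarrow> j \<ge> N2 \<Longrightarrow> dist (z i) (z j) < e / 4"
      using e metric_CauchyD[of z "e/4"] by auto
    have "dist (y i) (y j) < e" if "i \<ge> max N1 N2" "j \<ge> max N1 N2" for i j
    proof -
      have eq: "(y i - z i) + (z i - z j) - (y j - z j) = y i - y j" by simp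
      have "norm (y i - y j) \<le> norm (y i - z i) + norm (z i - z j) + norm (y j - z j)"
        using order_trans[OF norm_triangle_ineq4[of "(y i - z i) + (z i - z j)" "y j - z j"]
          add_right_mono[OF norm_triangle_ineq[of "y i - z i" "z i - z j"]]] unfolding eq .
      moreover have "norm (y i - z i) \<le> e / 4" "norm (y j - z j) \<le> e / 4" "norm (z i - z j) < e / 4"
        using N1[of i] N1[of j] N2[of i j] that by (auto simp: dist_norm)
      ultimately show ?thesis using e unfolding dist_norm by linarith
    qed
    then show "\<exists>M. \<forall>m\<ge>M. \<forall>n\<ge>M. dist (y m) (y n) < e" by blast
  qed
  then show ?thesis by (rule Cauchy_convergent)
qed

section \<open>Boolean algebras of coarse sets and the pseudometric of symmetric differences\<close>

definition coarse_dist :: "(nat \<Rightarrow> 'a measure) \<Rightarrow> nat \<Rightarrow> (nat \<times> 'a) set \<Rightarrow> (nat \<times> 'a) set \<Rightarrow> real" where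
  "coarse_dist M i A B = measure (M i) ((A - B \<union> (B - A)) `` {i})"

definition coarse_algebra :: "(nat \<Rightarrow> 'a measure) \<Rightarrow> (nat \<times> 'a) set set \<Rightarrow> bool" where
  "coarse_algebra M \<G> \<longleftrightarrow> (\<forall>A\<in>\<G>. coarse_set M A) \<and> {} \<in> \<G> \<and>
     (\<forall>A\<in>\<G>. \<forall>B\<in>\<G>. A \<inter> B \<in> \<G> \<and> A \<union> B \<in> \<G> \<and> coarse_union M - A \<in> \<G>)"

text \<open>The bound is asked for large \<open>i\<close> only: by condition (c) a coarse set may be
  changed at finitely many indices without leaving the collection.\<close>

definition approximable :: "(nat \<Rightarrow> 'a measure) \<Rightarrow> (nat \<times> 'a) set set \<Rightarrow> (nat \<times> 'a) set set" where
  "approximable M \<G> = {C. coarse_set M C \<and>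
     (\<forall>\<epsilon>>0. \<exists>G\<in>\<G>. \<forall>\<^sub>F i in sequentially. coarse_dist M i C G < \<epsilon>)}"

text \<open>Built from inside by the Boolean operations, so that properties of its members can be
  proved by induction and its countability by levels.\<close>

inductive_set generated_algebra :: "(nat \<Rightarrow> 'a measure) \<Rightarrow> (nat \<times> 'a) set set \<Rightarrow> (nat \<times> 'a) set set"
  for M \<G> where
  empty: "{} \<in> generated_algebra M \<G>"
| base: "A \<in> \<G> \<Longrightarrow> A \<in> generated_algebra M \<G>"
| inter: "A \<in> generated_algebra M \<G> \<Longrightarrow> B \<in> generated_algebra M \<G> \<Longrightarrow> A \<inter> B \<in> generated_algebra M \<G>"
| union: "A \<in> generated_algebra M \<G> \<Longrightarrow> B \<in> generated_algebra M \<G> \<Longrightarrow> A \<union> B \<in> generated_algebra M \<G>"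
| compl: "A \<in> generated_algebra M \<G> \<Longrightarrow> coarse_union M - A \<in> generated_algebra M \<G>"

text \<open>Applying the operations once to a countable family leaves it countable. The levels
  increase, so two sets of the algebra always lie on a common level and their combination lies on
  the next one.\<close>

lemma countable_generated_algebra:
  assumes "countable \<G>"
  shows "countable (generated_algebra M \<G>)"
proof -
  define next_level where "next_level L = L \<union> (\<lambda>(A, B). A \<inter> B) ` (L \<times> L) \<union> (\<lambda>(A, B). A \<union> B) ` (L \<times> L)
     \<union> (\<lambda>A. coarse_union M - A) ` L" for L
  define L where "L n = (next_level ^^ n) (insert {} \<G>)" for n
  have L_Suc: "L (Suc n) = next_level (L n)" for n by (simp add: L_def)
  have "countable (L n)" for n
  proof (induction n)
    case (Suc n)
    then show ?case unfolding L_Suc next_level_def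
      by (intro countable_Un countable_image countable_SIGMA) auto
  qed (use assms in \<open>simp add: L_def\<close>)
  then have "countable (\<Union>n. L n)" by blast
  moreover have mono: "L m \<subseteq> L n" if "m \<le> n" for m n
    by (rule lift_Suc_mono_le[OF _ that]) (auto simp: L_Suc next_level_def)
  have "A \<in> (\<Union>n. L n)" if "A \<in> generated_algebra M \<G>" for A
    using that
  proof induction
    case empty
    have "{} \<in> L 0" by (simp add: L_def)
    then show ?case by blast
  next
    case (base A)
    then have "A \<in> L 0" by (simp add: L_def)
    then show ?case by blast
  next
    case (inter A B)
    then obtain m n where "A \<in> L m" "B \<in> L n" by blast
    then have "A \<in> L (max m n)" "B \<in> L (max m n)" using mono[of m "max m n"] mono[of n "max m n"] by auto
    then have "A \<inter> B \<in> L (Suc (max m n))" unfolding L_Suc next_level_def by force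
    then show ?case by blast
  next
    case (union A B)
    then obtain m n where "A \<in> L m" "B \<in> L n" by blast
    then have "A \<in> L (max m n)" "B \<in> L (max m n)" using mono[of m "max m n"] mono[of n "max m n"] by auto
    then have "A \<union> B \<in> L (Suc (max m n))" unfolding L_Suc next_level_def by force
    then show ?case by blast
  next
    case (compl A)
    then obtain m where "A \<in> L m" by blast
    then have "coarse_union M - A \<in> L (Suc m)" unfolding L_Suc next_level_def by force
    then show ?case by blast
  qed
  then have "generated_algebra M \<G> \<subseteq> (\<Union>n. L n)" by blast
  ultimately show ?thesis using countable_subset by blast
qed

lemma coarse_set_Int: "coarse_set M A \<Longrightarrow> coarse_set M B \<Longrightarrow> coarse_set M (A \<inter> B)"
  unfolding coarse_set_def by (auto simp: Image_singleton Collect_conj_eq)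

lemma coarse_set_Un: "coarse_set M A \<Longrightarrow> coarse_set M B \<Longrightarrow> coarse_set M (A \<union> B)"
  unfolding coarse_set_def by (auto simp: Image_singleton Collect_disj_eq)

lemma coarse_union_section: "i \<ge> 1 \<Longrightarrow> coarse_union M `` {i} = space (M i)"
  by (auto simp: coarse_union_def)

lemma Diff_section: "(A - B) `` {i} = A `` {i} - B `` {i}"
  by auto

lemma coarse_set_Diff: "coarse_set M A \<Longrightarrow> coarse_set M B \<Longrightarrow> coarse_set M (A - B)"
  unfolding coarse_set_def by (auto simp: Diff_section)

lemma coarse_set_coarse_union: "coarse_set M (coarse_union M)"
  unfolding coarse_set_def by (auto simp: coarse_union_section)

lemma coarse_set_empty: "coarse_set M {}"
  unfolding coarse_set_def by auto

lemmas coarse_set_intros = coarse_set_Int coarse_set_Un coarse_set_Diff coarse_set_coarse_union coarse_set_empty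

lemma coarse_set_section: "coarse_set M A \<Longrightarrow> i \<ge> 1 \<Longrightarrow> A `` {i} \<in> sets (M i)"
  unfolding coarse_set_def by auto

lemma generated_algebra_algebra:
  assumes "\<And>A. A \<in> \<G> \<Longrightarrow> coarse_set M A"
  shows "coarse_algebra M (generated_algebra M \<G>)"
proof -
  have "coarse_set M A" if "A \<in> generated_algebra M \<G>" for A
    using that
    by induction (rule coarse_set_intros assms; assumption?; rule coarse_set_coarse_union)+
  then show ?thesis unfolding coarse_algebra_def
    by (auto intro: generated_algebra.empty generated_algebra.inter generated_algebra.union generated_algebra.compl)
qed

lemma coarse_algebraD:
  assumes "coarse_algebra M \<G>"
  shows "A \<in> \<G> \<Longrightarrow> coarse_set M A" "{} \<in> \<G>"
    "A \<in> \<G> \<Longrightarrow> B \<in> \<G> \<Longrightarrow> A \<inter> B \<in> \<G>" "A \<in> \<G> \<Longrightarrow> B \<in> \<G> \<Longrightarrow> A \<union> B \<in> \<G>"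
    "A \<in> \<G> \<Longrightarrow> coarse_union M - A \<in> \<G>"
  using assms unfolding coarse_algebra_def by blast+

lemma generated_algebra_minimal:
  assumes "coarse_algebra M \<H>" "\<G> \<subseteq> \<H>"
  shows "generated_algebra M \<G> \<subseteq> \<H>"
proof
  fix A assume "A \<in> generated_algebra M \<G>"
  then show "A \<in> \<H>"
  proof induction
    case (base A)
    then show ?case using assms(2) by blast
  qed (rule coarse_algebraD(2-)[OF assms(1)]; assumption)+
qed

locale prob_spaces =
  fixes M :: "nat \<Rightarrow> 'a measure"
  assumes prob: "i \<ge> 1 \<Longrightarrow> prob_space (M i)"
begin

lemma measure_section_mono:
  assumes "A `` {i} \<subseteq> B `` {i}" "coarse_set M B" "i \<ge> 1"
  shows "measure (M i) (A `` {i}) \<le> measure (M i) (B `` {i})"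
proof -
  interpret prob_space "M i" by (rule prob[OF assms(3)])
  show ?thesis using assms by (intro finite_measure_mono coarse_set_section)
qed

lemma measure_section_le_add:
  assumes "A `` {i} \<subseteq> B `` {i} \<union> C `` {i}" "coarse_set M B" "coarse_set M C" "i \<ge> 1"
  shows "measure (M i) (A `` {i}) \<le> measure (M i) (B `` {i}) + measure (M i) (C `` {i})"
proof -
  interpret prob_space "M i" by (rule prob[OF assms(4)])
  have "measure (M i) (A `` {i}) \<le> measure (M i) (B `` {i} \<union> C `` {i})"
    using assms by (intro finite_measure_mono sets.Un coarse_set_section)
  also have "\<dots> \<le> measure (M i) (B `` {i}) + measure (M i) (C `` {i})"
    using assms by (intro measure_Un_le coarse_set_section)
  finally show ?thesis .
qed

lemma coarse_dist_nonneg: "0 \<le> coarse_dist M i A B"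
  by (simp add: coarse_dist_def)

lemma coarse_dist_commute: "coarse_dist M i A B = coarse_dist M i B A"
  by (simp add: coarse_dist_def Un_commute)

lemma coarse_dist_self [simp]: "coarse_dist M i A A = 0"
  by (simp add: coarse_dist_def)

lemma coarse_dist_triangle:
  assumes "coarse_set M A" "coarse_set M B" "coarse_set M C" "i \<ge> 1"
  shows "coarse_dist M i A C \<le> coarse_dist M i A B + coarse_dist M i B C"
  unfolding coarse_dist_def using assms by (intro measure_section_le_add coarse_set_intros) auto

lemma coarse_dist_Int:
  assumes "coarse_set M A" "coarse_set M B" "coarse_set M A'" "coarse_set M B'" "i \<ge> 1"
  shows "coarse_dist M i (A \<inter> A') (B \<inter> B') \<le> coarse_dist M i A B + coarse_dist M i A' B'"
  unfolding coarse_dist_def using assms by (intro measure_section_le_add coarse_set_intros) auto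

lemma coarse_dist_Un:
  assumes "coarse_set M A" "coarse_set M B" "coarse_set M A'" "coarse_set M B'" "i \<ge> 1"
  shows "coarse_dist M i (A \<union> A') (B \<union> B') \<le> coarse_dist M i A B + coarse_dist M i A' B'"
  unfolding coarse_dist_def using assms by (intro measure_section_le_add coarse_set_intros) auto

lemma coarse_dist_compl:
  assumes "coarse_set M A" "coarse_set M B" "i \<ge> 1"
  shows "coarse_dist M i (coarse_union M - A) (coarse_union M - B) \<le> coarse_dist M i A B"
  unfolding coarse_dist_def using assms by (intro measure_section_mono coarse_set_intros) auto

lemma measure_diff_le_coarse_dist:
  assumes "coarse_set M A" "coarse_set M B" "i \<ge> 1"
  shows "\<bar>measure (M i) (A `` {i}) - measure (M i) (B `` {i})\<bar> \<le> coarse_dist M i A B"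
proof -
  have "measure (M i) (A `` {i}) \<le> measure (M i) (B `` {i}) + coarse_dist M i A B"
    "measure (M i) (B `` {i}) \<le> measure (M i) (A `` {i}) + coarse_dist M i A B"
    unfolding coarse_dist_def using assms by (intro measure_section_le_add coarse_set_intros; auto)+
  then show ?thesis by linarith
qed

lemma approximableI:
  assumes "coarse_set M C"
    "\<And>\<epsilon>. \<epsilon> > 0 \<Longrightarrow> \<exists>G\<in>\<G>. \<forall>\<^sub>F i in sequentially. i \<ge> 1 \<longrightarrow> coarse_dist M i C G < \<epsilon>"
  shows "C \<in> approximable M \<G>"
proof -
  have "\<exists>G\<in>\<G>. \<forall>\<^sub>F i in sequentially. coarse_dist M i C G < \<epsilon>" if e: "\<epsilon> > 0" for \<epsilon>
  proof -
    obtain G where G: "G \<in> \<G>" "\<forall>\<^sub>F i in sequentially. i \<ge> 1 \<longrightarrow> coarse_dist M i C G < \<epsilon>"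
      using assms(2)[OF e] by blast
    have "\<forall>\<^sub>F i in sequentially. coarse_dist M i C G < \<epsilon>"
      using G(2) eventually_ge_at_top[of "1::nat"] by eventually_elim auto
    with G(1) show ?thesis by blast
  qed
  then show ?thesis using assms(1) by (simp add: approximable_def)
qed

lemma approximableE:
  assumes "C \<in> approximable M \<G>" "\<epsilon> > 0"
  obtains G where "G \<in> \<G>" "\<forall>\<^sub>F i in sequentially. coarse_dist M i C G < \<epsilon>"
  using assms by (auto simp: approximable_def)

lemma approximable_coarse_set: "C \<in> approximable M \<G> \<Longrightarrow> coarse_set M C"
  by (simp add: approximable_def)

lemma approximable_base: "coarse_set M A \<Longrightarrow> A \<in> \<G> \<Longrightarrow> A \<in> approximable M \<G>"
  by (auto simp: approximable_def intro!: bexI[of _ A])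

text \<open>The triangle inequality: a limit of limits is a limit. It is used both to compare two
  algebras and to remove a second layer of approximation.\<close>

lemma approximable_trans:
  assumes "\<And>G. G \<in> \<G> \<Longrightarrow> G \<in> approximable M \<G>'" "\<And>G. G \<in> \<G>' \<Longrightarrow> coarse_set M G"
  shows "approximable M \<G> \<subseteq> approximable M \<G>'"
proof
  fix C assume C: "C \<in> approximable M \<G>"
  show "C \<in> approximable M \<G>'"
  proof (rule approximableI)
    show "coarse_set M C" using C by (rule approximable_coarse_set)
    fix \<epsilon> :: real assume "\<epsilon> > 0"
    then have e: "\<epsilon> / 2 > 0" by simp
    obtain G where G: "G \<in> \<G>" "\<forall>\<^sub>F i in sequentially. coarse_dist M i C G < \<epsilon> / 2"
      using approximableE[OF C e] by blast
    obtain G' where G': "G' \<in> \<G>'" "\<forall>\<^sub>F i in sequentially. coarse_dist M i G G' < \<epsilon> / 2"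
      using approximableE[OF assms(1)[OF G(1)] e] by blast
    have "\<forall>\<^sub>F i in sequentially. i \<ge> 1 \<longrightarrow> coarse_dist M i C G' < \<epsilon>"
      using G(2) G'(2)
    proof eventually_elim
      case (elim i)
      have "coarse_dist M i C G' \<le> coarse_dist M i C G + coarse_dist M i G G'" if "i \<ge> 1"
        using coarse_dist_triangle[of C G G' i] approximable_coarse_set[OF C] assms(2)[OF G'(1)]
          approximable_coarse_set[OF assms(1)[OF G(1)]] that by blast
      then show ?case using elim by auto
    qed
    with G'(1) show "\<exists>G\<in>\<G>'. \<forall>\<^sub>F i in sequentially. i \<ge> 1 \<longrightarrow> coarse_dist M i C G < \<epsilon>" by blast
  qed
qed

text \<open>A single argument with two halves of \<epsilon> for all Boolean operations; the
  complement is treated as a binary operation that ignores its second argument.\<close>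

lemma approximable_binary:
  assumes A: "A \<in> approximable M \<G>" and B: "B \<in> approximable M \<G>"
    and op_set: "coarse_set M (f A B)" and op: "\<And>A B. A \<in> \<G> \<Longrightarrow> B \<in> \<G> \<Longrightarrow> f A B \<in> \<G>"
    and le: "\<And>A' B' i. A' \<in> \<G> \<Longrightarrow> B' \<in> \<G> \<Longrightarrow> i \<ge> 1 \<Longrightarrow>
      coarse_dist M i (f A B) (f A' B') \<le> coarse_dist M i A A' + coarse_dist M i B B'"
  shows "f A B \<in> approximable M \<G>"
proof (rule approximableI[OF op_set])
  fix \<epsilon> :: real assume "\<epsilon> > 0"
  then have e: "\<epsilon> / 2 > 0" by simp
  obtain A' where A': "A' \<in> \<G>" "\<forall>\<^sub>F i in sequentially. coarse_dist M i A A' < \<epsilon> / 2"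
    using approximableE[OF A e] by blast
  obtain B' where B': "B' \<in> \<G>" "\<forall>\<^sub>F i in sequentially. coarse_dist M i B B' < \<epsilon> / 2"
    using approximableE[OF B e] by blast
  have "\<forall>\<^sub>F i in sequentially. i \<ge> 1 \<longrightarrow> coarse_dist M i (f A B) (f A' B') < \<epsilon>"
    using A'(2) B'(2) by eventually_elim (use le[OF A'(1) B'(1)] in fastforce)
  then show "\<exists>G\<in>\<G>. \<forall>\<^sub>F i in sequentially. i \<ge> 1 \<longrightarrow> coarse_dist M i (f A B) G < \<epsilon>"
    using op[OF A'(1) B'(1)] by blast
qed

context
  fixes \<G> assumes alg: "coarse_algebra M \<G>"
begin

lemma approximable_algebra: "coarse_algebra M (approximable M \<G>)"
  unfolding coarse_algebra_def
proof (intro conjI ballI)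
  note D = coarse_algebraD[OF alg]
  show "{} \<in> approximable M \<G>" by (rule approximable_base[OF coarse_set_empty D(2)])
  fix A B assume A: "A \<in> approximable M \<G>" and B: "B \<in> approximable M \<G>"
  note cs = approximable_coarse_set[OF A] approximable_coarse_set[OF B]
  show "A \<inter> B \<in> approximable M \<G>"
  proof (rule approximable_binary[OF A B, where f = "\<lambda>A B. A \<inter> B"])
    show "coarse_set M (A \<inter> B)" by (rule coarse_set_Int[OF cs])
  qed (rule D(3) coarse_dist_Int[OF cs(1) D(1) cs(2) D(1)]; assumption)+
  show "A \<union> B \<in> approximable M \<G>"
  proof (rule approximable_binary[OF A B, where f = "\<lambda>A B. A \<union> B"])
    show "coarse_set M (A \<union> B)" by (rule coarse_set_Un[OF cs])
  qed (rule D(4) coarse_dist_Un[OF cs(1) D(1) cs(2) D(1)]; assumption)+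
  show "coarse_union M - A \<in> approximable M \<G>"
  proof (rule approximable_binary[OF A A, where f = "\<lambda>A B. coarse_union M - A"])
    show "coarse_set M (coarse_union M - A)" by (rule coarse_set_Diff[OF coarse_set_coarse_union cs(1)])
    fix A' B' i assume A': "A' \<in> \<G>"
    show "coarse_union M - A' \<in> \<G>" by (rule D(5)[OF A'])
    assume "i \<ge> (1::nat)"
    from coarse_dist_compl[OF cs(1) D(1)[OF A'] this] coarse_dist_nonneg[of i A B']
    show "coarse_dist M i (coarse_union M - A) (coarse_union M - A') \<le> coarse_dist M i A A' + coarse_dist M i A B'"
      by linarith
  qed
qed (rule approximable_coarse_set)

end

end

section \<open>Countable operations: collections closed under (b)-(d) and their limits\<close>

context prob_spaces
begin

lemma measure_section_le_SUP:
  assumes "coarse_set M A" "i \<ge> 1"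
  shows "measure (M i) (A `` {i}) \<le> (SUP i\<in>{1..}. measure (M i) (A `` {i}))"
proof (rule cSUP_upper)
  show "bdd_above ((\<lambda>i. measure (M i) (A `` {i})) ` {1..})"
    using prob by (intro bdd_aboveI[of _ 1]) (auto intro: prob_space.prob_le_1)
qed (use assms in auto)

lemma measure_UN_section_le:
  fixes X :: "nat \<Rightarrow> (nat \<times> 'a) set"
  assumes "\<And>k. coarse_set M (X k)" "\<And>k. measure (M i) (X k `` {i}) \<le> b k" "summable b" "i \<ge> 1"
  shows "measure (M i) ((\<Union>k. X k) `` {i}) \<le> suminf b"
proof -
  interpret prob_space "M i" by (rule prob[OF assms(4)])
  have summ: "summable (\<lambda>k. measure (M i) (X k `` {i}))"
    by (rule summable_comparison_test'[OF assms(3), of 0]) (use assms(2) in auto)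
  have "measure (M i) ((\<Union>k. X k) `` {i}) = measure (M i) (\<Union>k. X k `` {i})"
    by (rule arg_cong[of _ _ "measure (M i)"]) blast
  also have "\<dots> \<le> (\<Sum>k. measure (M i) (X k `` {i}))"
    using assms summ by (intro finite_measure_subadditive_countably) (auto intro: coarse_set_section)
  also have "\<dots> \<le> suminf b"
    by (intro suminf_le assms summ)
  finally show ?thesis .
qed

lemma coarse_set_UN:
  fixes X :: "nat \<Rightarrow> (nat \<times> 'a) set"
  assumes "\<And>k. coarse_set M (X k)"
  shows "coarse_set M (\<Union>k. X k)"
proof -
  have "(\<Union>k. X k) `` {i} = (\<Union>k. X k `` {i})" for i by blast
  then show ?thesis using assms unfolding coarse_set_def by (auto intro!: sets.countable_UN)
qed

text \<open>Sets as in (c) are limits of the empty set. In (d) the tail of the series bounds,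
  uniformly in \<open>i\<close>, what a finite union misses, so the countable union is a limit of
  finite unions.\<close>

theorem approximable_closed:
  assumes alg: "coarse_algebra M \<G>"
  shows "coarse_closed M (approximable M \<G>)"
  unfolding coarse_closed_def
proof (intro conjI allI impI)
  note alg' = approximable_algebra[OF alg]
  show "\<forall>A\<in>approximable M \<G>. \<forall>B\<in>approximable M \<G>. A \<inter> B \<in> approximable M \<G> \<and>
      A \<union> B \<in> approximable M \<G> \<and> coarse_union M - A \<in> approximable M \<G>"
    using alg' unfolding coarse_algebra_def by blast
next
  fix A assume A: "coarse_set M A \<and> (\<lambda>i. measure (M i) (A `` {i})) \<longlonglongrightarrow> 0"
  show "A \<in> approximable M \<G>"
  proof (rule approximableI)
    fix \<epsilon> :: real assume "\<epsilon> > 0"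
    then have "\<forall>\<^sub>F i in sequentially. measure (M i) (A `` {i}) < \<epsilon>"
      using A by (intro order_tendstoD) auto
    then show "\<exists>G\<in>\<G>. \<forall>\<^sub>F i in sequentially. i \<ge> 1 \<longrightarrow> coarse_dist M i A G < \<epsilon>"
      using coarse_algebraD(2)[OF alg]
      by (intro bexI[of _ "{}"]) (auto elim!: eventually_mono simp: coarse_dist_def)
  qed (use A in simp)
next
  note alg' = approximable_algebra[OF alg]
  fix A :: "nat \<Rightarrow> (nat \<times> 'a) set"
  define s where "s k = (SUP i\<in>{1..}. measure (M i) (A k `` {i}))" for k
  assume "range A \<subseteq> approximable M \<G> \<and> disjoint_family A \<and>
        summable (\<lambda>k. SUP i\<in>{1..}. measure (M i) (A k `` {i}))"
  then have A: "\<And>k. A k \<in> approximable M \<G>" and s: "summable s" by (auto simp: s_def[abs_def])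
  note A_set = approximable_coarse_set[OF A]
  have finite_union: "(\<Union>k<n. A k) \<in> approximable M \<G>" for n
  proof (induction n)
    case 0
    then show ?case using coarse_algebraD(2)[OF alg'] by simp
  next
    case (Suc n)
    then show ?case using coarse_algebraD(4)[OF alg' A[of n] Suc] by (simp add: lessThan_Suc)
  qed
  \<comment> \<open>The finite unions are themselves only limits of sets of the algebra, hence the
    two layers; \<open>approximable_trans\<close> merges them below.\<close>
  have "(\<Union>k. A k) \<in> approximable M (approximable M \<G>)"
  proof (rule approximableI)
    show "coarse_set M (\<Union>k. A k)" by (rule coarse_set_UN[OF A_set])
    fix \<epsilon> :: real assume "\<epsilon> > 0"
    then obtain n where n: "norm (\<Sum>k. s (k + n)) < \<epsilon>"
      using suminf_exist_split[OF _ s] by blast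
    have "coarse_dist M i (\<Union>k. A k) (\<Union>k<n. A k) < \<epsilon>" if i: "i \<ge> 1" for i
    proof -
      have A': "coarse_set M (\<Union>k. A (k + n))" by (intro coarse_set_UN A_set)
      have "coarse_dist M i (\<Union>k. A k) (\<Union>k<n. A k) \<le> measure (M i) ((\<Union>k. A (k + n)) `` {i})"
        unfolding coarse_dist_def
      proof (rule measure_section_mono[OF _ A' i], intro Image_mono order_refl subsetI)
        fix x assume x: "x \<in> (\<Union>k. A k) - (\<Union>k<n. A k) \<union> ((\<Union>k<n. A k) - (\<Union>k. A k))"
        then obtain k where "x \<in> A k" "\<not> k < n" by blast
        then show "x \<in> (\<Union>k. A (k + n))" by (intro UN_I[of "k - n"]) auto
      qed
      also have "\<dots> \<le> (\<Sum>k. s (k + n))"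
      proof (rule measure_UN_section_le[OF A_set _ summable_ignore_initial_segment[OF s] i])
        show "measure (M i) (A (k + n) `` {i}) \<le> s (k + n)" for k
          unfolding s_def by (rule measure_section_le_SUP[OF A_set i])
      qed
      finally show ?thesis using n by simp
    qed
    then show "\<exists>G\<in>approximable M \<G>. \<forall>\<^sub>F i in sequentially. i \<ge> 1 \<longrightarrow> coarse_dist M i (\<Union>k. A k) G < \<epsilon>"
      using finite_union[of n] by (intro bexI[of _ "\<Union>k<n. A k"] always_eventually) auto
  qed
  also have "\<dots> \<subseteq> approximable M \<G>"
    by (rule approximable_trans) (use coarse_algebraD(1)[OF alg] in auto)
  finally show "(\<Union>k. A k) \<in> approximable M \<G>" .
qed

lemma coarse_closedD:
  assumes "coarse_closed M \<H>"
  shows "A \<in> \<H> \<Longrightarrow> B \<in> \<H> \<Longrightarrow> A \<inter> B \<in> \<H>" "A \<in> \<H> \<Longrightarrow> B \<in> \<H> \<Longrightarrow> A \<union> B \<in> \<H>"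
    "A \<in> \<H> \<Longrightarrow> coarse_union M - A \<in> \<H>"
    "coarse_set M A \<Longrightarrow> (\<lambda>i. measure (M i) (A `` {i})) \<longlonglongrightarrow> 0 \<Longrightarrow> A \<in> \<H>"
    "range X \<subseteq> \<H> \<Longrightarrow> disjoint_family X \<Longrightarrow>
      summable (\<lambda>k. SUP i\<in>{1..}. measure (M i) (X k `` {i})) \<Longrightarrow> (\<Union>k::nat. X k) \<in> \<H>"
proof -
  note c = assms[unfolded coarse_closed_def]
  show "A \<in> \<H> \<Longrightarrow> B \<in> \<H> \<Longrightarrow> A \<inter> B \<in> \<H>" "A \<in> \<H> \<Longrightarrow> B \<in> \<H> \<Longrightarrow> A \<union> B \<in> \<H>"
    "A \<in> \<H> \<Longrightarrow> coarse_union M - A \<in> \<H>"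
    using c[THEN conjunct1] by blast+
  show "coarse_set M A \<Longrightarrow> (\<lambda>i. measure (M i) (A `` {i})) \<longlonglongrightarrow> 0 \<Longrightarrow> A \<in> \<H>"
    using c[THEN conjunct2, THEN conjunct1] by simp
  show "range X \<subseteq> \<H> \<Longrightarrow> disjoint_family X \<Longrightarrow>
      summable (\<lambda>k. SUP i\<in>{1..}. measure (M i) (X k `` {i})) \<Longrightarrow> (\<Union>k::nat. X k) \<in> \<H>"
    by (intro c[THEN conjunct2, THEN conjunct2, rule_format] conjI)
qed

context
  fixes \<H>
  assumes closed: "coarse_closed M \<H>" and sets: "\<And>A. A \<in> \<H> \<Longrightarrow> coarse_set M A"
begin

lemma closed_algebra: "coarse_algebra M \<H>"
proof -
  have "{} \<in> \<H>" by (rule coarse_closedD(4)[OF closed]) (auto simp: coarse_set_empty)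
  then show ?thesis unfolding coarse_algebra_def
    by (intro conjI ballI sets coarse_closedD(1-3)[OF closed])
qed

lemma closed_Diff: "A \<in> \<H> \<Longrightarrow> B \<in> \<H> \<Longrightarrow> A - B \<in> \<H>"
proof -
  assume *: "A \<in> \<H>" "B \<in> \<H>"
  then have "A - B = A \<inter> (coarse_union M - B)"
    using sets[of A] by (auto simp: coarse_set_def)
  then show ?thesis using * coarse_closedD(1,3)[OF closed] by simp
qed

text \<open>Both halves of the symmetric difference have measure tending to 0, so (c) puts them into
  \<open>\<H>\<close>; removing one from \<open>H\<close> and adding the other yields
  \<open>C\<close>.\<close>

lemma closed_negligible_change:
  assumes "H \<in> \<H>" "coarse_set M C" "(\<lambda>i. coarse_dist M i C H) \<longlonglongrightarrow> 0"
  shows "C \<in> \<H>"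
proof -
  have negl: "X \<in> \<H>" if X: "coarse_set M X" "X \<subseteq> (C - H) \<union> (H - C)" for X
  proof (rule coarse_closedD(4)[OF closed X(1)])
    show "(\<lambda>i. measure (M i) (X `` {i})) \<longlonglongrightarrow> 0"
    proof (rule tendsto_sandwich[OF _ _ tendsto_const assms(3)])
      show "\<forall>\<^sub>F i in sequentially. measure (M i) (X `` {i}) \<le> coarse_dist M i C H"
        using eventually_ge_at_top[of 1] unfolding coarse_dist_def
      proof eventually_elim
        case (elim i)
        then show ?case using X(2) assms(2) sets[OF assms(1)]
          by (intro measure_section_mono coarse_set_Un coarse_set_Diff Image_mono order_refl)
      qed
    qed simp
  qed
  have eq: "(H - (H - C)) \<union> (C - H) = C" by blast
  have "H - C \<in> \<H>" "C - H \<in> \<H>"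
    using assms(2) sets[OF assms(1)] by (auto intro!: negl coarse_set_Diff)
  then show ?thesis
    using coarse_closedD(2)[OF closed closed_Diff[OF assms(1)], of "H - C" "C - H"] unfolding eq by blast
qed

text \<open>Condition (d) speaks of disjoint sets. Making the sequence disjoint only shrinks its
  members, so the majorant \<open>b\<close> still bounds the suprema.\<close>

lemma closed_UN:
  assumes X: "\<And>k::nat. X k \<in> \<H>" and le: "\<And>k i. i \<ge> 1 \<Longrightarrow> measure (M i) (X k `` {i}) \<le> b k" and b: "summable b"
  shows "(\<Union>k. X k) \<in> \<H>"
proof -
  have fin: "(\<Union>k<n. X k) \<in> \<H>" for n
  proof (induction n)
    case 0
    then show ?case using coarse_algebraD(2)[OF closed_algebra] by simp
  next
    case (Suc n)
    then show ?case using coarse_closedD(2)[OF closed X[of n] Suc] by (simp add: lessThan_Suc)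
  qed
  have disj: "disjointed X k \<in> \<H>" for k
    unfolding disjointed_def using fin[of k] X[of k] closed_Diff by (simp add: atLeast0LessThan)
  have "(\<Union>k. disjointed X k) \<in> \<H>"
  proof (rule coarse_closedD(5)[OF closed])
    show "disjoint_family (disjointed X)" by (rule disjoint_family_disjointed)
    have SUP_le: "(SUP i\<in>{1..}. measure (M i) (disjointed X k `` {i})) \<le> b k" for k
    proof (rule cSUP_least)
      fix i :: nat assume "i \<in> {1..}"
      then have i: "i \<ge> 1" by simp
      have "measure (M i) (disjointed X k `` {i}) \<le> measure (M i) (X k `` {i})"
        using disjointed_subset[of X k] i sets[OF X] by (intro measure_section_mono Image_mono order_refl)
      then show "measure (M i) (disjointed X k `` {i}) \<le> b k" using le[OF i, of k] by simp
    qed simp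
    have SUP_nonneg: "0 \<le> (SUP i\<in>{1..}. measure (M i) (disjointed X k `` {i}))" for k
      by (rule order_trans[OF measure_nonneg measure_section_le_SUP[OF sets[OF disj], of 1 k]]) simp
    show "summable (\<lambda>k. SUP i\<in>{1..}. measure (M i) (disjointed X k `` {i}))"
      by (rule summable_comparison_test'[OF b, of 0]) (use SUP_le SUP_nonneg in auto)
  qed (use disj in auto)
  then show ?thesis by (simp add: UN_disjointed_eq)
qed

text \<open>
  A limit of elements of \<open>\<H>\<close> agrees up to null sets with the upper limit of a fast converging
  sequence, whose approximation errors are made uniform in \<open>i\<close> by changing each term at finitely many \<open>i\<close>.
\<close>
theorem approximable_subset_closed: "approximable M \<H> \<subseteq> \<H>"
proof
  fix C assume C: "C \<in> approximable M \<H>"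
  note C_set = approximable_coarse_set[OF C]
  define b :: "nat \<Rightarrow> real" where "b k = (1/2) ^ k" for k
  have "\<exists>G\<in>\<H>. \<forall>i\<ge>1. coarse_dist M i C G \<le> b k" for k
  proof -
    have "b k > 0" by (simp add: b_def)
    then obtain H where H: "H \<in> \<H>" "\<forall>\<^sub>F i in sequentially. coarse_dist M i C H < b k"
      using approximableE[OF C] by blast
    then obtain n where n: "\<And>i. i \<ge> n \<Longrightarrow> coarse_dist M i C H < b k"
      by (auto simp: eventually_sequentially)
    define T where "T = {p :: nat \<times> 'a. n \<le> fst p}"
    define G where "G = (H \<inter> T) \<union> (C - T)"
    have G_sec: "G `` {i} = (if n \<le> i then H `` {i} else C `` {i})" for i
      unfolding G_def T_def by auto
    have G_set: "coarse_set M G"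
      using C_set sets[OF H(1)] unfolding coarse_set_def G_sec by (auto simp: G_def)
    have "\<forall>\<^sub>F i in sequentially. coarse_dist M i G H = 0"
      using eventually_ge_at_top[of n] by eventually_elim (simp add: coarse_dist_def Diff_section G_sec Un_Image)
    then have "G \<in> \<H>"
      by (intro closed_negligible_change[OF H(1) G_set] tendsto_eventually)
    moreover have "coarse_dist M i C G \<le> b k" for i
      using n[of i] \<open>b k > 0\<close> by (cases "n \<le> i") (simp_all add: coarse_dist_def Diff_section G_sec Un_Image)
    ultimately show ?thesis by blast
  qed
  then have "\<exists>G. \<forall>k. G k \<in> \<H> \<and> (\<forall>i\<ge>1. coarse_dist M i C (G k) \<le> b k)"
    by (intro choice allI) blast
  then obtain G where G: "\<And>k. G k \<in> \<H>" "\<And>k i. i \<ge> 1 \<Longrightarrow> coarse_dist M i C (G k) \<le> b k"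
    by blast
  note G_set = sets[OF G(1)]
  have b_shift: "(\<lambda>k. b (k + n)) sums (2 * b n)" for n
    using sums_mult2[OF geometric_sums[of "1/2 :: real"], of "b n"] by (simp add: b_def power_add)
  define U where "U n = (\<Union>k. G (k + n))" for n
  have U_in: "U n \<in> \<H>" for n
  proof -
    \<comment> \<open>The measures of the \<open>G k\<close> themselves need not be summable, but
      consecutive terms are close to \<open>C\<close>, hence to each other, so the increments have
      geometrically decreasing measures and \<open>closed_UN\<close> applies to them.\<close>
    have "U n = G n \<union> (\<Union>k. G (Suc k + n) - G (k + n))"
    proof -
      have "x \<in> G n \<union> (\<Union>k. G (Suc k + n) - G (k + n))" if "x \<in> G (k + n)" for x k
        using that by (induction k) auto
      then have "U n \<subseteq> G n \<union> (\<Union>k. G (Suc k + n) - G (k + n))" unfolding U_def by blast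
      moreover have "G n \<union> (\<Union>k. G (Suc k + n) - G (k + n)) \<subseteq> U n"
      proof -
        have "G n \<subseteq> U n" unfolding U_def using UN_upper[of 0 UNIV "\<lambda>k. G (k + n)"] by simp
        moreover have "G (Suc k + n) \<subseteq> U n" for k
          unfolding U_def using UN_upper[of "Suc k" UNIV "\<lambda>k. G (k + n)"] by simp
        ultimately show ?thesis by blast
      qed
      ultimately show ?thesis by (rule equalityI)
    qed
    moreover have "(\<Union>k. G (Suc k + n) - G (k + n)) \<in> \<H>"
    proof (rule closed_UN[where b = "\<lambda>k. 2 * b (k + n)"])
      show "G (Suc k + n) - G (k + n) \<in> \<H>" for k by (intro closed_Diff G)
      show "summable (\<lambda>k. 2 * b (k + n))" using b_shift by (intro summable_mult) (auto simp: sums_iff)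
      fix k i :: nat assume i: "i \<ge> 1"
      have "measure (M i) ((G (Suc k + n) - G (k + n)) `` {i}) \<le> coarse_dist M i (G (Suc k + n)) (G (k + n))"
        unfolding coarse_dist_def using i
        by (intro measure_section_mono coarse_set_Un coarse_set_Diff G_set) auto
      also have "\<dots> \<le> coarse_dist M i (G (Suc k + n)) C + coarse_dist M i C (G (k + n))"
        by (intro coarse_dist_triangle G_set C_set i)
      also have "\<dots> \<le> b (Suc k + n) + b (k + n)"
        using G(2)[OF i] by (simp add: coarse_dist_commute add_mono)
      also have "\<dots> \<le> 2 * b (k + n)" by (simp add: b_def power_add)
      finally show "measure (M i) ((G (Suc k + n) - G (k + n)) `` {i}) \<le> 2 * b (k + n)" .
    qed
    ultimately show ?thesis using coarse_closedD(2)[OF closed G(1)] by simp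
  qed
  note U_set = sets[OF U_in]
  have U_diff: "measure (M i) ((U n - C) `` {i}) \<le> 2 * b n" if i: "i \<ge> 1" for i n
  proof -
    have "U n - C = (\<Union>k. G (k + n) - C)" by (auto simp: U_def)
    moreover have "measure (M i) ((\<Union>k. G (k + n) - C) `` {i}) \<le> (\<Sum>k. b (k + n))"
    proof (rule measure_UN_section_le[OF _ _ _ i])
      show "coarse_set M (G (k + n) - C)" for k by (intro coarse_set_Diff G_set C_set)
      fix k
      have "measure (M i) ((G (k + n) - C) `` {i}) \<le> coarse_dist M i C (G (k + n))"
        unfolding coarse_dist_def using i C_set
        by (intro measure_section_mono coarse_set_Un coarse_set_Diff G_set) auto
      then show "measure (M i) ((G (k + n) - C) `` {i}) \<le> b (k + n)" using G(2)[OF i, of "k + n"] by simp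
      show "summable (\<lambda>k. b (k + n))" using b_shift by (auto simp: sums_iff)
    qed
    ultimately show ?thesis using b_shift by (simp add: sums_iff)
  qed
  have b_lim: "(\<lambda>k. b k) \<longlonglongrightarrow> 0" unfolding b_def by (rule LIMSEQ_realpow_zero) auto
  have C_diff: "measure (M i) ((C - U n) `` {i}) = 0" if i: "i \<ge> 1" for i n
  proof -
    have "measure (M i) ((C - U n) `` {i}) \<le> b (k + n)" for k
    proof -
      have "measure (M i) ((C - U n) `` {i}) \<le> coarse_dist M i C (G (k + n))"
        unfolding coarse_dist_def using i C_set
        by (intro measure_section_mono coarse_set_Un coarse_set_Diff G_set) (auto simp: U_def)
      then show ?thesis using G(2)[OF i, of "k + n"] by simp
    qed
    then have "measure (M i) ((C - U n) `` {i}) \<le> 0"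
      using LIMSEQ_ignore_initial_segment[OF b_lim, of n] by (intro tendsto_lowerbound) auto
    then show ?thesis by (simp add: measure_le_0_iff)
  qed
  define L where "L = (\<Inter>n. U n)"
  \<comment> \<open>The decreasing intersection is reached through a union again: \<open>L\<close>
    is \<open>U 0\<close> minus all the losses, and each loss is contained, up to a null set, in the
    small set \<open>U n - C\<close>.\<close>
  have "(\<Union>n. U n - U (Suc n)) \<in> \<H>"
  proof (rule closed_UN[where b = "\<lambda>n. 2 * b n"])
    show "U n - U (Suc n) \<in> \<H>" for n by (intro closed_Diff U_in)
    show "summable (\<lambda>k. 2 * b k)" using b_shift[of 0] by (intro summable_mult) (auto simp: sums_iff)
    fix n i :: nat assume i: "i \<ge> 1"
    have "measure (M i) ((U n - U (Suc n)) `` {i}) \<le> measure (M i) ((U n - C) `` {i}) + measure (M i) ((C - U (Suc n)) `` {i})"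
      using i C_set by (intro measure_section_le_add coarse_set_Diff U_set) auto
    then show "measure (M i) ((U n - U (Suc n)) `` {i}) \<le> 2 * b n"
      using U_diff[OF i, of n] C_diff[OF i, of "Suc n"] by simp
  qed
  moreover have "L = U 0 - (\<Union>n. U n - U (Suc n))"
  proof -
    have U0: "U n \<subseteq> U 0" for n unfolding U_def by auto
    have "x \<in> U n" if "x \<in> U 0 - (\<Union>n. U n - U (Suc n))" for x n
      using that by (induction n) auto
    then show ?thesis using U0 unfolding L_def by blast
  qed
  ultimately have L_in: "L \<in> \<H>" using closed_Diff[OF U_in[of 0]] by simp
  have "coarse_dist M i C L = 0" if i: "i \<ge> 1" for i
  proof -
    have "coarse_dist M i C L \<le> 2 * b n" for n
    proof -
      have 1: "measure (M i) ((\<Union>n. C - U n) `` {i}) \<le> (\<Sum>n::nat. 0)"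
        using i C_set C_diff by (intro measure_UN_section_le coarse_set_Diff U_set) auto
      have "coarse_dist M i C L \<le> measure (M i) ((\<Union>n. C - U n) `` {i}) + measure (M i) ((U n - C) `` {i})"
        unfolding coarse_dist_def using i C_set
        by (intro measure_section_le_add coarse_set_UN coarse_set_Diff U_set) (auto simp: L_def)
      then show ?thesis using U_diff[OF i, of n] 1 by simp
    qed
    then have "coarse_dist M i C L \<le> 0"
      using LIMSEQ_le_const[OF tendsto_mult[OF tendsto_const[of 2] b_lim]] by simp
    then show ?thesis using coarse_dist_nonneg[of i C L] by simp
  qed
  then have "\<forall>\<^sub>F i in sequentially. coarse_dist M i C L = 0"
    by (rule eventually_mono[OF eventually_ge_at_top])
  then show "C \<in> \<H>"
    by (intro closed_negligible_change[OF L_in C_set] tendsto_eventually)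
qed

end

lemma approximable_mono: "\<G> \<subseteq> \<G>' \<Longrightarrow> approximable M \<G> \<subseteq> approximable M \<G>'"
  unfolding approximable_def by blast

lemma coarse_closed_Inter:
  assumes T: "\<And>\<H>. \<H> \<in> T \<Longrightarrow> coarse_closed M \<H>"
  shows "coarse_closed M (\<Inter>T)"
  unfolding coarse_closed_def
proof (intro conjI ballI allI impI InterI)
  fix \<H> A B assume "\<H> \<in> T" "A \<in> \<Inter>T" "B \<in> \<Inter>T"
  then have "coarse_closed M \<H>" "A \<in> \<H>" "B \<in> \<H>" using T by auto
  then show "A \<inter> B \<in> \<H>" "A \<union> B \<in> \<H>" "coarse_union M - A \<in> \<H>"
    by (simp_all add: coarse_closedD)
next
  fix \<H> A assume "\<H> \<in> T" "coarse_set M A \<and> (\<lambda>i. measure (M i) (A `` {i})) \<longlonglongrightarrow> 0"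
  then show "A \<in> \<H>" using coarse_closedD(4)[OF T] by blast
next
  fix \<H> and A :: "nat \<Rightarrow> (nat \<times> 'a) set"
  assume \<H>: "\<H> \<in> T" and A: "range A \<subseteq> \<Inter>T \<and> disjoint_family A \<and>
    summable (\<lambda>k. SUP i\<in>{1..}. measure (M i) (A k `` {i}))"
  then have "range A \<subseteq> \<H>" by blast
  with A show "(\<Union>k. A k) \<in> \<H>" using coarse_closedD(5)[OF T[OF \<H>]] by blast
qed

text \<open>Separability in the pseudometric: the algebra generated by a countable generating family
  is still countable, and its limits form a closed collection containing the generators, hence all
  of \<open>\<A>\<close> by minimality of the hull.\<close>

lemma coarse_sigma_field_separable:
  assumes "coarse_sigma_field M \<A>"
  obtains \<G> where "countable \<G>" "coarse_algebra M \<G>" "\<G> \<subseteq> \<A>" "\<A> \<subseteq> approximable M \<G>"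
proof -
  obtain \<B> where \<B>: "\<B> \<subseteq> \<A>" "countable \<B>" "coarse_closed M hull \<B> = \<A>"
    using assms unfolding coarse_sigma_field_def by blast
  have sets: "\<And>A. A \<in> \<A> \<Longrightarrow> coarse_set M A" and closed: "coarse_closed M \<A>"
    using assms unfolding coarse_sigma_field_def by blast+
  have alg: "coarse_algebra M (generated_algebra M \<B>)"
    using \<B>(1) sets by (intro generated_algebra_algebra) blast
  show thesis
  proof
    show "countable (generated_algebra M \<B>)" by (rule countable_generated_algebra[OF \<B>(2)])
    show "coarse_algebra M (generated_algebra M \<B>)" by (rule alg)
    show "generated_algebra M \<B> \<subseteq> \<A>"
      by (rule generated_algebra_minimal[OF closed_algebra[OF closed sets] \<B>(1)])
    have "\<B> \<subseteq> approximable M (generated_algebra M \<B>)"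
      using \<B>(1) sets by (auto intro!: approximable_base generated_algebra.base)
    then have "coarse_closed M hull \<B> \<subseteq> approximable M (generated_algebra M \<B>)"
      by (rule hull_minimal) (rule approximable_closed[OF alg])
    then show "\<A> \<subseteq> approximable M (generated_algebra M \<B>)" using \<B>(3) by simp
  qed
qed

text \<open>For countable generation, the hull of the dense countable algebra is closed and
  therefore contains its own limits by \<open>approximable_subset_closed\<close>, which are all sets
  in question. Convergence of measures survives because measures are 1-Lipschitz in the
  pseudometric.\<close>

lemma approximable_sigma_field:
  assumes alg: "coarse_algebra M \<G>" and conv: "\<And>G. G \<in> \<G> \<Longrightarrow> convergent (\<lambda>i. measure (M i) (G `` {i}))"
    and alg0: "coarse_algebra M \<G>\<^sub>0" and countable: "countable \<G>\<^sub>0"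
    and subset: "\<G>\<^sub>0 \<subseteq> \<G>" and dense: "\<G> \<subseteq> approximable M \<G>\<^sub>0"
  shows "coarse_sigma_field M (approximable M \<G>)"
  unfolding coarse_sigma_field_def
proof (intro conjI ballI)
  show closed: "coarse_closed M (approximable M \<G>)" by (rule approximable_closed[OF alg])
  have G0: "\<G>\<^sub>0 \<subseteq> approximable M \<G>"
    using subset coarse_algebraD(1)[OF alg] by (auto intro!: approximable_base)
  have hull: "coarse_closed M hull \<G>\<^sub>0 \<subseteq> approximable M \<G>"
    by (rule hull_minimal) (rule G0 closed)+
  have hull_closed: "coarse_closed M (coarse_closed M hull \<G>\<^sub>0)"
    by (rule hull_in) (rule coarse_closed_Inter, blast)
  have "approximable M \<G> \<subseteq> approximable M \<G>\<^sub>0"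
    using dense coarse_algebraD(1)[OF alg0] by (intro approximable_trans) auto
  also have "\<dots> \<subseteq> approximable M (coarse_closed M hull \<G>\<^sub>0)"
    by (rule approximable_mono) (rule hull_subset)
  also have "\<dots> \<subseteq> coarse_closed M hull \<G>\<^sub>0"
    using hull approximable_coarse_set by (intro approximable_subset_closed hull_closed) blast
  finally have "coarse_closed M hull \<G>\<^sub>0 = approximable M \<G>" using hull by blast
  then show "\<exists>\<B>\<subseteq>approximable M \<G>. countable \<B> \<and> coarse_closed M hull \<B> = approximable M \<G>"
    using countable G0 by blast
next
  fix A assume A: "A \<in> approximable M \<G>"
  show "coarse_set M A" by (rule approximable_coarse_set[OF A])
  show "convergent (\<lambda>i. measure (M i) (A `` {i}))"
  proof (rule convergent_approx)
    fix \<epsilon> :: real assume "\<epsilon> > 0"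
    then obtain G where G: "G \<in> \<G>" "\<forall>\<^sub>F i in sequentially. coarse_dist M i A G < \<epsilon>"
      using approximableE[OF A] by blast
    have "\<forall>\<^sub>F i in sequentially. norm (measure (M i) (A `` {i}) - measure (M i) (G `` {i})) \<le> \<epsilon>"
      using G(2) eventually_ge_at_top[of 1]
    proof eventually_elim
      case (elim i)
      then show ?case
        using measure_diff_le_coarse_dist[OF approximable_coarse_set[OF A] coarse_algebraD(1)[OF alg G(1)], of i]
        by simp
    qed
    then show "\<exists>z. convergent z \<and> (\<forall>\<^sub>F i in sequentially. norm (measure (M i) (A `` {i}) - z i) \<le> \<epsilon>)"
      using conv[OF G(1)] by blast
  qed
qed

end

section \<open>Walsh expansions\<close>

interpretation signs: prob_space sign_space
  unfolding sign_space_def by (rule prob_space_uniform_count_measure) auto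

interpretation sign_product: product_prob_space "\<lambda>_::real. sign_space" I for I
  by unfold_locales

lemma space_sign_space [simp]: "space sign_space = {-1, 1}"
  by (simp add: sign_space_def space_uniform_count_measure)

lemma sets_sign_space [simp]: "sets sign_space = Pow {-1, 1}"
  by (simp add: sign_space_def sets_uniform_count_measure)

lemma borel_measurable_sign_space: "f \<in> sign_space \<rightarrow>\<^sub>M N" if "\<And>x. f x \<in> space N"
  using that by (auto simp: measurable_def)

lemma prob_space_dyadic: "prob_space (dyadic_space i)"
  unfolding dyadic_space_def by (rule prob_space_PiM) (rule signs.prob_space_axioms)

lemma dyadic_sign: "\<omega> \<in> space (dyadic_space i) \<Longrightarrow> m \<in> grid i \<Longrightarrow> \<omega> m = -1 \<or> \<omega> m = 1"
  by (auto simp: dyadic_space_def space_PiM PiE_def Pi_def)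

lemma walsh_empty [simp]: "walsh {} \<omega> = 1"
  by (simp add: walsh_def)

lemma walsh_union:
  assumes "finite M" "finite N" "M \<inter> N = {}"
  shows "walsh (M \<union> N) \<omega> = walsh M \<omega> * walsh N \<omega>"
  using assms by (simp add: walsh_def prod.union_disjoint)

lemma cnj_walsh [simp]: "cnj (walsh M \<omega>) = walsh M \<omega>"
  by (simp add: walsh_def)

lemma walsh_mult_self:
  assumes "M \<subseteq> grid i" "\<omega> \<in> space (dyadic_space i)"
  shows "walsh M \<omega> * walsh M \<omega> = 1"
proof -
  have "(\<Prod>m\<in>M. \<omega> m) * (\<Prod>m\<in>M. \<omega> m) = (\<Prod>m\<in>M. \<omega> m * \<omega> m)"
    by (simp add: prod.distrib)
  also have "\<dots> = 1"
    using assms dyadic_sign by (intro prod.neutral ballI) fastforce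
  finally show ?thesis unfolding walsh_def of_real_mult[symmetric] by simp
qed

lemma norm_walsh:
  assumes "M \<subseteq> grid i" "\<omega> \<in> space (dyadic_space i)"
  shows "norm (walsh M \<omega>) = 1"
proof -
  have "norm (walsh M \<omega>) * norm (walsh M \<omega>) = 1"
    using walsh_mult_self[OF assms] by (metis norm_mult norm_one)
  then show ?thesis by (metis abs_norm_cancel abs_square_eq_1 power2_eq_square)
qed

lemma finite_subsetsD: "M \<in> finite_subsets i \<Longrightarrow> finite M" "M \<in> finite_subsets i \<Longrightarrow> M \<subseteq> grid i"
  by (auto simp: finite_subsets_def)

text \<open>The signs occurring in both factors square to 1 and drop out.\<close>

lemma walsh_mult:
  assumes "M \<in> finite_subsets i" "N \<in> finite_subsets i" "\<omega> \<in> space (dyadic_space i)"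
  shows "walsh M \<omega> * walsh N \<omega> = walsh (M - N \<union> (N - M)) \<omega>"
proof -
  note fin = finite_subsetsD(1)[OF assms(1)] finite_subsetsD(1)[OF assms(2)]
  have "walsh M \<omega> = walsh (M - N) \<omega> * walsh (M \<inter> N) \<omega>"
  proof (subst walsh_union[symmetric])
    show "walsh M \<omega> = walsh (M - N \<union> M \<inter> N) \<omega>" by (rule arg_cong[of _ _ "\<lambda>M. walsh M \<omega>"]) blast
  qed (use fin in auto)
  moreover have "walsh N \<omega> = walsh (N - M) \<omega> * walsh (M \<inter> N) \<omega>"
  proof (subst walsh_union[symmetric])
    show "walsh N \<omega> = walsh (N - M \<union> M \<inter> N) \<omega>" by (rule arg_cong[of _ _ "\<lambda>M. walsh M \<omega>"]) blast
  qed (use fin in auto)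
  moreover have "walsh (M \<inter> N) \<omega> * walsh (M \<inter> N) \<omega> = 1"
    using assms finite_subsetsD(2)[OF assms(1)] by (intro walsh_mult_self) auto
  moreover have "walsh (M - N \<union> (N - M)) \<omega> = walsh (M - N) \<omega> * walsh (N - M) \<omega>"
    using fin by (intro walsh_union) auto
  ultimately show ?thesis by algebra
qed

lemma walsh_measurable [measurable]:
  assumes "M \<in> finite_subsets i"
  shows "walsh M \<in> borel_measurable (dyadic_space i)"
proof -
  have "(\<lambda>\<omega>. \<omega> m) \<in> borel_measurable (dyadic_space i)" if "m \<in> M" for m
  proof -
    have "(\<lambda>\<omega>. \<omega> m) \<in> dyadic_space i \<rightarrow>\<^sub>M sign_space"
      unfolding dyadic_space_def using that finite_subsetsD(2)[OF assms]
      by (intro measurable_component_singleton) auto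
    moreover have "(\<lambda>x. x) \<in> sign_space \<rightarrow>\<^sub>M (borel :: real measure)"
      by (rule borel_measurable_sign_space) simp
    ultimately show ?thesis using measurable_compose by blast
  qed
  then have "(\<lambda>\<omega>. complex_of_real (\<Prod>m\<in>M. \<omega> m)) \<in> borel_measurable (dyadic_space i)"
    using measurable_compose[OF borel_measurable_prod[of M "\<lambda>m \<omega>. \<omega> m" "dyadic_space i"] borel_measurable_of_real] by blast
  then show ?thesis by (simp add: walsh_def[abs_def])
qed

text \<open>By independence the integral is the product of the means of the signs, each of which is
  0.\<close>

lemma integral_walsh:
  assumes "M \<in> finite_subsets i"
  shows "(\<integral>\<omega>. walsh M \<omega> \<partial>dyadic_space i) = (if M = {} then 1 else 0)"
proof -
  note M = finite_subsetsD[OF assms]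
  have id_meas: "(\<lambda>x. x) \<in> borel_measurable sign_space"
    by (rule borel_measurable_sign_space) simp
  have "(\<integral>\<omega>. (\<Prod>m\<in>M. \<omega> m) \<partial>dyadic_space i)
    = (\<integral>\<omega>. (\<Prod>m\<in>M. (restrict \<omega> M) m) \<partial>dyadic_space i)" by simp
  also have "\<dots> = (\<integral>\<omega>. (\<Prod>m\<in>M. \<omega> m) \<partial>distr (dyadic_space i) (\<Pi>\<^sub>M m\<in>M. sign_space) (\<lambda>\<omega>. restrict \<omega> M))"
  proof (rule integral_distr[symmetric])
    show "(\<lambda>\<omega>. restrict \<omega> M) \<in> dyadic_space i \<rightarrow>\<^sub>M (\<Pi>\<^sub>M m\<in>M. sign_space)"
      unfolding dyadic_space_def using M(2) by (rule measurable_restrict_subset)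
    show "(\<lambda>\<omega>. \<Prod>m\<in>M. \<omega> m) \<in> borel_measurable (\<Pi>\<^sub>M m\<in>M. sign_space)"
    proof (rule borel_measurable_prod)
      fix m assume "m \<in> M"
      then have "(\<lambda>\<omega>. \<omega> m) \<in> (\<Pi>\<^sub>M m\<in>M. sign_space) \<rightarrow>\<^sub>M sign_space"
        by (rule measurable_component_singleton)
      from measurable_compose[OF this id_meas]
      show "(\<lambda>\<omega>. \<omega> m) \<in> borel_measurable (\<Pi>\<^sub>M m\<in>M. sign_space)" .
    qed
  qed
  also have "\<dots> = (\<integral>\<omega>. (\<Prod>m\<in>M. \<omega> m) \<partial>(\<Pi>\<^sub>M m\<in>M. sign_space))"
    unfolding dyadic_space_def using sign_product.distr_PiM_restrict_finite[OF M] by simp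
  also have "\<dots> = (\<Prod>m\<in>M. \<integral>x. x \<partial>sign_space)"
    using M(1) id_meas
    by (intro sign_product.product_integral_prod signs.integrable_const_bound[of _ 1] AE_I2) auto
  also have "(\<integral>x. x \<partial>sign_space) = 0"
    by (simp add: sign_space_def integral_uniform_count_measure)
  finally have "(\<integral>\<omega>. (\<Prod>m\<in>M. \<omega> m) \<partial>dyadic_space i) = (if M = {} then 1 else 0)"
    using M(1) by (auto simp: prod_constant)
  moreover have "(\<integral>\<omega>. walsh M \<omega> \<partial>dyadic_space i) = complex_of_real (\<integral>\<omega>. (\<Prod>m\<in>M. \<omega> m) \<partial>dyadic_space i)"
    unfolding walsh_def by (rule integral_complex_of_real)
  ultimately show ?thesis by simp
qed

lemma finite_subsets_sym_diff:
  "M \<in> finite_subsets i \<Longrightarrow> N \<in> finite_subsets i \<Longrightarrow> M - N \<union> (N - M) \<in> finite_subsets i"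
  by (auto simp: finite_subsets_def)

lemma integral_walsh_mult:
  assumes "M \<in> finite_subsets i" "N \<in> finite_subsets i"
  shows "(\<integral>\<omega>. walsh M \<omega> * walsh N \<omega> \<partial>dyadic_space i) = (if M = N then 1 else 0)"
proof -
  have "(\<integral>\<omega>. walsh M \<omega> * walsh N \<omega> \<partial>dyadic_space i) = (\<integral>\<omega>. walsh (M - N \<union> (N - M)) \<omega> \<partial>dyadic_space i)"
    by (intro Bochner_Integration.integral_cong refl walsh_mult[OF assms])
  also have "\<dots> = (if M - N \<union> (N - M) = {} then 1 else 0)"
    by (rule integral_walsh[OF finite_subsets_sym_diff[OF assms]])
  finally show ?thesis by (auto split: if_splits)
qed

lemma integrable_mult_walsh:
  assumes "integrable (dyadic_space i) f" "M \<in> finite_subsets i"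
  shows "integrable (dyadic_space i) (\<lambda>\<omega>. f \<omega> * walsh M \<omega>)"
proof (rule Bochner_Integration.integrable_bound[OF assms(1)])
  show "(\<lambda>\<omega>. f \<omega> * walsh M \<omega>) \<in> borel_measurable (dyadic_space i)"
    using borel_measurable_integrable[OF assms(1)] walsh_measurable[OF assms(2)] by measurable
  show "AE \<omega> in dyadic_space i. norm (f \<omega> * walsh M \<omega>) \<le> norm (f \<omega>)"
    using norm_walsh[OF finite_subsetsD(2)[OF assms(2)]] by (intro AE_I2) (simp add: norm_mult)
qed

lemma integrable_walsh: "M \<in> finite_subsets i \<Longrightarrow> integrable (dyadic_space i) (walsh M)"
proof -
  interpret prob_space "dyadic_space i" by (rule prob_space_dyadic)
  assume "M \<in> finite_subsets i"
  then show ?thesis using integrable_mult_walsh[of i "\<lambda>_. 1" M] by simp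
qed

lemma square_integrable_integrable:
  assumes "square_integrable (dyadic_space i) f"
  shows "integrable (dyadic_space i) f"
proof (rule Bochner_Integration.integrable_bound)
  interpret prob_space "dyadic_space i" by (rule prob_space_dyadic)
  show "integrable (dyadic_space i) (\<lambda>\<omega>. 1 + (cmod (f \<omega>))\<^sup>2)"
    using assms by (simp add: square_integrable_def)
  show "f \<in> borel_measurable (dyadic_space i)" using assms by (simp add: square_integrable_def)
  have "t \<le> 1 + t\<^sup>2" if "0 \<le> t" for t :: real
    using sum_power2_ge_zero[of "t - 1/2" 0] by (simp add: power2_eq_square algebra_simps)
  then show "AE \<omega> in dyadic_space i. norm (f \<omega>) \<le> norm (1 + (cmod (f \<omega>))\<^sup>2)"
    by (intro AE_I2) (simp add: abs_of_nonneg)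
qed

lemma walsh_coeff_lin:
  assumes "integrable (dyadic_space i) f" "integrable (dyadic_space i) g" "M \<in> finite_subsets i"
  shows "walsh_coeff i (\<lambda>\<omega>. a * f \<omega> + b * g \<omega>) M = a * walsh_coeff i f M + b * walsh_coeff i g M"
proof -
  have "(\<integral>\<omega>. (a * f \<omega> + b * g \<omega>) * walsh M \<omega> \<partial>dyadic_space i)
    = (\<integral>\<omega>. a * (f \<omega> * walsh M \<omega>) + b * (g \<omega> * walsh M \<omega>) \<partial>dyadic_space i)"
    by (simp add: algebra_simps)
  also have "\<dots> = a * (\<integral>\<omega>. f \<omega> * walsh M \<omega> \<partial>dyadic_space i) + b * (\<integral>\<omega>. g \<omega> * walsh M \<omega> \<partial>dyadic_space i)"
    using integrable_mult_walsh[OF assms(1,3)] integrable_mult_walsh[OF assms(2,3)] by simp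
  finally show ?thesis by (simp add: walsh_coeff_def)
qed

lemma walsh_coeff_diff:
  assumes "integrable (dyadic_space i) f" "integrable (dyadic_space i) g" "M \<in> finite_subsets i"
  shows "walsh_coeff i (\<lambda>\<omega>. f \<omega> - g \<omega>) M = walsh_coeff i f M - walsh_coeff i g M"
  using walsh_coeff_lin[OF assms, of 1 "-1"] by simp

text \<open>The squared distance from \<open>f\<close> to its partial sum \<open>p\<close> over
  \<open>S\<close> is nonnegative; orthonormality turns its expansion into the squared norm of
  \<open>f\<close> minus the sum. For functions of finitely many signs \<open>walsh_parseval\<close>
  provides the corresponding equality.\<close>

lemma bessel:
  assumes f: "square_integrable (dyadic_space i) f" and S: "finite S" "S \<subseteq> finite_subsets i"
  shows "(\<Sum>M\<in>S. (cmod (walsh_coeff i f M))\<^sup>2) \<le> (\<integral>\<omega>. (cmod (f \<omega>))\<^sup>2 \<partial>dyadic_space i)"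
proof -
  let ?D = "dyadic_space i"
  define c where "c M = walsh_coeff i f M" for M
  define p where "p \<omega> = (\<Sum>M\<in>S. c M * walsh M \<omega>)" for \<omega>
  have fi: "integrable ?D f" by (rule square_integrable_integrable[OF f])
  have f2: "integrable ?D (\<lambda>\<omega>. f \<omega> * cnj (f \<omega>))"
    using f unfolding complex_norm_square[symmetric] square_integrable_def by (simp only: integrable_of_real)
  have fp: "integrable ?D (\<lambda>\<omega>. cnj (c M) * (f \<omega> * walsh M \<omega>))" if "M \<in> S" for M
    using S that by (intro integrable_mult_right integrable_mult_walsh[OF fi]) auto
  have pf: "integrable ?D (\<lambda>\<omega>. c M * cnj (f \<omega> * walsh M \<omega>))" if "M \<in> S" for M
    using S that by (intro integrable_mult_right integrable_cnj integrable_mult_walsh[OF fi]) auto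
  have ww: "integrable ?D (\<lambda>\<omega>. walsh M \<omega> * walsh N \<omega>)" if "M \<in> S" "N \<in> S" for M N
    using S that by (intro integrable_mult_walsh integrable_walsh) auto
  have int_fw: "(\<integral>\<omega>. cnj (f \<omega> * walsh M \<omega>) \<partial>?D) = cnj (c M)" for M
    unfolding c_def walsh_coeff_def by (rule Bochner_Integration.integral_cnj)
  have "complex_of_real ((cmod (f \<omega> - p \<omega>))\<^sup>2) = f \<omega> * cnj (f \<omega>)
      - (\<Sum>M\<in>S. cnj (c M) * (f \<omega> * walsh M \<omega>)) - (\<Sum>M\<in>S. c M * cnj (f \<omega> * walsh M \<omega>))
      + (\<Sum>M\<in>S. \<Sum>N\<in>S. (c M * cnj (c N)) * (walsh M \<omega> * walsh N \<omega>))" (is "_ = ?e \<omega>") for \<omega>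
  proof -
    have "complex_of_real ((cmod (f \<omega> - p \<omega>))\<^sup>2) = (f \<omega> - p \<omega>) * cnj (f \<omega> - p \<omega>)"
      by (rule complex_norm_square)
    also have "\<dots> = f \<omega> * cnj (f \<omega>) - f \<omega> * cnj (p \<omega>) - p \<omega> * cnj (f \<omega>) + p \<omega> * cnj (p \<omega>)"
      by (simp add: algebra_simps)
    also have "f \<omega> * cnj (p \<omega>) = (\<Sum>M\<in>S. cnj (c M) * (f \<omega> * walsh M \<omega>))"
      by (simp add: p_def sum_distrib_left mult_ac)
    also have "p \<omega> * cnj (f \<omega>) = (\<Sum>M\<in>S. c M * cnj (f \<omega> * walsh M \<omega>))"
      by (simp add: p_def sum_distrib_left mult_ac)
    also have "p \<omega> * cnj (p \<omega>) = (\<Sum>M\<in>S. \<Sum>N\<in>S. (c M * cnj (c N)) * (walsh M \<omega> * walsh N \<omega>))"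
      by (simp add: p_def sum_product mult_ac)
    finally show ?thesis .
  qed
  then have "(\<integral>\<omega>. complex_of_real ((cmod (f \<omega> - p \<omega>))\<^sup>2) \<partial>?D) = (\<integral>\<omega>. ?e \<omega> \<partial>?D)" by simp
  also have "\<dots> = (\<integral>\<omega>. f \<omega> * cnj (f \<omega>) \<partial>?D)
      - (\<Sum>M\<in>S. cnj (c M) * c M) - (\<Sum>M\<in>S. c M * cnj (c M))
      + (\<Sum>M\<in>S. \<Sum>N\<in>S. (c M * cnj (c N)) * (if M = N then 1 else 0))"
  proof -
    have "(\<integral>\<omega>. (\<Sum>M\<in>S. cnj (c M) * (f \<omega> * walsh M \<omega>)) \<partial>?D) = (\<Sum>M\<in>S. cnj (c M) * c M)"
      using fp by (subst Bochner_Integration.integral_sum) (auto simp: c_def walsh_coeff_def)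
    moreover have "(\<integral>\<omega>. (\<Sum>M\<in>S. c M * cnj (f \<omega> * walsh M \<omega>)) \<partial>?D) = (\<Sum>M\<in>S. c M * cnj (c M))"
      using pf by (subst Bochner_Integration.integral_sum) (simp_all only: integral_mult_right_zero int_fw)
    moreover have "(\<integral>\<omega>. (\<Sum>M\<in>S. \<Sum>N\<in>S. (c M * cnj (c N)) * (walsh M \<omega> * walsh N \<omega>)) \<partial>?D)
        = (\<Sum>M\<in>S. \<Sum>N\<in>S. (c M * cnj (c N)) * (if M = N then 1 else 0))"
    proof (subst Bochner_Integration.integral_sum)
      show "integrable ?D (\<lambda>\<omega>. \<Sum>N\<in>S. c M * cnj (c N) * (walsh M \<omega> * walsh N \<omega>))" if "M \<in> S" for M
        using ww that by (intro Bochner_Integration.integrable_sum integrable_mult_right) auto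
      show "(\<Sum>M\<in>S. \<integral>\<omega>. (\<Sum>N\<in>S. c M * cnj (c N) * (walsh M \<omega> * walsh N \<omega>)) \<partial>?D)
        = (\<Sum>M\<in>S. \<Sum>N\<in>S. (c M * cnj (c N)) * (if M = N then 1 else 0))"
      proof (intro sum.cong refl)
        fix M assume M: "M \<in> S"
        show "(\<integral>\<omega>. (\<Sum>N\<in>S. c M * cnj (c N) * (walsh M \<omega> * walsh N \<omega>)) \<partial>?D)
          = (\<Sum>N\<in>S. (c M * cnj (c N)) * (if M = N then 1 else 0))"
        proof (subst Bochner_Integration.integral_sum)
          show "integrable ?D (\<lambda>\<omega>. c M * cnj (c N) * (walsh M \<omega> * walsh N \<omega>))" if "N \<in> S" for N
            using ww M that by (intro integrable_mult_right) auto
          show "(\<Sum>N\<in>S. \<integral>\<omega>. c M * cnj (c N) * (walsh M \<omega> * walsh N \<omega>) \<partial>?D)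
            = (\<Sum>N\<in>S. (c M * cnj (c N)) * (if M = N then 1 else 0))"
            using S(2) M by (intro sum.cong refl, subst integral_mult_right_zero, subst integral_walsh_mult) auto
        qed
      qed
    qed
    moreover have "integrable ?D (\<lambda>\<omega>. \<Sum>M\<in>S. cnj (c M) * (f \<omega> * walsh M \<omega>))"
      using fp by (intro Bochner_Integration.integrable_sum) auto
    moreover have "integrable ?D (\<lambda>\<omega>. \<Sum>M\<in>S. c M * cnj (f \<omega> * walsh M \<omega>))"
      using pf by (intro Bochner_Integration.integrable_sum) auto
    moreover have "integrable ?D (\<lambda>\<omega>. \<Sum>M\<in>S. \<Sum>N\<in>S. (c M * cnj (c N)) * (walsh M \<omega> * walsh N \<omega>))"
      using ww by (intro Bochner_Integration.integrable_sum integrable_mult_right) auto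
    ultimately show ?thesis using f2 by (simp only: Bochner_Integration.integral_add Bochner_Integration.integral_diff
        Bochner_Integration.integrable_diff Bochner_Integration.integrable_add)
  qed
  also have "\<dots> = (\<integral>\<omega>. f \<omega> * cnj (f \<omega>) \<partial>?D) - (\<Sum>M\<in>S. c M * cnj (c M))"
    using S(1) by (simp add: if_distrib[of "(*) _"] mult.commute cong: if_cong)
  also have "\<dots> = complex_of_real ((\<integral>\<omega>. (cmod (f \<omega>))\<^sup>2 \<partial>?D) - (\<Sum>M\<in>S. (cmod (c M))\<^sup>2))"
    unfolding complex_norm_square[symmetric] by (simp only: integral_complex_of_real of_real_diff of_real_sum)
  finally have "complex_of_real (\<integral>\<omega>. (cmod (f \<omega> - p \<omega>))\<^sup>2 \<partial>?D)
      = complex_of_real ((\<integral>\<omega>. (cmod (f \<omega>))\<^sup>2 \<partial>?D) - (\<Sum>M\<in>S. (cmod (c M))\<^sup>2))"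
    by (simp only: integral_complex_of_real)
  then have "(\<integral>\<omega>. (cmod (f \<omega> - p \<omega>))\<^sup>2 \<partial>?D) = (\<integral>\<omega>. (cmod (f \<omega>))\<^sup>2 \<partial>?D) - (\<Sum>M\<in>S. (cmod (c M))\<^sup>2)"
    by (simp only: of_real_eq_iff)
  moreover have "0 \<le> (\<integral>\<omega>. (cmod (f \<omega> - p \<omega>))\<^sup>2 \<partial>?D)" by simp
  ultimately show ?thesis by (simp add: c_def)
qed

text \<open>For finite \<open>W\<close> inside the grid these are the functions of the signs in
  \<open>W\<close>, as \<open>walsh_poly_restrict\<close> confirms. The equation is required only on
  the sample space, because \<open>\<omega>\<close> ranges over a larger type.\<close>

definition walsh_poly :: "nat \<Rightarrow> real set \<Rightarrow> ((real \<Rightarrow> real) \<Rightarrow> complex) \<Rightarrow> bool" where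
  "walsh_poly i W f \<longleftrightarrow> (\<exists>a. \<forall>\<omega>\<in>space (dyadic_space i). f \<omega> = (\<Sum>M\<in>Pow W. a M * walsh M \<omega>))"

lemma finite_subsets_mono: "W \<in> finite_subsets i \<Longrightarrow> M \<subseteq> W \<Longrightarrow> M \<in> finite_subsets i"
  by (auto simp: finite_subsets_def intro: finite_subset)

lemma finite_subsets_Un: "V \<in> finite_subsets i \<Longrightarrow> W \<in> finite_subsets i \<Longrightarrow> V \<union> W \<in> finite_subsets i"
  by (auto simp: finite_subsets_def)

lemma finite_Pow_subsets: "W \<in> finite_subsets i \<Longrightarrow> finite (Pow W)"
  by (auto simp: finite_subsets_def)

lemma walsh_coeff_sum:
  assumes W: "W \<in> finite_subsets i" and N: "N \<in> finite_subsets i"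
    and f: "\<And>\<omega>. \<omega> \<in> space (dyadic_space i) \<Longrightarrow> f \<omega> = (\<Sum>M\<in>Pow W. a M * walsh M \<omega>)"
  shows "walsh_coeff i f N = (if N \<subseteq> W then a N else 0)"
proof -
  have "walsh_coeff i f N = (\<integral>\<omega>. (\<Sum>M\<in>Pow W. a M * walsh M \<omega>) * walsh N \<omega> \<partial>dyadic_space i)"
    unfolding walsh_coeff_def by (rule Bochner_Integration.integral_cong) (simp_all add: f)
  also have "\<dots> = (\<integral>\<omega>. (\<Sum>M\<in>Pow W. a M * (walsh M \<omega> * walsh N \<omega>)) \<partial>dyadic_space i)"
    by (simp add: sum_distrib_right mult.assoc)
  also have "\<dots> = (\<Sum>M\<in>Pow W. \<integral>\<omega>. a M * (walsh M \<omega> * walsh N \<omega>) \<partial>dyadic_space i)"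
    using finite_subsets_mono[OF W] N
    by (intro Bochner_Integration.integral_sum integrable_mult_right integrable_mult_walsh integrable_walsh) auto
  also have "\<dots> = (\<Sum>M\<in>Pow W. a M * (if M = N then 1 else 0))"
  proof (intro sum.cong refl)
    fix M assume "M \<in> Pow W"
    then have "M \<in> finite_subsets i" using finite_subsets_mono[OF W] by simp
    then show "(\<integral>\<omega>. a M * (walsh M \<omega> * walsh N \<omega>) \<partial>dyadic_space i) = a M * (if M = N then 1 else 0)"
      using integral_walsh_mult[OF _ N] by (subst integral_mult_right_zero) simp
  qed
  also have "\<dots> = (\<Sum>M\<in>Pow W. if M = N then a M else 0)"
    by (intro sum.cong) auto
  also have "\<dots> = (if N \<subseteq> W then a N else 0)"
    using finite_Pow_subsets[OF W] by (subst sum.delta) auto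
  finally show ?thesis .
qed

lemma walsh_poly_expand:
  assumes "walsh_poly i W f" "W \<in> finite_subsets i" "\<omega> \<in> space (dyadic_space i)"
  shows "f \<omega> = (\<Sum>M\<in>Pow W. walsh_coeff i f M * walsh M \<omega>)"
proof -
  obtain a where a: "\<And>\<omega>. \<omega> \<in> space (dyadic_space i) \<Longrightarrow> f \<omega> = (\<Sum>M\<in>Pow W. a M * walsh M \<omega>)"
    using assms(1) unfolding walsh_poly_def by auto
  have "walsh_coeff i f M = a M" if "M \<in> Pow W" for M
    using walsh_coeff_sum[OF assms(2) finite_subsets_mono[OF assms(2)] a, of M] that by simp
  then show ?thesis using a[OF assms(3)] by simp
qed

lemma walsh_poly_coeff_0:
  assumes "walsh_poly i W f" "W \<in> finite_subsets i" "M \<in> finite_subsets i" "\<not> M \<subseteq> W"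
  shows "walsh_coeff i f M = 0"
proof -
  obtain a where a: "\<And>\<omega>. \<omega> \<in> space (dyadic_space i) \<Longrightarrow> f \<omega> = (\<Sum>M\<in>Pow W. a M * walsh M \<omega>)"
    using assms(1) unfolding walsh_poly_def by auto
  show ?thesis using walsh_coeff_sum[OF assms(2,3) a] assms(4) by simp
qed

lemma walsh_poly_measurable:
  assumes "walsh_poly i W f" "W \<in> finite_subsets i"
  shows "f \<in> borel_measurable (dyadic_space i)"
proof -
  have "(\<lambda>\<omega>. \<Sum>M\<in>Pow W. walsh_coeff i f M * walsh M \<omega>) \<in> borel_measurable (dyadic_space i)"
    using finite_subsets_mono[OF assms(2)]
    by (intro borel_measurable_sum borel_measurable_times borel_measurable_const walsh_measurable) auto
  then show ?thesis
    by (subst measurable_cong[OF walsh_poly_expand[OF assms]])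
qed

lemma walsh_poly_bounded:
  assumes "walsh_poly i W f" "W \<in> finite_subsets i"
  shows "\<exists>B. \<forall>\<omega>\<in>space (dyadic_space i). cmod (f \<omega>) \<le> B"
proof (intro exI ballI)
  fix \<omega> assume \<omega>: "\<omega> \<in> space (dyadic_space i)"
  have "cmod (f \<omega>) \<le> (\<Sum>M\<in>Pow W. cmod (walsh_coeff i f M * walsh M \<omega>))"
    unfolding walsh_poly_expand[OF assms \<omega>] by (rule norm_sum)
  also have "\<dots> = (\<Sum>M\<in>Pow W. cmod (walsh_coeff i f M))"
    using finite_subsetsD(2)[OF assms(2)]
    by (intro sum.cong refl) (auto simp: norm_mult norm_walsh[OF _ \<omega>])
  finally show "cmod (f \<omega>) \<le> (\<Sum>M\<in>Pow W. cmod (walsh_coeff i f M))" .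
qed

lemma walsh_poly_square_integrable:
  assumes "walsh_poly i W f" "W \<in> finite_subsets i"
  shows "square_integrable (dyadic_space i) f"
proof -
  interpret prob_space "dyadic_space i" by (rule prob_space_dyadic)
  obtain B where B: "\<And>\<omega>. \<omega> \<in> space (dyadic_space i) \<Longrightarrow> cmod (f \<omega>) \<le> B"
    using walsh_poly_bounded[OF assms] by blast
  have [measurable]: "f \<in> borel_measurable (dyadic_space i)" by (rule walsh_poly_measurable[OF assms])
  have "integrable (dyadic_space i) (\<lambda>\<omega>. (cmod (f \<omega>))\<^sup>2)"
    using B by (intro integrable_const_bound[of _ "B\<^sup>2"]) (auto intro!: power_mono AE_I2)
  then show ?thesis by (simp add: square_integrable_def)
qed

lemma walsh_poly_integrable:
  "walsh_poly i W f \<Longrightarrow> W \<in> finite_subsets i \<Longrightarrow> integrable (dyadic_space i) f"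
  by (intro square_integrable_integrable walsh_poly_square_integrable)

text \<open>Induction on the number of signs: fixing the new sign to 1 and to -1 gives two functions
  of the remaining signs, both already expanded.\<close>

lemma walsh_poly_restrict:
  assumes W: "W \<in> finite_subsets i"
  shows "walsh_poly i W (\<lambda>\<omega>. g (restrict \<omega> W))"
proof -
  have "finite W" using W by (rule finite_subsetsD)
  then have "\<exists>a. \<forall>\<omega>. (\<forall>m\<in>W. \<omega> m = -1 \<or> \<omega> m = 1) \<longrightarrow> g (restrict \<omega> W) = (\<Sum>M\<in>Pow W. a M * walsh M \<omega>)" for g
  proof (induction W arbitrary: g)
    case empty
    show ?case by (intro exI[of _ "\<lambda>_. g (\<lambda>_. undefined)"]) (simp add: restrict_def)
  next
    case (insert m W)
    obtain a where a: "\<And>\<omega>. (\<forall>m\<in>W. \<omega> m = -1 \<or> \<omega> m = 1) \<Longrightarrow> g ((restrict \<omega> W)(m := 1)) = (\<Sum>M\<in>Pow W. a M * walsh M \<omega>)"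
      using insert.IH[of "\<lambda>r. g (r(m := 1))"] by blast
    obtain b where b: "\<And>\<omega>. (\<forall>m\<in>W. \<omega> m = -1 \<or> \<omega> m = 1) \<Longrightarrow> g ((restrict \<omega> W)(m := -1)) = (\<Sum>M\<in>Pow W. b M * walsh M \<omega>)"
      using insert.IH[of "\<lambda>r. g (r(m := -1))"] by blast
    \<comment> \<open>A function of one sign \<open>s\<close> with value \<open>a\<close> at 1 and
      \<open>b\<close> at -1 is \<open>(a + b) / 2 + s * (a - b) / 2\<close>; this is applied to
      each pair of coefficients.\<close>
    define d where "d M = (if m \<in> M then (a (M - {m}) - b (M - {m})) / 2 else (a M + b M) / 2)" for M
    show ?case
    proof (intro exI[of _ d] allI impI)
      fix \<omega> :: "real \<Rightarrow> real" assume \<omega>: "\<forall>k\<in>insert m W. \<omega> k = -1 \<or> \<omega> k = 1"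
      have inj: "inj_on (insert m) (Pow W)" using insert.hyps by (auto simp: inj_on_def)
      have "(\<Sum>M\<in>Pow (insert m W). d M * walsh M \<omega>) =
        (\<Sum>M\<in>Pow W. d M * walsh M \<omega>) + (\<Sum>M\<in>insert m ` Pow W. d M * walsh M \<omega>)"
        unfolding Pow_insert using insert.hyps by (intro sum.union_disjoint) auto
      also have "(\<Sum>M\<in>insert m ` Pow W. d M * walsh M \<omega>) = (\<Sum>M\<in>Pow W. d (insert m M) * walsh (insert m M) \<omega>)"
        by (simp add: sum.reindex[OF inj])
      also have "\<dots> = (\<Sum>M\<in>Pow W. of_real (\<omega> m) * ((a M - b M) / 2 * walsh M \<omega>))"
      proof (intro sum.cong refl)
        fix M assume M: "M \<in> Pow W"
        then have "m \<notin> M" "finite M" using insert.hyps finite_subset by auto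
        then show "d (insert m M) * walsh (insert m M) \<omega> = of_real (\<omega> m) * ((a M - b M) / 2 * walsh M \<omega>)"
          by (simp add: d_def walsh_def)
      qed
      also have "(\<Sum>M\<in>Pow W. d M * walsh M \<omega>) = (\<Sum>M\<in>Pow W. (a M + b M) / 2 * walsh M \<omega>)"
        using insert.hyps by (intro sum.cong refl) (auto simp: d_def)
      finally have sum_eq: "(\<Sum>M\<in>Pow (insert m W). d M * walsh M \<omega>) = (\<Sum>M\<in>Pow W. (a M + b M) / 2 * walsh M \<omega>)
          + of_real (\<omega> m) * (\<Sum>M\<in>Pow W. (a M - b M) / 2 * walsh M \<omega>)"
        by (simp add: sum_distrib_left)
      have r: "restrict \<omega> (insert m W) = (restrict \<omega> W)(m := \<omega> m)"
        by (auto simp: restrict_def fun_eq_iff)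
      have "\<omega> m = -1 \<or> \<omega> m = 1" using \<omega> by simp
      then show "g (restrict \<omega> (insert m W)) = (\<Sum>M\<in>Pow (insert m W). d M * walsh M \<omega>)"
      proof
        assume s: "\<omega> m = -1"
        have "g (restrict \<omega> (insert m W)) = (\<Sum>M\<in>Pow W. b M * walsh M \<omega>)"
          unfolding r s using b[of \<omega>] \<omega> by simp
        also have "\<dots> = (\<Sum>M\<in>Pow W. (a M + b M) / 2 * walsh M \<omega> - (a M - b M) / 2 * walsh M \<omega>)"
          by (intro sum.cong refl) (simp add: field_simps)
        finally show ?thesis unfolding sum_eq s by (simp add: sum_subtractf)
      next
        assume s: "\<omega> m = 1"
        have "g (restrict \<omega> (insert m W)) = (\<Sum>M\<in>Pow W. a M * walsh M \<omega>)"
          unfolding r s using a[of \<omega>] \<omega> by simp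
        also have "\<dots> = (\<Sum>M\<in>Pow W. (a M + b M) / 2 * walsh M \<omega> + (a M - b M) / 2 * walsh M \<omega>)"
          by (intro sum.cong refl) (simp add: field_simps)
        finally show ?thesis unfolding sum_eq s by (simp add: sum.distrib)
      qed
    qed
  qed
  then obtain a where a: "\<And>\<omega>. (\<forall>m\<in>W. \<omega> m = -1 \<or> \<omega> m = 1) \<Longrightarrow> g (restrict \<omega> W) = (\<Sum>M\<in>Pow W. a M * walsh M \<omega>)"
    by blast
  show ?thesis unfolding walsh_poly_def
    using a dyadic_sign finite_subsetsD(2)[OF W] by (intro exI[of _ a]) blast
qed

lemma walsh_parseval:
  assumes f: "walsh_poly i W f" and g: "walsh_poly i W g" and W: "W \<in> finite_subsets i"
  shows "(\<Sum>M\<in>Pow W. walsh_coeff i f M * cnj (walsh_coeff i g M)) = (\<integral>\<omega>. f \<omega> * cnj (g \<omega>) \<partial>dyadic_space i)"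
proof -
  have "(\<integral>\<omega>. f \<omega> * cnj (g \<omega>) \<partial>dyadic_space i) =
    (\<integral>\<omega>. (\<Sum>M\<in>Pow W. cnj (walsh_coeff i g M) * (f \<omega> * walsh M \<omega>)) \<partial>dyadic_space i)"
  proof (rule Bochner_Integration.integral_cong[OF refl])
    fix \<omega> assume "\<omega> \<in> space (dyadic_space i)"
    from walsh_poly_expand[OF g W this]
    have "cnj (g \<omega>) = cnj (\<Sum>M\<in>Pow W. walsh_coeff i g M * walsh M \<omega>)" by simp
    then show "f \<omega> * cnj (g \<omega>) = (\<Sum>M\<in>Pow W. cnj (walsh_coeff i g M) * (f \<omega> * walsh M \<omega>))"
      by (simp add: sum_distrib_left mult_ac)
  qed
  also have "\<dots> = (\<Sum>M\<in>Pow W. \<integral>\<omega>. cnj (walsh_coeff i g M) * (f \<omega> * walsh M \<omega>) \<partial>dyadic_space i)"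
    using finite_subsets_mono[OF W]
    by (intro Bochner_Integration.integral_sum integrable_mult_right integrable_mult_walsh
        walsh_poly_integrable[OF f W]) auto
  also have "\<dots> = (\<Sum>M\<in>Pow W. walsh_coeff i f M * cnj (walsh_coeff i g M))"
    by (simp add: walsh_coeff_def mult.commute)
  finally show ?thesis by simp
qed

lemma sum_Pow_Un_disjoint:
  assumes "A \<inter> B = {}"
  shows "(\<Sum>M\<in>Pow (A \<union> B). h (M \<inter> A) (M \<inter> B)) = (\<Sum>M\<in>Pow A. \<Sum>N\<in>Pow B. h M N)"
proof -
  have "(\<Sum>M\<in>Pow (A \<union> B). h (M \<inter> A) (M \<inter> B)) = (\<Sum>(M, N)\<in>Pow A \<times> Pow B. h M N)"
    by (rule sum.reindex_bij_witness[where i = "\<lambda>(M, N). M \<union> N" and j = "\<lambda>M. (M \<inter> A, M \<inter> B)"])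
       (use assms in auto)
  then show ?thesis by (simp add: sum.cartesian_product)
qed

lemma walsh_poly_mult:
  assumes f: "walsh_poly i V f" and g: "walsh_poly i W g"
    and V: "V \<in> finite_subsets i" and W: "W \<in> finite_subsets i" and disj: "V \<inter> W = {}"
    and \<omega>: "\<omega> \<in> space (dyadic_space i)"
  shows "f \<omega> * g \<omega> = (\<Sum>M\<in>Pow (V \<union> W). (walsh_coeff i f (M \<inter> V) * walsh_coeff i g (M \<inter> W)) * walsh M \<omega>)"
proof -
  have "f \<omega> * g \<omega> = (\<Sum>M\<in>Pow V. walsh_coeff i f M * walsh M \<omega>) * (\<Sum>N\<in>Pow W. walsh_coeff i g N * walsh N \<omega>)"
    using walsh_poly_expand[OF f V \<omega>] walsh_poly_expand[OF g W \<omega>] by simp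
  also have "\<dots> = (\<Sum>M\<in>Pow V. \<Sum>N\<in>Pow W. (walsh_coeff i f M * walsh_coeff i g N) * (walsh M \<omega> * walsh N \<omega>))"
    by (simp add: sum_product mult_ac)
  also have "\<dots> = (\<Sum>M\<in>Pow (V \<union> W). (walsh_coeff i f (M \<inter> V) * walsh_coeff i g (M \<inter> W)) * (walsh (M \<inter> V) \<omega> * walsh (M \<inter> W) \<omega>))"
    by (rule sum_Pow_Un_disjoint[OF disj, symmetric])
  also have "\<dots> = (\<Sum>M\<in>Pow (V \<union> W). (walsh_coeff i f (M \<inter> V) * walsh_coeff i g (M \<inter> W)) * walsh M \<omega>)"
  proof (intro sum.cong refl)
    fix M assume M: "M \<in> Pow (V \<union> W)"
    have "finite (M \<inter> V)" "finite (M \<inter> W)"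
      using finite_subsetsD(1)[OF V] finite_subsetsD(1)[OF W] by auto
    moreover have "M \<inter> V \<union> M \<inter> W = M" using M by blast
    ultimately have "walsh (M \<inter> V) \<omega> * walsh (M \<inter> W) \<omega> = walsh M \<omega>"
      using walsh_union[of "M \<inter> V" "M \<inter> W" \<omega>] disj by (simp add: disjoint_iff)
    then show "(walsh_coeff i f (M \<inter> V) * walsh_coeff i g (M \<inter> W)) * (walsh (M \<inter> V) \<omega> * walsh (M \<inter> W) \<omega>)
       = (walsh_coeff i f (M \<inter> V) * walsh_coeff i g (M \<inter> W)) * walsh M \<omega>" by simp
  qed
  finally show ?thesis .
qed

lemma walsh_coeff_mult:
  assumes f: "walsh_poly i V f" and g: "walsh_poly i W g"
    and V: "V \<in> finite_subsets i" and W: "W \<in> finite_subsets i" and disj: "V \<inter> W = {}"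
    and M: "M \<subseteq> V \<union> W"
  shows "walsh_coeff i (\<lambda>\<omega>. f \<omega> * g \<omega>) M = walsh_coeff i f (M \<inter> V) * walsh_coeff i g (M \<inter> W)"
  using walsh_coeff_sum[OF finite_subsets_Un[OF V W] finite_subsets_mono[OF finite_subsets_Un[OF V W] M]
      walsh_poly_mult[OF f g V W disj]] M by simp

text \<open>For square integrable arguments and finite \<open>F\<close> in the grid this is the
  inner product of the projections to functions of the signs in \<open>F\<close>. On the diagonal it
  is the spectral mass of the subsets of \<open>F\<close>; the polarized form is what can be
  extended along linear spans.\<close>

definition spectral_form :: "nat \<Rightarrow> real set \<Rightarrow> ((real \<Rightarrow> real) \<Rightarrow> complex) \<Rightarrow> ((real \<Rightarrow> real) \<Rightarrow> complex) \<Rightarrow> complex" where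
  "spectral_form i F f g = (\<Sum>M\<in>Pow F. walsh_coeff i f M * cnj (walsh_coeff i g M))"

text \<open>A subset of \<open>V \<union> W\<close> is a pair of a subset of \<open>V\<close> and
  one of \<open>W\<close>, and the coefficient of a product of functions of disjoint sets of signs
  is the product of the coefficients; the sum over pairs then factors.\<close>

lemma spectral_form_mult:
  assumes polys: "walsh_poly i V f\<^sub>1" "walsh_poly i W f\<^sub>2" "walsh_poly i V g\<^sub>1" "walsh_poly i W g\<^sub>2"
    and V: "V \<in> finite_subsets i" and W: "W \<in> finite_subsets i" and disj: "V \<inter> W = {}"
  shows "spectral_form i ((V \<union> W) \<inter> E) (\<lambda>\<omega>. f\<^sub>1 \<omega> * f\<^sub>2 \<omega>) (\<lambda>\<omega>. g\<^sub>1 \<omega> * g\<^sub>2 \<omega>)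
    = spectral_form i (V \<inter> E) f\<^sub>1 g\<^sub>1 * spectral_form i (W \<inter> E) f\<^sub>2 g\<^sub>2"
proof -
  let ?h = "\<lambda>M N. (walsh_coeff i f\<^sub>1 M * walsh_coeff i f\<^sub>2 N) * cnj (walsh_coeff i g\<^sub>1 M * walsh_coeff i g\<^sub>2 N)"
  have "spectral_form i ((V \<union> W) \<inter> E) (\<lambda>\<omega>. f\<^sub>1 \<omega> * f\<^sub>2 \<omega>) (\<lambda>\<omega>. g\<^sub>1 \<omega> * g\<^sub>2 \<omega>)
    = (\<Sum>M\<in>Pow ((V \<inter> E) \<union> (W \<inter> E)). ?h (M \<inter> (V \<inter> E)) (M \<inter> (W \<inter> E)))"
    unfolding spectral_form_def Int_Un_distrib2
  proof (intro sum.cong refl)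
    fix M assume M: "M \<in> Pow ((V \<inter> E) \<union> (W \<inter> E))"
    then have "M \<subseteq> V \<union> W" "M \<inter> V = M \<inter> (V \<inter> E)" "M \<inter> W = M \<inter> (W \<inter> E)" by auto
    then show "walsh_coeff i (\<lambda>\<omega>. f\<^sub>1 \<omega> * f\<^sub>2 \<omega>) M * cnj (walsh_coeff i (\<lambda>\<omega>. g\<^sub>1 \<omega> * g\<^sub>2 \<omega>) M)
      = ?h (M \<inter> (V \<inter> E)) (M \<inter> (W \<inter> E))"
      by (simp only: walsh_coeff_mult[OF polys(1,2) V W disj] walsh_coeff_mult[OF polys(3,4) V W disj])
  qed
  also have "\<dots> = (\<Sum>M\<in>Pow (V \<inter> E). \<Sum>N\<in>Pow (W \<inter> E). ?h M N)"
    by (rule sum_Pow_Un_disjoint) (use disj in auto)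
  also have "\<dots> = spectral_form i (V \<inter> E) f\<^sub>1 g\<^sub>1 * spectral_form i (W \<inter> E) f\<^sub>2 g\<^sub>2"
    unfolding spectral_form_def sum_product by (intro sum.cong refl) (simp add: mult_ac)
  finally show ?thesis .
qed

lemma l2_norm_nonneg [simp]: "0 \<le> l2_norm M f"
  by (simp add: l2_norm_def)

lemma bessel_l2:
  assumes "square_integrable (dyadic_space i) f" "finite S" "S \<subseteq> finite_subsets i"
  shows "L2_set (\<lambda>M. cmod (walsh_coeff i f M)) S \<le> l2_norm (dyadic_space i) f"
  unfolding L2_set_def l2_norm_def using bessel[OF assms] by simp

text \<open>Cauchy-Schwarz for the finite sum, then Bessel for each factor. The bound involves
  neither \<open>F\<close> nor \<open>i\<close> explicitly, which lets convergence pass to L2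
  limits.\<close>

lemma spectral_form_le:
  assumes "square_integrable (dyadic_space i) f" "square_integrable (dyadic_space i) g" "F \<in> finite_subsets i"
  shows "cmod (spectral_form i F f g) \<le> l2_norm (dyadic_space i) f * l2_norm (dyadic_space i) g"
proof -
  have F: "finite (Pow F)" "Pow F \<subseteq> finite_subsets i"
    using finite_Pow_subsets[OF assms(3)] finite_subsets_mono[OF assms(3)] by auto
  have "cmod (spectral_form i F f g) \<le> (\<Sum>M\<in>Pow F. cmod (walsh_coeff i f M * cnj (walsh_coeff i g M)))"
    unfolding spectral_form_def by (rule norm_sum)
  also have "\<dots> = (\<Sum>M\<in>Pow F. \<bar>cmod (walsh_coeff i f M)\<bar> * \<bar>cmod (walsh_coeff i g M)\<bar>)"
    by (simp add: norm_mult)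
  also have "\<dots> \<le> L2_set (\<lambda>M. cmod (walsh_coeff i f M)) (Pow F) * L2_set (\<lambda>M. cmod (walsh_coeff i g M)) (Pow F)"
    by (rule L2_set_mult_ineq)
  also have "\<dots> \<le> l2_norm (dyadic_space i) f * l2_norm (dyadic_space i) g"
    by (intro mult_mono bessel_l2 assms F) (auto simp: L2_set_nonneg)
  finally show ?thesis .
qed

lemma spectral_form_lin_left:
  assumes "integrable (dyadic_space i) f" "integrable (dyadic_space i) f'" "F \<in> finite_subsets i"
  shows "spectral_form i F (\<lambda>\<omega>. a * f \<omega> + b * f' \<omega>) g = a * spectral_form i F f g + b * spectral_form i F f' g"
proof -
  have "walsh_coeff i (\<lambda>\<omega>. a * f \<omega> + b * f' \<omega>) M = a * walsh_coeff i f M + b * walsh_coeff i f' M"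
    if "M \<in> Pow F" for M
    using that by (intro walsh_coeff_lin assms finite_subsets_mono[OF assms(3)]) auto
  then show ?thesis
    unfolding spectral_form_def by (simp add: sum.distrib sum_distrib_left algebra_simps)
qed

lemma spectral_form_cnj: "spectral_form i F g f = cnj (spectral_form i F f g)"
  unfolding spectral_form_def by (simp add: mult.commute)

lemma spectral_form_lin_right:
  assumes "integrable (dyadic_space i) g" "integrable (dyadic_space i) g'" "F \<in> finite_subsets i"
  shows "spectral_form i F f (\<lambda>\<omega>. a * g \<omega> + b * g' \<omega>) = cnj a * spectral_form i F f g + cnj b * spectral_form i F f g'"
proof -
  have "spectral_form i F f (\<lambda>\<omega>. a * g \<omega> + b * g' \<omega>) = cnj (a * spectral_form i F g f + b * spectral_form i F g' f)"
    unfolding spectral_form_lin_left[OF assms, symmetric] by (rule spectral_form_cnj)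
  also have "\<dots> = cnj a * cnj (spectral_form i F g f) + cnj b * cnj (spectral_form i F g' f)" by simp
  finally show ?thesis by (simp only: spectral_form_cnj[symmetric])
qed

section \<open>Convergence of the spectral form\<close>

interpretation dyadic: prob_spaces dyadic_space
  by (rule prob_spaces.intro) (rule prob_space_dyadic)

section \<open>Windows and their finite sample spaces\<close>

lemma finite_grid_interval: "finite (grid i \<inter> {a..<b})"
proof (cases "i = 0")
  case True
  \<comment> \<open>Division by zero gives zero, so \<open>grid 0\<close> is a single point and the
    finiteness of windows holds for every index.\<close>
  then have "grid i \<subseteq> {0}" by (auto simp: grid_def)
  then show ?thesis by (meson finite.emptyI finite_Int finite_insert finite_subset)
next
  case False
  have "grid i \<inter> {a..<b} \<subseteq> (\<lambda>k. real_of_int k / real i) ` {\<lfloor>a * real i\<rfloor>..\<lceil>b * real i\<rceil>}"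
  proof
    fix x assume "x \<in> grid i \<inter> {a..<b}"
    then obtain k where k: "x = real_of_int k / real i" "a \<le> x" "x < b" by (auto simp: grid_def)
    then have "a * real i \<le> real_of_int k" "real_of_int k < b * real i"
      using False mult_right_mono[of a x "real i"] mult_strict_right_mono[of x b "real i"] by simp_all
    then have "k \<in> {\<lfloor>a * real i\<rfloor>..\<lceil>b * real i\<rceil>}"
      by (simp add: floor_le_iff le_ceiling_iff)
    with k(1) show "x \<in> (\<lambda>k. real_of_int k / real i) ` {\<lfloor>a * real i\<rfloor>..\<lceil>b * real i\<rceil>}" by blast
  qed
  then show ?thesis by (rule finite_subset) simp
qed

lemma window_finite_subsets: "window s t i \<in> finite_subsets i"
  using finite_grid_interval by (auto simp: window_def finite_subsets_def)

lemma window_Int_finite_subsets: "window s t i \<inter> E \<in> finite_subsets i"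
  by (rule finite_subsets_mono[OF window_finite_subsets]) blast

lemma space_window_space: "space (window_space s t i) = (\<Pi>\<^sub>E m\<in>window s t i. {-1, 1})"
  by (simp add: window_space_def space_PiM)

lemma finite_window: "finite (window s t i)"
  using window_finite_subsets finite_subsetsD(1) by blast

text \<open>A window carries finitely many configurations, and each single configuration is a
  measurable box; so subsets of a window space raise no question of measurability.\<close>

lemma sets_window_space: "sets (window_space s t i) = Pow (space (window_space s t i))"
proof (intro equalityI subsetI)
  let ?W = "window s t i"
  fix A assume "A \<in> Pow (space (window_space s t i))"
  then have A: "A \<subseteq> (\<Pi>\<^sub>E m\<in>?W. {-1, 1})" by (simp add: space_window_space)
  have "finite A"
    by (rule finite_subset[OF A]) (simp add: finite_PiE finite_window)
  moreover have "{a} \<in> sets (window_space s t i)" if "a \<in> A" for a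
  proof -
    have "a \<in> (\<Pi>\<^sub>E m\<in>?W. {-1, 1})" using that A by blast
    then have "{a} = (\<Pi>\<^sub>E m\<in>?W. {a m})" "\<And>m. m \<in> ?W \<Longrightarrow> {a m} \<in> sets sign_space"
      using PiE_singleton[of a ?W] by (auto simp: PiE_def)
    then show ?thesis unfolding window_space_def
      using sets_PiM_I_finite[OF finite_window, of s t i "\<lambda>m. {a m}" "\<lambda>_. sign_space"] by simp
  qed
  ultimately have "(\<Union>a\<in>A. {a}) \<in> sets (window_space s t i)" by (intro sets.finite_UN) auto
  then show "A \<in> sets (window_space s t i)" by simp
qed (use sets.sets_into_space in blast)

lemma restrict_window_measurable:
  "(\<lambda>\<omega>. restrict \<omega> (window s t i)) \<in> dyadic_space i \<rightarrow>\<^sub>M window_space s t i"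
  unfolding dyadic_space_def window_space_def
  by (rule measurable_restrict_subset) (simp add: window_def)

lemma window_space_distr:
  "distr (dyadic_space i) (window_space s t i) (\<lambda>\<omega>. restrict \<omega> (window s t i)) = window_space s t i"
  unfolding dyadic_space_def window_space_def
  by (rule sign_product.distr_PiM_restrict_finite[OF finite_window]) (simp add: window_def)

lemma prob_space_window_space: "prob_space (window_space s t i)"
  unfolding window_space_def by (rule prob_space_PiM) (rule signs.prob_space_axioms)

lemma window_preimage_section:
  "i \<ge> 1 \<Longrightarrow> window_preimage s t A `` {i} = {\<omega> \<in> space (dyadic_space i). (i, restrict \<omega> (window s t i)) \<in> A}"
  by (auto simp: window_preimage_def coarse_union_def)

lemma measure_window_preimage:
  assumes "A \<subseteq> coarse_union (window_space s t)" "i \<ge> 1"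
  shows "measure (window_space s t i) (A `` {i}) = measure (dyadic_space i) (window_preimage s t A `` {i})"
proof -
  have A: "A `` {i} \<in> sets (window_space s t i)"
    unfolding sets_window_space using assms(1) by (auto simp: coarse_union_def)
  have "measure (window_space s t i) (A `` {i}) =
    measure (distr (dyadic_space i) (window_space s t i) (\<lambda>\<omega>. restrict \<omega> (window s t i))) (A `` {i})"
    unfolding window_space_distr ..
  also have "\<dots> = measure (dyadic_space i) ((\<lambda>\<omega>. restrict \<omega> (window s t i)) -` (A `` {i}) \<inter> space (dyadic_space i))"
    by (rule measure_distr[OF restrict_window_measurable A])
  also have "(\<lambda>\<omega>. restrict \<omega> (window s t i)) -` (A `` {i}) \<inter> space (dyadic_space i) = window_preimage s t A `` {i}"
    unfolding window_preimage_section[OF assms(2)] by auto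
  finally show ?thesis .
qed

lemma restrict_window_space: "\<omega> \<in> space (dyadic_space i) \<Longrightarrow> restrict \<omega> (window s t i) \<in> space (window_space s t i)"
  using measurable_space[OF restrict_window_measurable] .

lemma coarse_set_window: "A \<subseteq> coarse_union (window_space s t) \<Longrightarrow> coarse_set (window_space s t) A"
  unfolding coarse_set_def sets_window_space by (auto simp: coarse_union_def)

lemma window_preimage_Int: "window_preimage s t (A \<inter> B) = window_preimage s t A \<inter> window_preimage s t B"
  by (auto simp: window_preimage_def)

lemma window_preimage_Un: "window_preimage s t (A \<union> B) = window_preimage s t A \<union> window_preimage s t B"
  by (auto simp: window_preimage_def)

lemma window_preimage_Diff: "window_preimage s t (A - B) = window_preimage s t A - window_preimage s t B"
  by (auto simp: window_preimage_def)

lemma window_preimage_empty: "window_preimage s t {} = {}"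
  by (simp add: window_preimage_def)

lemma window_preimage_full: "window_preimage s t (coarse_union (window_space s t)) = coarse_union dyadic_space"
proof -
  have "(i, restrict \<omega> (window s t i)) \<in> coarse_union (window_space s t)" if "(i, \<omega>) \<in> coarse_union dyadic_space" for i \<omega>
    using that restrict_window_space[of \<omega> i s t] by (simp add: coarse_union_def)
  then show ?thesis unfolding window_preimage_def by blast
qed

lemma coarse_dist_window:
  assumes "A \<subseteq> coarse_union (window_space s t)" "B \<subseteq> coarse_union (window_space s t)" "i \<ge> 1"
  shows "coarse_dist (window_space s t) i A B = coarse_dist dyadic_space i (window_preimage s t A) (window_preimage s t B)"
  unfolding coarse_dist_def window_preimage_Diff[symmetric] window_preimage_Un[symmetric]
  by (rule measure_window_preimage) (use assms in blast)+

section \<open>Indicators of coarse sets and their linear span\<close>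

abbreviation ind :: "(nat \<times> 'a) set \<Rightarrow> nat \<Rightarrow> 'a \<Rightarrow> complex" where
  "ind A i \<omega> \<equiv> indicator A (i, \<omega>)"

lemma ind_section: "ind A i \<omega> = complex_of_real (indicator (A `` {i}) \<omega>)"
  by (simp add: indicator_def)

lemma ind_square_integrable:
  assumes "coarse_set dyadic_space A" "i \<ge> 1"
  shows "square_integrable (dyadic_space i) (ind A i)"
proof -
  interpret prob_space "dyadic_space i" by (rule prob_space_dyadic)
  have A: "A `` {i} \<in> sets (dyadic_space i)" by (rule coarse_set_section[OF assms])
  have "(\<lambda>\<omega>. (cmod (ind A i \<omega>))\<^sup>2) = indicator (A `` {i})"
    by (auto simp: indicator_def fun_eq_iff)
  moreover have "ind A i \<in> borel_measurable (dyadic_space i)"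
    unfolding ind_section[abs_def]
    by (rule measurable_compose[OF borel_measurable_indicator[OF A] borel_measurable_of_real])
  moreover have "integrable (dyadic_space i) (indicator (A `` {i}) :: _ \<Rightarrow> real)"
    using A by (intro integrable_real_indicator) (auto simp: emeasure_eq_measure)
  ultimately show ?thesis by (simp add: square_integrable_def)
qed

lemma ind_integral:
  assumes "coarse_set dyadic_space A" "i \<ge> 1"
  shows "(\<integral>\<omega>. ind A i \<omega> \<partial>dyadic_space i) = of_real (measure (dyadic_space i) (A `` {i}))"
proof -
  have "A `` {i} \<subseteq> space (dyadic_space i)"
    using coarse_set_section[OF assms] sets.sets_into_space by blast
  then have eq: "A `` {i} \<inter> space (dyadic_space i) = A `` {i}" by blast
  show ?thesis unfolding ind_section integral_complex_of_real Bochner_Integration.integral_indicator eq ..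
qed

lemma ind_coeff_empty:
  assumes "coarse_set dyadic_space A" "i \<ge> 1"
  shows "walsh_coeff i (ind A i) {} = of_real (measure (dyadic_space i) (A `` {i}))"
  unfolding walsh_coeff_def walsh_empty mult_1_right by (rule ind_integral[OF assms])

lemma ind_l2_le:
  assumes "coarse_set dyadic_space A" "i \<ge> 1"
  shows "l2_norm (dyadic_space i) (ind A i) \<le> 1"
proof -
  interpret prob_space "dyadic_space i" by (rule prob_space_dyadic)
  have "(\<lambda>\<omega>. (cmod (ind A i \<omega>))\<^sup>2) = indicator (A `` {i})"
    by (auto simp: indicator_def fun_eq_iff)
  then show ?thesis by (simp add: l2_norm_def)
qed

lemma ind_diff_l2:
  assumes "coarse_set dyadic_space A" "coarse_set dyadic_space B" "i \<ge> 1"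
  shows "(\<integral>\<omega>. (cmod (ind A i \<omega> - ind B i \<omega>))\<^sup>2 \<partial>dyadic_space i) = coarse_dist dyadic_space i A B"
proof -
  have eq: "(\<lambda>\<omega>. (cmod (ind A i \<omega> - ind B i \<omega>))\<^sup>2) = indicator ((A - B \<union> (B - A)) `` {i})"
    by (auto simp: indicator_def fun_eq_iff)
  have "(A - B \<union> (B - A)) `` {i} \<in> sets (dyadic_space i)"
    using assms by (intro coarse_set_section coarse_set_Un coarse_set_Diff)
  then have "(A - B \<union> (B - A)) `` {i} \<inter> space (dyadic_space i) = (A - B \<union> (B - A)) `` {i}"
    using sets.sets_into_space by blast
  then show ?thesis unfolding eq coarse_dist_def by (simp only: Bochner_Integration.integral_indicator)
qed

lemma walsh_poly_window_preimage:
  assumes "i \<ge> 1"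
  shows "walsh_poly i (window s t i) (ind (window_preimage s t A) i)"
proof -
  have "walsh_poly i (window s t i) (\<lambda>\<omega>. (\<lambda>\<rho>. ind A i \<rho>) (restrict \<omega> (window s t i)))"
    by (rule walsh_poly_restrict[OF window_finite_subsets])
  moreover have "ind (window_preimage s t A) i \<omega> = ind A i (restrict \<omega> (window s t i))"
    if "\<omega> \<in> space (dyadic_space i)" for \<omega>
    using that assms by (simp add: indicator_def window_preimage_def coarse_union_def)
  ultimately show ?thesis by (simp add: walsh_poly_def)
qed

lemma walsh_poly_lin:
  assumes "walsh_poly i W f" "walsh_poly i W g"
  shows "walsh_poly i W (\<lambda>\<omega>. a * f \<omega> + b * g \<omega>)"
proof -
  obtain c where c: "\<And>\<omega>. \<omega> \<in> space (dyadic_space i) \<Longrightarrow> f \<omega> = (\<Sum>M\<in>Pow W. c M * walsh M \<omega>)"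
    using assms(1) unfolding walsh_poly_def by auto
  obtain d where d: "\<And>\<omega>. \<omega> \<in> space (dyadic_space i) \<Longrightarrow> g \<omega> = (\<Sum>M\<in>Pow W. d M * walsh M \<omega>)"
    using assms(2) unfolding walsh_poly_def by auto
  show ?thesis unfolding walsh_poly_def
    by (intro exI[of _ "\<lambda>M. a * c M + b * d M"])
       (simp add: c d sum_distrib_left sum.distrib[symmetric] distrib_right mult.assoc)
qed

text \<open>The linear span in a form suited to induction on each argument of a sesquilinear
  expression. The coefficients \<open>a\<close> and \<open>b\<close> do not depend on
  \<open>i\<close>, so convergence in \<open>i\<close> is preserved by linear combinations.\<close>

inductive_set ind_span :: "(nat \<times> 'a) set set \<Rightarrow> (nat \<Rightarrow> 'a \<Rightarrow> complex) set" for \<D> where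
  ind: "A \<in> \<D> \<Longrightarrow> ind A \<in> ind_span \<D>"
| lin: "f \<in> ind_span \<D> \<Longrightarrow> g \<in> ind_span \<D> \<Longrightarrow> (\<lambda>i \<omega>. a * f i \<omega> + b * g i \<omega>) \<in> ind_span \<D>"

lemma ind_span_mono: "f \<in> ind_span \<D> \<Longrightarrow> \<D> \<subseteq> \<E> \<Longrightarrow> f \<in> ind_span \<E>"
  by (induction rule: ind_span.induct) (auto intro: ind_span.intros)

lemma ind_span_mult:
  assumes \<D>: "\<And>A B. A \<in> \<D> \<Longrightarrow> B \<in> \<D> \<Longrightarrow> A \<inter> B \<in> \<D>"
    and f: "f \<in> ind_span \<D>" and g: "g \<in> ind_span \<D>"
  shows "(\<lambda>i \<omega>. f i \<omega> * g i \<omega>) \<in> ind_span \<D>"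
  using f
proof induction
  case (ind A)
  note A = ind
  show ?case using g
  proof induction
    case (ind B)
    have "ind (A \<inter> B) \<in> ind_span \<D>" by (rule ind_span.ind[OF \<D>[OF A ind]])
    then show ?case by (simp add: indicator_inter_arith)
  next
    case (lin g h a b)
    from ind_span.lin[OF lin.IH, of a b] show ?case by (simp add: algebra_simps)
  qed
next
  case (lin f h a b)
  from ind_span.lin[OF lin.IH, of a b] show ?case by (simp add: algebra_simps)
qed

lemma norm_lin_square_le:
  "(cmod (a * u + b * v))\<^sup>2 \<le> 2 * (cmod a)\<^sup>2 * (cmod u)\<^sup>2 + 2 * (cmod b)\<^sup>2 * (cmod v)\<^sup>2"
proof -
  have "(cmod (a * u + b * v))\<^sup>2 \<le> (cmod (a * u) + cmod (b * v))\<^sup>2"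
    by (intro power_mono norm_triangle_ineq norm_ge_zero)
  also have "\<dots> \<le> 2 * (cmod (a * u))\<^sup>2 + 2 * (cmod (b * v))\<^sup>2"
    using sum_squares_ge_zero[of "cmod (a * u) - cmod (b * v)" 0]
    by (simp add: power2_eq_square algebra_simps)
  finally show ?thesis by (simp add: norm_mult power_mult_distrib)
qed

lemma square_integrable_lin:
  assumes f: "square_integrable M f" and g: "square_integrable M g"
  shows "square_integrable M (\<lambda>\<omega>. a * f \<omega> + b * g \<omega>)"
    and "(\<integral>\<omega>. (cmod (a * f \<omega> + b * g \<omega>))\<^sup>2 \<partial>M) \<le>
      2 * (cmod a)\<^sup>2 * (\<integral>\<omega>. (cmod (f \<omega>))\<^sup>2 \<partial>M) + 2 * (cmod b)\<^sup>2 * (\<integral>\<omega>. (cmod (g \<omega>))\<^sup>2 \<partial>M)"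
proof -
  have [measurable]: "f \<in> borel_measurable M" "g \<in> borel_measurable M"
    and int: "integrable M (\<lambda>\<omega>. (cmod (f \<omega>))\<^sup>2)" "integrable M (\<lambda>\<omega>. (cmod (g \<omega>))\<^sup>2)"
    using f g by (auto simp: square_integrable_def)
  have bound: "integrable M (\<lambda>\<omega>. 2 * (cmod a)\<^sup>2 * (cmod (f \<omega>))\<^sup>2 + 2 * (cmod b)\<^sup>2 * (cmod (g \<omega>))\<^sup>2)"
    using int by simp
  have lin: "integrable M (\<lambda>\<omega>. (cmod (a * f \<omega> + b * g \<omega>))\<^sup>2)"
  proof (rule Bochner_Integration.integrable_bound[OF bound])
    show "AE \<omega> in M. norm ((cmod (a * f \<omega> + b * g \<omega>))\<^sup>2) \<le>
      norm (2 * (cmod a)\<^sup>2 * (cmod (f \<omega>))\<^sup>2 + 2 * (cmod b)\<^sup>2 * (cmod (g \<omega>))\<^sup>2)"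
      by (intro AE_I2) (simp add: norm_lin_square_le)
  qed measurable
  then show "square_integrable M (\<lambda>\<omega>. a * f \<omega> + b * g \<omega>)" by (simp add: square_integrable_def)
  have "(\<integral>\<omega>. (cmod (a * f \<omega> + b * g \<omega>))\<^sup>2 \<partial>M) \<le>
    (\<integral>\<omega>. 2 * (cmod a)\<^sup>2 * (cmod (f \<omega>))\<^sup>2 + 2 * (cmod b)\<^sup>2 * (cmod (g \<omega>))\<^sup>2 \<partial>M)"
    by (intro integral_mono lin bound norm_lin_square_le)
  then show "(\<integral>\<omega>. (cmod (a * f \<omega> + b * g \<omega>))\<^sup>2 \<partial>M) \<le>
      2 * (cmod a)\<^sup>2 * (\<integral>\<omega>. (cmod (f \<omega>))\<^sup>2 \<partial>M) + 2 * (cmod b)\<^sup>2 * (\<integral>\<omega>. (cmod (g \<omega>))\<^sup>2 \<partial>M)"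
    using int by simp
qed

lemma ind_span_square_integrable:
  assumes "f \<in> ind_span \<D>" "\<And>A. A \<in> \<D> \<Longrightarrow> coarse_set dyadic_space A" "i \<ge> 1"
  shows "square_integrable (dyadic_space i) (f i)"
  using assms(1)
proof induction
  case (ind A)
  then show ?case by (rule ind_square_integrable[OF assms(2) assms(3)])
next
  case (lin f g a b)
  show ?case by (rule square_integrable_lin(1)[OF lin.IH])
qed

lemma convergent_spectral_form_span:
  assumes conv: "\<And>A B. A \<in> \<D> \<Longrightarrow> B \<in> \<D> \<Longrightarrow> convergent (\<lambda>i. spectral_form i (F i) (ind A i) (ind B i))"
    and sets: "\<And>A. A \<in> \<D> \<Longrightarrow> coarse_set dyadic_space A"
    and F: "\<And>i. F i \<in> finite_subsets i"
    and f: "f \<in> ind_span \<D>" and g: "g \<in> ind_span \<D>"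
  shows "convergent (\<lambda>i. spectral_form i (F i) (f i) (g i))"
proof -
  have int: "\<forall>\<^sub>F i in sequentially. integrable (dyadic_space i) (h i)" if "h \<in> ind_span \<D>" for h
    using eventually_ge_at_top[of 1]
    by eventually_elim (intro square_integrable_integrable ind_span_square_integrable[OF that sets])
  show ?thesis using f
  proof induction
    case (ind A)
    note A = ind
    show ?case using g
    proof induction
      case (ind B)
      show ?case by (rule conv[OF A ind])
    next
      case (lin g h a b)
      have "\<forall>\<^sub>F i in sequentially. spectral_form i (F i) (ind A i) (\<lambda>\<omega>. a * g i \<omega> + b * h i \<omega>) =
         cnj a * spectral_form i (F i) (ind A i) (g i) + cnj b * spectral_form i (F i) (ind A i) (h i)"
        using int[OF lin.hyps(1)] int[OF lin.hyps(2)]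
        by eventually_elim (rule spectral_form_lin_right[OF _ _ F])
      then show ?case
        by (subst convergent_cong) (auto intro!: convergent_add convergent_mult convergent_const lin.IH)
    qed
  next
    case (lin f h a b)
    have "\<forall>\<^sub>F i in sequentially. spectral_form i (F i) (\<lambda>\<omega>. a * f i \<omega> + b * h i \<omega>) (g i) =
       a * spectral_form i (F i) (f i) (g i) + b * spectral_form i (F i) (h i) (g i)"
      using int[OF lin.hyps(1)] int[OF lin.hyps(2)]
      by eventually_elim (rule spectral_form_lin_left[OF _ _ F])
    then show ?case
      by (subst convergent_cong) (auto intro!: convergent_add convergent_mult convergent_const lin.IH)
  qed
qed

text \<open>The squared L2 distance of two indicators is the measure of the symmetric difference,
  and the third indicator has norm at most 1; \<open>spectral_form_le\<close> then gives the square
  root. The second bound is the conjugate of the first.\<close>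

lemma spectral_form_ind_diff_le:
  assumes sets: "coarse_set dyadic_space A" "coarse_set dyadic_space B" "coarse_set dyadic_space C" and i: "i \<ge> 1"
    and F: "F \<in> finite_subsets i"
  shows "cmod (spectral_form i F (ind A i) (ind C i) - spectral_form i F (ind B i) (ind C i)) \<le> sqrt (coarse_dist dyadic_space i A B)"
    "cmod (spectral_form i F (ind C i) (ind A i) - spectral_form i F (ind C i) (ind B i)) \<le> sqrt (coarse_dist dyadic_space i A B)"
proof -
  note si = ind_square_integrable[OF sets(1) i] ind_square_integrable[OF sets(2) i] ind_square_integrable[OF sets(3) i]
  note int = si[THEN square_integrable_integrable]
  have diff: "square_integrable (dyadic_space i) (\<lambda>\<omega>. 1 * ind A i \<omega> + (-1) * ind B i \<omega>)"
  proof (rule ind_span_square_integrable[of "\<lambda>i \<omega>. 1 * ind A i \<omega> + (-1) * ind B i \<omega>" "{A, B}"])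
    show "(\<lambda>i \<omega>. 1 * ind A i \<omega> + (-1) * ind B i \<omega>) \<in> ind_span {A, B}"
      by (intro ind_span.intros) simp_all
  qed (use sets i in auto)
  have l2: "l2_norm (dyadic_space i) (\<lambda>\<omega>. 1 * ind A i \<omega> + (-1) * ind B i \<omega>) = sqrt (coarse_dist dyadic_space i A B)"
    unfolding l2_norm_def ind_diff_l2[OF sets(1,2) i, symmetric] by simp
  have "cmod (spectral_form i F (\<lambda>\<omega>. 1 * ind A i \<omega> + (-1) * ind B i \<omega>) (ind C i)) \<le> sqrt (coarse_dist dyadic_space i A B) * 1"
    unfolding l2[symmetric]
    by (rule order_trans[OF spectral_form_le[OF diff si(3) F]]) (intro mult_left_mono ind_l2_le sets i l2_norm_nonneg)
  then show 1: "cmod (spectral_form i F (ind A i) (ind C i) - spectral_form i F (ind B i) (ind C i)) \<le> sqrt (coarse_dist dyadic_space i A B)"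
    unfolding spectral_form_lin_left[OF int(1,2) F] by simp
  have "spectral_form i F (ind C i) (ind A i) - spectral_form i F (ind C i) (ind B i)
    = cnj (spectral_form i F (ind A i) (ind C i) - spectral_form i F (ind B i) (ind C i))"
    unfolding complex_cnj_diff by (simp only: spectral_form_cnj[symmetric])
  with 1 show "cmod (spectral_form i F (ind C i) (ind A i) - spectral_form i F (ind C i) (ind B i)) \<le> sqrt (coarse_dist dyadic_space i A B)"
    by (simp only: complex_mod_cnj)
qed

lemma convergent_spectral_form_approximable:
  assumes conv: "\<And>A B. A \<in> \<D> \<Longrightarrow> B \<in> \<D> \<Longrightarrow> convergent (\<lambda>i. spectral_form i (F i) (ind A i) (ind B i))"
    and sets: "\<And>A. A \<in> \<D> \<Longrightarrow> coarse_set dyadic_space A"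
    and F: "\<And>i. F i \<in> finite_subsets i"
    and A: "A \<in> approximable dyadic_space \<D>" and B: "B \<in> approximable dyadic_space \<D>"
  shows "convergent (\<lambda>i. spectral_form i (F i) (ind A i) (ind B i))"
proof (rule convergent_approx)
  fix \<epsilon> :: real assume \<epsilon>: "\<epsilon> > 0"
  \<comment> \<open>Squared, because the form varies like the square root of the coarse
    distance.\<close>
  then have e: "(\<epsilon> / 2)\<^sup>2 > 0" by simp
  obtain A' where A': "A' \<in> \<D>" "\<forall>\<^sub>F i in sequentially. coarse_dist dyadic_space i A A' < (\<epsilon> / 2)\<^sup>2"
    using dyadic.approximableE[OF A e] by blast
  obtain B' where B': "B' \<in> \<D>" "\<forall>\<^sub>F i in sequentially. coarse_dist dyadic_space i B B' < (\<epsilon> / 2)\<^sup>2"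
    using dyadic.approximableE[OF B e] by blast
  note cs = dyadic.approximable_coarse_set[OF A] dyadic.approximable_coarse_set[OF B] sets[OF A'(1)] sets[OF B'(1)]
  have "\<forall>\<^sub>F i in sequentially. norm (spectral_form i (F i) (ind A i) (ind B i) - spectral_form i (F i) (ind A' i) (ind B' i)) \<le> \<epsilon>"
    using A'(2) B'(2) eventually_ge_at_top[of 1]
  proof eventually_elim
    case (elim i)
    have s: "sqrt (coarse_dist dyadic_space i A A') \<le> \<epsilon> / 2" "sqrt (coarse_dist dyadic_space i B B') \<le> \<epsilon> / 2"
      using elim \<epsilon> by (intro real_le_lsqrt; simp add: less_imp_le)+
    let ?f = "spectral_form i (F i)"
    have "norm (?f (ind A i) (ind B i) - ?f (ind A' i) (ind B' i)) \<le>
      norm (?f (ind A i) (ind B i) - ?f (ind A' i) (ind B i)) + norm (?f (ind A' i) (ind B i) - ?f (ind A' i) (ind B' i))"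
      by (rule norm_diff_triangle_ineq[THEN order_trans[rotated]]) simp
    also have "\<dots> \<le> \<epsilon> / 2 + \<epsilon> / 2"
      using spectral_form_ind_diff_le(1)[OF cs(1,3,2) elim(3) F] spectral_form_ind_diff_le(2)[OF cs(2,4,3) elim(3) F] s
      by (intro add_mono) (rule order_trans, assumption+)+
    finally show ?case by simp
  qed
  then show "\<exists>z. convergent z \<and> (\<forall>\<^sub>F i in sequentially. norm (spectral_form i (F i) (ind A i) (ind B i) - z i) \<le> \<epsilon>)"
    using conv[OF A'(1) B'(1)] by (intro exI conjI)
qed

lemma coarse_set_window_preimage:
  assumes "A \<subseteq> coarse_union (window_space s t)"
  shows "coarse_set dyadic_space (window_preimage s t A)"
  unfolding coarse_set_def
proof (intro conjI allI impI)
  show "window_preimage s t A \<subseteq> coarse_union dyadic_space" by (auto simp: window_preimage_def)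
  fix i :: nat assume i: "i \<ge> 1"
  have "A `` {i} \<in> sets (window_space s t i)"
    by (rule coarse_set_section[OF coarse_set_window[OF assms] i])
  then have "(\<lambda>\<omega>. restrict \<omega> (window s t i)) -` (A `` {i}) \<inter> space (dyadic_space i) \<in> sets (dyadic_space i)"
    by (rule measurable_sets[OF restrict_window_measurable])
  moreover have "(\<lambda>\<omega>. restrict \<omega> (window s t i)) -` (A `` {i}) \<inter> space (dyadic_space i) = window_preimage s t A `` {i}"
    unfolding window_preimage_section[OF i] by auto
  ultimately show "window_preimage s t A `` {i} \<in> sets (dyadic_space i)" by simp
qed

section \<open>Adjacent windows: the product sample space seen from the dyadic space\<close>

definition pair_preimage :: "(nat \<Rightarrow> real) \<Rightarrow> (nat \<Rightarrow> real) \<Rightarrow> (nat \<Rightarrow> real)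
    \<Rightarrow> (nat \<times> (real \<Rightarrow> real) \<times> (real \<Rightarrow> real)) set \<Rightarrow> (nat \<times> (real \<Rightarrow> real)) set" where
  "pair_preimage r s t C = {(i, \<omega>) \<in> coarse_union dyadic_space.
     (i, restrict \<omega> (window r s i), restrict \<omega> (window s t i)) \<in> C}"

abbreviation pair_space :: "(nat \<Rightarrow> real) \<Rightarrow> (nat \<Rightarrow> real) \<Rightarrow> (nat \<Rightarrow> real) \<Rightarrow> nat
    \<Rightarrow> ((real \<Rightarrow> real) \<times> (real \<Rightarrow> real)) measure" where
  "pair_space r s t i \<equiv> window_space r s i \<Otimes>\<^sub>M window_space s t i"

lemma prob_spaces_pair_space: "prob_spaces (pair_space r s t)"
proof (rule prob_spaces.intro)
  fix i :: nat
  interpret A: prob_space "window_space r s i" by (rule prob_space_window_space)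
  interpret B: prob_space "window_space s t i" by (rule prob_space_window_space)
  interpret pair_prob_space "window_space r s i" "window_space s t i" ..
  show "prob_space (pair_space r s t i)" by (rule prob_space_axioms)
qed

lemma windows_disjoint: "window r s i \<inter> window s t i = {}"
  by (auto simp: window_def)

lemma windows_union: "r i \<le> s i \<Longrightarrow> s i \<le> t i \<Longrightarrow> window r t i = window r s i \<union> window s t i"
  by (auto simp: window_def)

text \<open>Independence of disjoint windows, read off from the coefficient at the empty set: it is
  the mean, and it is multiplicative by \<open>walsh_coeff_mult\<close>.\<close>

lemma measure_rectangle:
  assumes A: "A \<subseteq> coarse_union (window_space r s)" and B: "B \<subseteq> coarse_union (window_space s t)" and i: "i \<ge> 1"
  shows "measure (dyadic_space i) ((window_preimage r s A \<inter> window_preimage s t B) `` {i})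
    = measure (dyadic_space i) (window_preimage r s A `` {i}) * measure (dyadic_space i) (window_preimage s t B `` {i})"
proof -
  let ?A = "window_preimage r s A" and ?B = "window_preimage s t B"
  note cs = coarse_set_window_preimage[OF A] coarse_set_window_preimage[OF B]
  have "complex_of_real (measure (dyadic_space i) ((?A \<inter> ?B) `` {i})) = walsh_coeff i (ind (?A \<inter> ?B) i) {}"
    by (rule ind_coeff_empty[OF coarse_set_Int[OF cs] i, symmetric])
  also have "\<dots> = walsh_coeff i (\<lambda>\<omega>. ind ?A i \<omega> * ind ?B i \<omega>) {}"
    by (simp only: indicator_inter_arith)
  also have "\<dots> = walsh_coeff i (ind ?A i) {} * walsh_coeff i (ind ?B i) {}"
    using walsh_coeff_mult[OF walsh_poly_window_preimage[OF i, of r s A] walsh_poly_window_preimage[OF i, of s t B]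
      window_finite_subsets window_finite_subsets windows_disjoint, where M = "{}"] by simp
  also have "\<dots> = complex_of_real (measure (dyadic_space i) (?A `` {i}) * measure (dyadic_space i) (?B `` {i}))"
    unfolding ind_coeff_empty[OF cs(1) i] ind_coeff_empty[OF cs(2) i] by simp
  finally show ?thesis by (simp only: of_real_eq_iff)
qed

text \<open>By independence the joint law of the two restrictions agrees with the product measure on
  rectangles, which determine it. This lets measures on the product be computed on the dyadic
  space.\<close>

lemma pair_space_distr:
  assumes i: "i \<ge> 1"
  shows "pair_space r s t i =
    distr (dyadic_space i) (pair_space r s t i) (\<lambda>\<omega>. (restrict \<omega> (window r s i), restrict \<omega> (window s t i)))"
proof (rule pair_measure_eqI)
  interpret D: prob_space "dyadic_space i" by (rule prob_space_dyadic)
  interpret A: prob_space "window_space r s i" by (rule prob_space_window_space)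
  interpret B: prob_space "window_space s t i" by (rule prob_space_window_space)
  show "sigma_finite_measure (window_space r s i)" "sigma_finite_measure (window_space s t i)"
    by (rule A.sigma_finite_measure_axioms B.sigma_finite_measure_axioms)+
  fix X Y assume X: "X \<in> sets (window_space r s i)" and Y: "Y \<in> sets (window_space s t i)"
  have XY: "X \<subseteq> space (window_space r s i)" "Y \<subseteq> space (window_space s t i)"
    using X Y by (simp_all add: sets_window_space)
  \<comment> \<open>A coarse set whose only nonempty section is \<open>X\<close> at the index
    \<open>i\<close>, so that \<open>measure_rectangle\<close> applies; likewise \<open>B\<close>
    for \<open>Y\<close>.\<close>
  define A where "A = {i} \<times> X"
  define B where "B = {i} \<times> Y"
  have A: "A \<subseteq> coarse_union (window_space r s)" "A `` {i} = X"
    using XY i by (auto simp: A_def coarse_union_def)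
  have B: "B \<subseteq> coarse_union (window_space s t)" "B `` {i} = Y"
    using XY i by (auto simp: B_def coarse_union_def)
  have meas: "(\<lambda>\<omega>. (restrict \<omega> (window r s i), restrict \<omega> (window s t i))) \<in> dyadic_space i \<rightarrow>\<^sub>M pair_space r s t i"
    by (intro measurable_Pair restrict_window_measurable)
  have "emeasure (distr (dyadic_space i) (pair_space r s t i) (\<lambda>\<omega>. (restrict \<omega> (window r s i), restrict \<omega> (window s t i)))) (X \<times> Y)
    = emeasure (dyadic_space i) ((\<lambda>\<omega>. (restrict \<omega> (window r s i), restrict \<omega> (window s t i))) -` (X \<times> Y) \<inter> space (dyadic_space i))"
    using X Y by (intro emeasure_distr[OF meas] pair_measureI)
  also have "(\<lambda>\<omega>. (restrict \<omega> (window r s i), restrict \<omega> (window s t i))) -` (X \<times> Y) \<inter> space (dyadic_space i)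
    = (window_preimage r s A \<inter> window_preimage s t B) `` {i}"
    using i by (auto simp: window_preimage_def coarse_union_def A_def B_def)
  also have "emeasure (dyadic_space i) \<dots> = ennreal (measure (window_space r s i) X * measure (window_space s t i) Y)"
    unfolding D.emeasure_eq_measure measure_rectangle[OF A(1) B(1) i]
      measure_window_preimage[OF A(1) i, symmetric] measure_window_preimage[OF B(1) i, symmetric] A(2) B(2) ..
  also have "\<dots> = emeasure (window_space r s i) X * emeasure (window_space s t i) Y"
    unfolding A.emeasure_eq_measure B.emeasure_eq_measure by (simp add: ennreal_mult)
  finally show "emeasure (window_space r s i) X * emeasure (window_space s t i) Y =
    emeasure (distr (dyadic_space i) (pair_space r s t i) (\<lambda>\<omega>. (restrict \<omega> (window r s i), restrict \<omega> (window s t i)))) (X \<times> Y)"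
    by (rule sym)
qed simp

lemma measure_pair_preimage:
  assumes "coarse_set (pair_space r s t) C" "i \<ge> 1"
  shows "measure (pair_space r s t i) (C `` {i}) = measure (dyadic_space i) (pair_preimage r s t C `` {i})"
    and "pair_preimage r s t C `` {i} \<in> sets (dyadic_space i)"
proof -
  have meas: "(\<lambda>\<omega>. (restrict \<omega> (window r s i), restrict \<omega> (window s t i))) \<in> dyadic_space i \<rightarrow>\<^sub>M pair_space r s t i"
    by (intro measurable_Pair restrict_window_measurable)
  have eq: "(\<lambda>\<omega>. (restrict \<omega> (window r s i), restrict \<omega> (window s t i))) -` (C `` {i}) \<inter> space (dyadic_space i)
    = pair_preimage r s t C `` {i}"
    using assms(2) by (auto simp: pair_preimage_def coarse_union_def)
  note C = coarse_set_section[OF assms]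
  have "measure (pair_space r s t i) (C `` {i}) = measure (distr (dyadic_space i) (pair_space r s t i) (\<lambda>\<omega>. (restrict \<omega> (window r s i), restrict \<omega> (window s t i)))) (C `` {i})"
    using pair_space_distr[OF assms(2), of r s t] by simp
  also have "\<dots> = measure (dyadic_space i) (pair_preimage r s t C `` {i})"
    unfolding measure_distr[OF meas C] eq ..
  finally show "measure (pair_space r s t i) (C `` {i}) = measure (dyadic_space i) (pair_preimage r s t C `` {i})" .
  show "pair_preimage r s t C `` {i} \<in> sets (dyadic_space i)"
    using measurable_sets[OF meas C] unfolding eq .
qed

lemma pair_preimage_ops:
  "pair_preimage r s t (A \<inter> B) = pair_preimage r s t A \<inter> pair_preimage r s t B"
  "pair_preimage r s t (A \<union> B) = pair_preimage r s t A \<union> pair_preimage r s t B"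
  "pair_preimage r s t (A - B) = pair_preimage r s t A - pair_preimage r s t B"
  "pair_preimage r s t {} = {}"
  by (auto simp: pair_preimage_def)

lemma pair_preimage_full: "pair_preimage r s t (coarse_union (pair_space r s t)) = coarse_union dyadic_space"
proof -
  have "(i, restrict \<omega> (window r s i), restrict \<omega> (window s t i)) \<in> coarse_union (pair_space r s t)"
    if "(i, \<omega>) \<in> coarse_union dyadic_space" for i \<omega>
    using that restrict_window_space[of \<omega> i r s] restrict_window_space[of \<omega> i s t]
    by (simp add: coarse_union_def space_pair_measure)
  then show ?thesis unfolding pair_preimage_def by blast
qed

lemma coarse_dist_pair:
  assumes "coarse_set (pair_space r s t) A" "coarse_set (pair_space r s t) B" "i \<ge> 1"
  shows "coarse_dist (pair_space r s t) i A B = coarse_dist dyadic_space i (pair_preimage r s t A) (pair_preimage r s t B)"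
  unfolding coarse_dist_def pair_preimage_ops[symmetric]
  by (intro measure_pair_preimage(1) coarse_set_Un coarse_set_Diff assms)

lemma pair_preimage_times:
  "pair_preimage r s t (coarse_times A B) = window_preimage r s A \<inter> window_preimage s t B"
  by (auto simp: pair_preimage_def coarse_times_def window_preimage_def)

lemma coarse_set_times:
  assumes A: "A \<subseteq> coarse_union (window_space r s)" and B: "B \<subseteq> coarse_union (window_space s t)"
  shows "coarse_set (pair_space r s t) (coarse_times A B)"
  unfolding coarse_set_def
proof (intro conjI allI impI)
  show "coarse_times A B \<subseteq> coarse_union (pair_space r s t)"
    using A B by (auto simp: coarse_times_def coarse_union_def space_pair_measure)
  fix i :: nat assume i: "1 \<le> i"
  have "coarse_times A B `` {i} = (A `` {i}) \<times> (B `` {i})" by (auto simp: coarse_times_def)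
  then show "coarse_times A B `` {i} \<in> sets (pair_space r s t i)"
    using coarse_set_section[OF coarse_set_window[OF A] i] coarse_set_section[OF coarse_set_window[OF B] i] by simp
qed

lemma coarse_dist_times:
  assumes "A \<subseteq> coarse_union (window_space r s)" "B \<subseteq> coarse_union (window_space s t)"
    "A' \<subseteq> coarse_union (window_space r s)" "B' \<subseteq> coarse_union (window_space s t)" "i \<ge> 1"
  shows "coarse_dist (pair_space r s t) i (coarse_times A B) (coarse_times A' B')
    \<le> coarse_dist (window_space r s) i A A' + coarse_dist (window_space s t) i B B'"
  unfolding coarse_dist_pair[OF coarse_set_times[OF assms(1,2)] coarse_set_times[OF assms(3,4)] assms(5)]
    pair_preimage_times coarse_dist_window[OF assms(1,3,5)] coarse_dist_window[OF assms(2,4,5)]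
  by (intro dyadic.coarse_dist_Int coarse_set_window_preimage assms)

section \<open>Dense rectangles and the factorization property\<close>

locale dyadic_factorization =
  fixes \<A> :: "(nat \<times> (real \<Rightarrow> real)) set set"
  assumes factorization: "dyadic_coarse_factorization \<A>"
begin

lemma coarse_sigma_field: "coarse_sigma_field dyadic_space \<A>"
  using factorization unfolding dyadic_coarse_factorization_def coarse_prob_space_def by blast

lemma sets_\<A>: "A \<in> \<A> \<Longrightarrow> coarse_set dyadic_space A"
  using coarse_sigma_field unfolding coarse_sigma_field_def by blast

lemma closed_\<A>: "coarse_closed dyadic_space \<A>"
  using coarse_sigma_field unfolding coarse_sigma_field_def by blast

lemma algebra_\<A>: "coarse_algebra dyadic_space \<A>"
  by (rule dyadic.closed_algebra[OF closed_\<A> sets_\<A>])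

lemma convergent_\<A>: "A \<in> \<A> \<Longrightarrow> convergent (\<lambda>i. measure (dyadic_space i) (A `` {i}))"
  using coarse_sigma_field unfolding coarse_sigma_field_def by blast

lemma window_fieldD:
  assumes "A \<in> window_field \<A> s t"
  shows "A \<subseteq> coarse_union (window_space s t)" "window_preimage s t A \<in> \<A>"
  using assms by (auto simp: window_field_def)

lemma window_field_algebra: "coarse_algebra (window_space s t) (window_field \<A> s t)"
proof -
  note \<A> = coarse_algebraD[OF algebra_\<A>]
  show ?thesis unfolding coarse_algebra_def
  proof (intro conjI ballI)
    fix A assume A: "A \<in> window_field \<A> s t"
    show "coarse_set (window_space s t) A" by (rule coarse_set_window[OF window_fieldD(1)[OF A]])
  next
    show "{} \<in> window_field \<A> s t" using \<A>(2) by (simp add: window_field_def window_preimage_empty)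
  next
    fix A B assume AB: "A \<in> window_field \<A> s t" "B \<in> window_field \<A> s t"
    note D = window_fieldD[OF AB(1)] window_fieldD[OF AB(2)]
    show "A \<inter> B \<in> window_field \<A> s t"
      using D(1) \<A>(3)[OF D(2) D(4)] by (auto simp: window_field_def window_preimage_Int)
    show "A \<union> B \<in> window_field \<A> s t"
      using D(1,3) \<A>(4)[OF D(2) D(4)] by (auto simp: window_field_def window_preimage_Un)
    show "coarse_union (window_space s t) - A \<in> window_field \<A> s t"
      using \<A>(5)[OF D(2)] by (auto simp: window_field_def window_preimage_Diff window_preimage_full)
  qed
qed

text \<open>A subspace of a separable pseudometric space is separable. For each member
  \<open>G\<close> of a countable dense algebra and each tolerance \<open>1 / Suc n\<close>, some
  window set within that tolerance of \<open>G\<close> is selected if one exists; a given window set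
  \<open>A\<close> near \<open>G\<close> is itself a witness, so the selected set is within twice
  the tolerance of \<open>A\<close>.\<close>

lemma window_field_separable:
  obtains \<D> where "countable \<D>" "\<D> \<subseteq> window_field \<A> s t"
    "\<And>A \<epsilon>. A \<in> window_field \<A> s t \<Longrightarrow> \<epsilon> > 0 \<Longrightarrow>
      \<exists>B\<in>\<D>. \<forall>\<^sub>F i in sequentially. coarse_dist (window_space s t) i A B < \<epsilon>"
proof -
  obtain \<G> where \<G>: "countable \<G>" "coarse_algebra dyadic_space \<G>" "\<G> \<subseteq> \<A>" "\<A> \<subseteq> approximable dyadic_space \<G>"
    using dyadic.coarse_sigma_field_separable[OF coarse_sigma_field] .
  define near where "near G n B \<longleftrightarrow> B \<in> window_field \<A> s t \<and>
    (\<forall>\<^sub>F i in sequentially. coarse_dist dyadic_space i (window_preimage s t B) G < 1 / real (Suc n))" for G n B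
  define pick where "pick G n = (SOME B. near G n B)" for G n
  define \<D> where "\<D> = {pick G n |G n. G \<in> \<G> \<and> (\<exists>B. near G n B)}"
  have pick: "near G n (pick G n)" if "near G n B" for G n B
    unfolding pick_def by (rule someI[of "near G n", OF that])
  show thesis
  proof
    have "\<D> \<subseteq> (\<lambda>(G, n). pick G n) ` (\<G> \<times> UNIV)" unfolding \<D>_def by auto
    moreover have "countable ((\<lambda>(G, n). pick G n) ` (\<G> \<times> (UNIV :: nat set)))"
      by (intro countable_image countable_SIGMA \<G>(1)) auto
    ultimately show "countable \<D>" by (rule countable_subset)
    show "\<D> \<subseteq> window_field \<A> s t"
      using pick unfolding \<D>_def near_def by blast
    fix A \<epsilon> assume A: "A \<in> window_field \<A> s t" and \<epsilon>: "\<epsilon> > (0::real)"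
    then have "\<epsilon> / 2 > 0" by simp
    then obtain n where n: "1 / real (Suc n) < \<epsilon> / 2" using nat_approx_posE by blast
    have pA: "window_preimage s t A \<in> approximable dyadic_space \<G>"
      using window_fieldD(2)[OF A] \<G>(4) by blast
    obtain G where G: "G \<in> \<G>" "\<forall>\<^sub>F i in sequentially. coarse_dist dyadic_space i (window_preimage s t A) G < 1 / real (Suc n)"
      by (rule dyadic.approximableE[OF pA, of "1 / real (Suc n)"]) simp
    then have "near G n A" using A by (simp add: near_def)
    from pick[OF this] have B: "near G n (pick G n)" .
    have "\<forall>\<^sub>F i in sequentially. coarse_dist (window_space s t) i A (pick G n) < \<epsilon>"
      using G(2) conjunct2[OF B[unfolded near_def]] eventually_ge_at_top[of 1]
    proof eventually_elim
      case (elim i)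
      have B': "pick G n \<in> window_field \<A> s t" using B by (simp add: near_def)
      note w = window_fieldD(1)[OF A] window_fieldD(1)[OF B']
      have "coarse_dist (window_space s t) i A (pick G n) =
        coarse_dist dyadic_space i (window_preimage s t A) (window_preimage s t (pick G n))"
        by (rule coarse_dist_window[OF w elim(3)])
      also have "\<dots> \<le> coarse_dist dyadic_space i (window_preimage s t A) G + coarse_dist dyadic_space i G (window_preimage s t (pick G n))"
        using coarse_algebraD(1)[OF \<G>(2) G(1)] elim(3) by (intro dyadic.coarse_dist_triangle coarse_set_window_preimage w)
      finally show ?case using elim(1,2) n dyadic.coarse_dist_commute[of i G "window_preimage s t (pick G n)"] by linarith
    qed
    moreover have "pick G n \<in> \<D>" unfolding \<D>_def using G(1) \<open>near G n A\<close> by blast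
    ultimately show "\<exists>B\<in>\<D>. \<forall>\<^sub>F i in sequentially. coarse_dist (window_space s t) i A B < \<epsilon>" by blast
  qed
qed

definition rectangles :: "(nat \<Rightarrow> real) \<Rightarrow> (nat \<Rightarrow> real) \<Rightarrow> (nat \<Rightarrow> real)
    \<Rightarrow> (nat \<times> (real \<Rightarrow> real) \<times> (real \<Rightarrow> real)) set set" where
  "rectangles r s t = {coarse_times A B |A B. A \<in> window_field \<A> r s \<and> B \<in> window_field \<A> s t}"

definition rectangle_algebra where
  "rectangle_algebra r s t = generated_algebra (pair_space r s t) (rectangles r s t)"

lemma rectangle_algebra_algebra: "coarse_algebra (pair_space r s t) (rectangle_algebra r s t)"
  unfolding rectangle_algebra_def
proof (rule generated_algebra_algebra)
  fix C assume "C \<in> rectangles r s t"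
  then show "coarse_set (pair_space r s t) C"
    unfolding rectangles_def using coarse_set_times[OF window_fieldD(1) window_fieldD(1)] by blast
qed

lemma rectangle_algebra_preimage: "C \<in> rectangle_algebra r s t \<Longrightarrow> pair_preimage r s t C \<in> \<A>"
  unfolding rectangle_algebra_def
proof (induction rule: generated_algebra.induct)
  note \<A> = coarse_algebraD[OF algebra_\<A>]
  { case empty show ?case using \<A>(2) by (simp add: pair_preimage_ops) }
  { case (base C)
    then obtain A B where "C = coarse_times A B" "A \<in> window_field \<A> r s" "B \<in> window_field \<A> s t"
      by (auto simp: rectangles_def)
    then show ?case using \<A>(3)[OF window_fieldD(2) window_fieldD(2)] by (simp add: pair_preimage_times) }
  { case (inter A B) then show ?case using \<A>(3) by (simp add: pair_preimage_ops) }
  { case (union A B) then show ?case using \<A>(4) by (simp add: pair_preimage_ops) }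
  { case (compl A) then show ?case using \<A>(5) by (simp add: pair_preimage_ops pair_preimage_full) }
qed

text \<open>The competitor in the intersection that defines the product. Rectangles with sides from
  countable dense families of the two factors approximate all rectangles; since limits of an algebra
  form an algebra, the countable algebra they generate is dense in the whole rectangle
  algebra.\<close>

lemma coarse_sigma_field_pair:
  "coarse_sigma_field (pair_space r s t) (approximable (pair_space r s t) (rectangle_algebra r s t))"
proof -
  interpret P: prob_spaces "pair_space r s t" by (rule prob_spaces_pair_space)
  obtain \<D>1 where D1: "countable \<D>1" "\<D>1 \<subseteq> window_field \<A> r s"
    "\<And>A \<epsilon>. A \<in> window_field \<A> r s \<Longrightarrow> \<epsilon> > 0 \<Longrightarrow> \<exists>B\<in>\<D>1. \<forall>\<^sub>F i in sequentially. coarse_dist (window_space r s) i A B < \<epsilon>"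
    using window_field_separable[of r s] by blast
  obtain \<D>2 where D2: "countable \<D>2" "\<D>2 \<subseteq> window_field \<A> s t"
    "\<And>A \<epsilon>. A \<in> window_field \<A> s t \<Longrightarrow> \<epsilon> > 0 \<Longrightarrow> \<exists>B\<in>\<D>2. \<forall>\<^sub>F i in sequentially. coarse_dist (window_space s t) i A B < \<epsilon>"
    using window_field_separable[of s t] by blast
  define \<R> where "\<R> = (\<lambda>(A, B). coarse_times A B) ` (\<D>1 \<times> \<D>2)"
  have \<R>_subset: "\<R> \<subseteq> rectangles r s t"
    unfolding \<R>_def rectangles_def using D1(2) D2(2) by auto
  have \<R>_alg: "coarse_algebra (pair_space r s t) (generated_algebra (pair_space r s t) \<R>)"
    using \<R>_subset rectangle_algebra_algebra[of r s t]
    by (intro generated_algebra_algebra coarse_algebraD(1)[OF rectangle_algebra_algebra, of _ r s t])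
       (auto simp: rectangle_algebra_def intro: generated_algebra.base)
  have dense: "rectangles r s t \<subseteq> approximable (pair_space r s t) (generated_algebra (pair_space r s t) \<R>)"
  proof
    fix C assume "C \<in> rectangles r s t"
    then obtain A B where C: "C = coarse_times A B" and A: "A \<in> window_field \<A> r s" and B: "B \<in> window_field \<A> s t"
      by (auto simp: rectangles_def)
    show "C \<in> approximable (pair_space r s t) (generated_algebra (pair_space r s t) \<R>)"
    proof (rule P.approximableI)
      show "coarse_set (pair_space r s t) C" unfolding C by (rule coarse_set_times[OF window_fieldD(1)[OF A] window_fieldD(1)[OF B]])
      fix \<epsilon> :: real assume "\<epsilon> > 0"
      then have e: "\<epsilon> / 2 > 0" by simp
      obtain A' where A': "A' \<in> \<D>1" "\<forall>\<^sub>F i in sequentially. coarse_dist (window_space r s) i A A' < \<epsilon> / 2"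
        using D1(3)[OF A e] by blast
      obtain B' where B': "B' \<in> \<D>2" "\<forall>\<^sub>F i in sequentially. coarse_dist (window_space s t) i B B' < \<epsilon> / 2"
        using D2(3)[OF B e] by blast
      have "\<forall>\<^sub>F i in sequentially. i \<ge> 1 \<longrightarrow> coarse_dist (pair_space r s t) i C (coarse_times A' B') < \<epsilon>"
        using A'(2) B'(2)
      proof eventually_elim
        case (elim i)
        have "coarse_dist (pair_space r s t) i C (coarse_times A' B')
          \<le> coarse_dist (window_space r s) i A A' + coarse_dist (window_space s t) i B B'" if "i \<ge> 1"
          unfolding C using A'(1) B'(1) D1(2) D2(2)
          by (intro coarse_dist_times window_fieldD(1) A B that) auto
        then show ?case using elim by auto
      qed
      moreover have "coarse_times A' B' \<in> generated_algebra (pair_space r s t) \<R>"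
        using A'(1) B'(1) by (intro generated_algebra.base) (auto simp: \<R>_def)
      ultimately show "\<exists>G\<in>generated_algebra (pair_space r s t) \<R>.
        \<forall>\<^sub>F i in sequentially. i \<ge> 1 \<longrightarrow> coarse_dist (pair_space r s t) i C G < \<epsilon>" by blast
    qed
  qed
  show ?thesis
  proof (rule P.approximable_sigma_field[OF rectangle_algebra_algebra _ \<R>_alg])
    fix G assume G: "G \<in> rectangle_algebra r s t"
    \<comment> \<open>The limit exists because the set pulled back to the dyadic space belongs to
      \<open>\<A>\<close>, where condition (e) is available.\<close>
    have "\<forall>\<^sub>F i in sequentially. measure (pair_space r s t i) (G `` {i}) = measure (dyadic_space i) (pair_preimage r s t G `` {i})"
      using eventually_ge_at_top[of 1]
      by eventually_elim (rule measure_pair_preimage(1)[OF coarse_algebraD(1)[OF rectangle_algebra_algebra G]])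
    then show "convergent (\<lambda>i. measure (pair_space r s t i) (G `` {i}))"
      by (subst convergent_cong) (auto intro: convergent_\<A> rectangle_algebra_preimage[OF G])
  next
    show "countable (generated_algebra (pair_space r s t) \<R>)"
      unfolding \<R>_def using D1(1) D2(1) by (intro countable_generated_algebra countable_image countable_SIGMA) auto
    show "generated_algebra (pair_space r s t) \<R> \<subseteq> rectangle_algebra r s t"
      by (rule generated_algebra_minimal[OF rectangle_algebra_algebra])
         (use \<R>_subset in \<open>auto simp: rectangle_algebra_def intro: generated_algebra.base\<close>)
    show "rectangle_algebra r s t \<subseteq> approximable (pair_space r s t) (generated_algebra (pair_space r s t) \<R>)"
      unfolding rectangle_algebra_def
      by (rule generated_algebra_minimal[OF P.approximable_algebra[OF \<R>_alg] dense])
  qed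
qed

text \<open>The product is contained in every coarse \<sigma>-field that contains the rectangles, in
  particular in the one just constructed. Every product set is thereby a limit of sets from the
  rectangle algebra.\<close>

lemma coarse_prod_subset:
  "coarse_prod (window_space r s) (window_field \<A> r s) (window_space s t) (window_field \<A> s t)
    \<subseteq> approximable (pair_space r s t) (rectangle_algebra r s t)"
  unfolding coarse_prod_def
proof (rule hull_minimal)
  show "coarse_sigma_field (pair_space r s t) (approximable (pair_space r s t) (rectangle_algebra r s t))"
    by (rule coarse_sigma_field_pair)
  interpret P: prob_spaces "pair_space r s t" by (rule prob_spaces_pair_space)
  have "C \<in> approximable (pair_space r s t) (rectangle_algebra r s t)" if "C \<in> rectangles r s t" for C
  proof -
    have "C \<in> rectangle_algebra r s t" unfolding rectangle_algebra_def using that by (rule generated_algebra.base)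
    then show ?thesis by (intro P.approximable_base coarse_algebraD(1)[OF rectangle_algebra_algebra])
  qed
  then show "{coarse_times A B |A B. A \<in> window_field \<A> r s \<and> B \<in> window_field \<A> s t}
    \<subseteq> approximable (pair_space r s t) (rectangle_algebra r s t)"
    unfolding rectangles_def by blast
qed

text \<open>The field of a window in its identification with a part of \<open>\<A>\<close>; working
  inside one sample space makes fields of different windows comparable.\<close>

definition preimage_field :: "(nat \<Rightarrow> real) \<Rightarrow> (nat \<Rightarrow> real) \<Rightarrow> (nat \<times> (real \<Rightarrow> real)) set set" where
  "preimage_field s t = window_preimage s t ` window_field \<A> s t"

lemma preimage_field_subset: "preimage_field s t \<subseteq> \<A>"
  unfolding preimage_field_def using window_fieldD(2) by blast

lemma preimage_field_algebra: "coarse_algebra dyadic_space (preimage_field s t)"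
proof -
  note w = coarse_algebraD[OF window_field_algebra[of s t]]
  show ?thesis unfolding coarse_algebra_def
  proof (intro conjI ballI)
    show "coarse_set dyadic_space A" if "A \<in> preimage_field s t" for A
      using that preimage_field_subset sets_\<A> by blast
    show "{} \<in> preimage_field s t"
      unfolding preimage_field_def using w(2) window_preimage_empty by (metis imageI)
    fix A B assume "A \<in> preimage_field s t" "B \<in> preimage_field s t"
    then obtain A' B' where *: "A = window_preimage s t A'" "A' \<in> window_field \<A> s t"
      "B = window_preimage s t B'" "B' \<in> window_field \<A> s t"
      by (auto simp: preimage_field_def)
    show "A \<inter> B \<in> preimage_field s t"
      unfolding preimage_field_def *(1,3) window_preimage_Int[symmetric] by (rule imageI[OF w(3)[OF *(2,4)]])
    show "A \<union> B \<in> preimage_field s t"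
      unfolding preimage_field_def *(1,3) window_preimage_Un[symmetric] by (rule imageI[OF w(4)[OF *(2,4)]])
    show "coarse_union dyadic_space - A \<in> preimage_field s t"
      unfolding preimage_field_def *(1) window_preimage_full[of s t, symmetric] window_preimage_Diff[symmetric]
      by (rule imageI[OF w(5)[OF *(2)]])
  qed
qed

text \<open>\<open>E\<close> will be a union of dyadic cells. Cutting it down to the window makes it
  finite and loses nothing, since functions of the window have zero coefficients at sets not
  contained in it.\<close>

definition form_convergent :: "real set \<Rightarrow> (nat \<Rightarrow> real) \<Rightarrow> (nat \<Rightarrow> real) \<Rightarrow> bool" where
  "form_convergent E s t \<longleftrightarrow> (\<forall>A\<in>preimage_field s t. \<forall>B\<in>preimage_field s t.
     convergent (\<lambda>i. spectral_form i (window s t i \<inter> E) (ind A i) (ind B i)))"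

text \<open>Intersections of rectangles are rectangles, and the full space is one, so the span is
  closed under products and contains 1. Unions and complements then follow from the linear formulas
  for their indicators.\<close>

lemma ind_rectangle_algebra:
  assumes "C \<in> rectangle_algebra r s t"
  shows "ind (pair_preimage r s t C) \<in> ind_span {A \<inter> B |A B. A \<in> preimage_field r s \<and> B \<in> preimage_field s t}"
    (is "_ \<in> ind_span ?\<D>")
proof -
  note a1 = coarse_algebraD[OF preimage_field_algebra[of r s]]
  note a2 = coarse_algebraD[OF preimage_field_algebra[of s t]]
  have int: "X \<inter> Y \<in> ?\<D>" if "X \<in> ?\<D>" "Y \<in> ?\<D>" for X Y
  proof -
    obtain A B A' B' where *: "X = A \<inter> B" "Y = A' \<inter> B'" "A \<in> preimage_field r s" "B \<in> preimage_field s t"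
      "A' \<in> preimage_field r s" "B' \<in> preimage_field s t"
      using \<open>X \<in> ?\<D>\<close> \<open>Y \<in> ?\<D>\<close> by blast
    then have "X \<inter> Y = (A \<inter> A') \<inter> (B \<inter> B')" by blast
    then show ?thesis using a1(3)[OF *(3,5)] a2(3)[OF *(4,6)] by blast
  qed
  have empty: "{} \<in> ?\<D>" using a1(2) a2(2) by blast
  have full: "coarse_union dyadic_space \<in> ?\<D>"
    using a1(5)[OF a1(2)] a2(5)[OF a2(2)] by fastforce
  have mult: "ind (X \<inter> Y) \<in> ind_span ?\<D>" if "ind X \<in> ind_span ?\<D>" "ind Y \<in> ind_span ?\<D>" for X Y
    using ind_span_mult[OF int that] by (simp add: indicator_inter_arith)
  show ?thesis using assms unfolding rectangle_algebra_def
  proof (induction rule: generated_algebra.induct)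
    case empty
    show ?case unfolding pair_preimage_ops by (rule ind_span.ind[OF \<open>{} \<in> ?\<D>\<close>])
  next
    case (base C)
    then obtain A B where *: "C = coarse_times A B" "A \<in> window_field \<A> r s" "B \<in> window_field \<A> s t"
      by (auto simp: rectangles_def)
    show ?case unfolding *(1) pair_preimage_times
      by (rule ind_span.ind) (use *(2,3) in \<open>unfold preimage_field_def, blast\<close>)
  next
    case (inter A B)
    show ?case unfolding pair_preimage_ops by (rule mult[OF inter.IH])
  next
    case (union A B)
    let ?A = "pair_preimage r s t A" and ?B = "pair_preimage r s t B"
    have "(\<lambda>i \<omega>. 1 * (1 * ind ?A i \<omega> + 1 * ind ?B i \<omega>) + (-1) * ind (?A \<inter> ?B) i \<omega>) \<in> ind_span ?\<D>"
      by (intro ind_span.lin union.IH mult)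
    moreover have "(\<lambda>i \<omega>. 1 * (1 * ind ?A i \<omega> + 1 * ind ?B i \<omega>) + (-1) * ind (?A \<inter> ?B) i \<omega>) = ind (?A \<union> ?B)"
      by (auto simp: fun_eq_iff indicator_def)
    ultimately show ?case unfolding pair_preimage_ops by simp
  next
    case (compl A)
    let ?A = "pair_preimage r s t A"
    have "(\<lambda>i \<omega>. 1 * ind (coarse_union dyadic_space) i \<omega> + (-1) * ind ?A i \<omega>) \<in> ind_span ?\<D>"
      by (intro ind_span.lin compl.IH ind_span.ind full)
    moreover have "?A \<subseteq> coarse_union dyadic_space" by (auto simp: pair_preimage_def)
    then have "(\<lambda>i \<omega>. 1 * ind (coarse_union dyadic_space) i \<omega> + (-1) * ind ?A i \<omega>) = ind (coarse_union dyadic_space - ?A)"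
      by (auto simp: fun_eq_iff indicator_def)
    ultimately show ?case unfolding pair_preimage_ops pair_preimage_full by simp
  qed
qed

text \<open>On rectangles the form is the product of the forms on the two windows. Convergence
  extends by sesquilinearity to the rectangle algebra and by continuity to its limits, which exhaust
  the field of the joined window by the factorization property.\<close>

theorem form_convergent_trans:
  assumes rs: "coarse_time_interval r s" and st: "coarse_time_interval s t"
    and Q: "form_convergent E r s" "form_convergent E s t"
  shows "form_convergent E r t"
proof -
  interpret P: prob_spaces "pair_space r s t" by (rule prob_spaces_pair_space)
  have le: "r i \<le> s i" "s i \<le> t i" if "i \<ge> 1" for i
    using rs st that by (auto simp: coarse_time_interval_def)
  define \<D> where "\<D> = {A \<inter> B |A B. A \<in> preimage_field r s \<and> B \<in> preimage_field s t}"
  let ?F = "\<lambda>i. window r t i \<inter> E"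
  have \<D>_sets: "coarse_set dyadic_space X" if "X \<in> \<D>" for X
    using that coarse_set_Int[OF coarse_algebraD(1)[OF preimage_field_algebra] coarse_algebraD(1)[OF preimage_field_algebra]]
    unfolding \<D>_def by blast
  have conv_\<D>: "convergent (\<lambda>i. spectral_form i (?F i) (ind X i) (ind Y i))" if X: "X \<in> \<D>" and Y: "Y \<in> \<D>" for X Y
  proof -
    obtain A\<^sub>1 A\<^sub>2 where A: "X = A\<^sub>1 \<inter> A\<^sub>2" "A\<^sub>1 \<in> preimage_field r s" "A\<^sub>2 \<in> preimage_field s t"
      using X unfolding \<D>_def by blast
    obtain B\<^sub>1 B\<^sub>2 where B: "Y = B\<^sub>1 \<inter> B\<^sub>2" "B\<^sub>1 \<in> preimage_field r s" "B\<^sub>2 \<in> preimage_field s t"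
      using Y unfolding \<D>_def by blast
    have poly: "walsh_poly i (window u v i) (ind Z i)" if "Z \<in> preimage_field u v" "i \<ge> 1" for Z u v i
      using that(1) walsh_poly_window_preimage[OF that(2)] unfolding preimage_field_def by blast
    have "\<forall>\<^sub>F i in sequentially. spectral_form i (?F i) (ind X i) (ind Y i) =
      spectral_form i (window r s i \<inter> E) (ind A\<^sub>1 i) (ind B\<^sub>1 i) * spectral_form i (window s t i \<inter> E) (ind A\<^sub>2 i) (ind B\<^sub>2 i)"
      using eventually_ge_at_top[of 1]
    proof eventually_elim
      case (elim i)
      show ?case
        unfolding A(1) B(1) windows_union[of r i s t, OF le[OF elim]] indicator_inter_arith
        by (intro spectral_form_mult poly A B elim window_finite_subsets windows_disjoint)
    qed
    then show ?thesis
      using Q A(2,3) B(2,3) unfolding form_convergent_def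
      by (subst convergent_cong) (auto intro!: convergent_mult)
  qed
  have conv_span: "convergent (\<lambda>i. spectral_form i (?F i) (f i) (g i))"
    if "f \<in> ind_span \<D>" "g \<in> ind_span \<D>" for f g
    by (rule convergent_spectral_form_span[OF conv_\<D> \<D>_sets window_Int_finite_subsets that])
  define \<G> where "\<G> = pair_preimage r s t ` rectangle_algebra r s t"
  have \<G>_sets: "coarse_set dyadic_space X" if "X \<in> \<G>" for X
    using that rectangle_algebra_preimage sets_\<A> unfolding \<G>_def by blast
  have conv_\<G>: "convergent (\<lambda>i. spectral_form i (?F i) (ind X i) (ind Y i))" if "X \<in> \<G>" "Y \<in> \<G>" for X Y
  proof (rule conv_span)
    show "ind X \<in> ind_span \<D>" "ind Y \<in> ind_span \<D>"
      using that ind_rectangle_algebra unfolding \<G>_def \<D>_def by auto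
  qed
  have "A \<in> approximable dyadic_space \<G>" if A: "A \<in> preimage_field r t" for A
  proof (rule dyadic.approximableI)
    show "coarse_set dyadic_space A" by (rule coarse_algebraD(1)[OF preimage_field_algebra A])
    obtain A' where A': "A = window_preimage r t A'" "A' \<in> window_field \<A> r t"
      using A by (auto simp: preimage_field_def)
    have "window_field \<A> r t = window_glue r s t `
            coarse_prod (window_space r s) (window_field \<A> r s) (window_space s t) (window_field \<A> s t)"
      using factorization[unfolded dyadic_coarse_factorization_def, THEN conjunct2, THEN conjunct1, rule_format, OF conjI[OF rs st]] .
    with A'(2) obtain C where C: "A' = window_glue r s t C"
      "C \<in> coarse_prod (window_space r s) (window_field \<A> r s) (window_space s t) (window_field \<A> s t)"
      by (auto simp only: image_iff)
    have C_approx: "C \<in> approximable (pair_space r s t) (rectangle_algebra r s t)"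
      by (rule subsetD[OF coarse_prod_subset C(2)])
    \<comment> \<open>Gluing and then pulling back to the dyadic space is the same as pulling back
      at once, because restricting first to \<open>[r, t)\<close> and then to a subwindow is one
      restriction.\<close>
    have AC: "A = pair_preimage r s t C"
    proof -
      have "(i, restrict \<omega> (window r t i)) \<in> window_glue r s t C \<longleftrightarrow>
        (i, restrict \<omega> (window r s i), restrict \<omega> (window s t i)) \<in> C" if "(i, \<omega>) \<in> coarse_union dyadic_space" for i \<omega>
      proof -
        have i: "i \<ge> 1" and \<omega>: "\<omega> \<in> space (dyadic_space i)" using that by (auto simp: coarse_union_def)
        have "window r s i \<subseteq> window r t i" "window s t i \<subseteq> window r t i"
          using windows_union[of r i s t, OF le[OF i]] by auto
        then have "restrict (restrict \<omega> (window r t i)) (window r s i) = restrict \<omega> (window r s i)"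
          "restrict (restrict \<omega> (window r t i)) (window s t i) = restrict \<omega> (window s t i)"
          by (simp_all add: Int_absorb1)
        moreover have "(i, restrict \<omega> (window r t i)) \<in> coarse_union (window_space r t)"
          using i restrict_window_space[OF \<omega>] by (simp add: coarse_union_def)
        ultimately show ?thesis by (simp add: window_glue_def)
      qed
      then show ?thesis unfolding A'(1) C(1) window_preimage_def pair_preimage_def by blast
    qed
    fix \<epsilon> :: real assume "\<epsilon> > 0"
    obtain G where G: "G \<in> rectangle_algebra r s t" "\<forall>\<^sub>F i in sequentially. coarse_dist (pair_space r s t) i C G < \<epsilon>"
      by (rule P.approximableE[OF C_approx \<open>\<epsilon> > 0\<close>])
    have "\<forall>\<^sub>F i in sequentially. i \<ge> 1 \<longrightarrow> coarse_dist dyadic_space i A (pair_preimage r s t G) < \<epsilon>"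
      using G(2)
    proof eventually_elim
      case (elim i)
      show ?case unfolding AC
        using elim coarse_dist_pair[OF P.approximable_coarse_set[OF C_approx] coarse_algebraD(1)[OF rectangle_algebra_algebra G(1)], of i]
        by (intro impI) simp
    qed
    then show "\<exists>G\<in>\<G>. \<forall>\<^sub>F i in sequentially. i \<ge> 1 \<longrightarrow> coarse_dist dyadic_space i A G < \<epsilon>"
      unfolding \<G>_def using G(1) by blast
  qed
  then show ?thesis
    unfolding form_convergent_def
    using convergent_spectral_form_approximable[OF conv_\<G> \<G>_sets window_Int_finite_subsets] by blast
qed

end

section \<open>Limit measures on the space of compact sets\<close>

lemma interval_subdivision:
  fixes m :: "nat \<Rightarrow> real"
  assumes "\<And>j. 0 \<le> m j" "m sums L" "a \<le> u" "u < a + L"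
  shows "\<exists>k. a + sum m {..<k} \<le> u \<and> u < a + sum m {..<Suc k}"
proof -
  have "(\<lambda>k. a + sum m {..<k}) \<longlonglongrightarrow> a + L"
    using assms(2) unfolding sums_def by (intro tendsto_intros)
  then have "\<forall>\<^sub>F k in sequentially. u < a + sum m {..<k}"
    using assms(4) by (rule order_tendstoD)
  then have ex: "\<exists>k. u < a + sum m {..<k}"
    by (auto simp: eventually_sequentially)
  define k where "k = (LEAST k. u < a + sum m {..<k})"
  have k: "u < a + sum m {..<k}"
    unfolding k_def by (rule LeastI_ex[OF ex])
  have "k \<noteq> 0" using k assms(3) by (intro notI) simp
  then obtain j where j: "k = Suc j" by (cases k) auto
  have "\<not> u < a + sum m {..<j}"
    using not_less_Least[of j "\<lambda>k. u < a + sum m {..<k}"] j unfolding k_def by auto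
  with k j show ?thesis by (intro exI[of _ j]) auto
qed

text \<open>Every natural number serves as a node on every level, possibly with weight 0, and one
  map \<open>\<pi>\<close> gives the parents on all levels. The total weight \<open>c\<close> is not
  normalized.\<close>

locale weight_tree =
  fixes m :: "nat \<Rightarrow> nat \<Rightarrow> real" and \<pi> :: "nat \<Rightarrow> nat" and c :: real
  assumes nonneg: "0 \<le> m n k"
    and root: "m 0 sums c"
    and children: "(\<lambda>j. if \<pi> j = k then m (Suc n) j else 0) sums m n k"
begin

text \<open>Siblings are laid side by side in the order of their labels, starting at the left end of
  the parent's interval; the sum collects the weights of the earlier siblings.\<close>

primrec left :: "nat \<Rightarrow> nat \<Rightarrow> real" where
  "left 0 = (\<lambda>k. sum (m 0) {..<k})"
| "left (Suc n) = (\<lambda>k. left n (\<pi> k) + (\<Sum>j<k. if \<pi> j = \<pi> k then m (Suc n) j else 0))"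

definition cell :: "nat \<Rightarrow> nat \<Rightarrow> real set" where
  "cell n k = {left n k..<left n k + m n k}"

lemma cell_subset_parent: "cell (Suc n) k \<subseteq> cell n (\<pi> k)"
proof -
  let ?f = "\<lambda>j. if \<pi> j = \<pi> k then m (Suc n) j else 0"
  have "sum ?f {..<Suc k} \<le> m n (\<pi> k)"
    using sum_le_suminf[of ?f "{..<Suc k}"] children[of "\<pi> k" n] nonneg
    by (auto simp: sums_iff)
  moreover have "0 \<le> sum ?f {..<k}" by (intro sum_nonneg) (auto simp: nonneg)
  ultimately show ?thesis by (auto simp: cell_def)
qed

lemma partial_sums_disjoint:
  fixes f :: "nat \<Rightarrow> real"
  assumes "\<And>j. 0 \<le> f j" "sum f {..<k} \<le> u" "u < sum f {..<Suc k}"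
    "sum f {..<k'} \<le> u" "u < sum f {..<Suc k'}"
  shows "k = k'"
proof -
  have mono: "sum f {..<Suc i} \<le> sum f {..<j}" if "i < j" for i j
    using that assms(1) by (intro sum_mono2) auto
  show ?thesis
    using mono[of k k'] mono[of k' k] assms(2-) by (cases k k' rule: linorder_cases) auto
qed

lemma cell_disjoint: "u \<in> cell n k \<Longrightarrow> u \<in> cell n k' \<Longrightarrow> k = k'"
proof (induction n arbitrary: k k')
  case 0
  then show ?case
    by (intro partial_sums_disjoint[of "m 0" k u k'] nonneg) (auto simp: cell_def)
next
  case (Suc n)
  then have p: "\<pi> k = \<pi> k'" using cell_subset_parent by blast
  let ?f = "\<lambda>j. if \<pi> j = \<pi> k then m (Suc n) j else 0"
  from Suc.prems p show ?case
    by (intro partial_sums_disjoint[of ?f k "u - left n (\<pi> k)" k']) (auto simp: cell_def nonneg)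
qed

lemma cell_cover: "u \<in> {0..<c} \<Longrightarrow> \<exists>k. u \<in> cell n k"
proof (induction n)
  case 0
  with interval_subdivision[OF nonneg root, of 0 u] show ?case
    by (auto simp: cell_def)
next
  case (Suc n)
  then obtain k where k: "u \<in> cell n k" by auto
  let ?f = "\<lambda>j. if \<pi> j = k then m (Suc n) j else 0"
  obtain j where j: "left n k + sum ?f {..<j} \<le> u" "u < left n k + sum ?f {..<Suc j}"
    using interval_subdivision[of ?f "m n k" "left n k" u, OF _ children, THEN exE] k nonneg
    unfolding cell_def by (smt (verit) atLeastLessThan_iff)
  \<comment> \<open>For any other \<open>j\<close> the summand is 0, both bounds coincide, and no
    \<open>u\<close> could lie between them.\<close>
  then have "\<pi> j = k" by (auto split: if_splits)
  with j show ?case by (auto simp: cell_def)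
qed

lemma cell_subset: "cell n k \<subseteq> {0..<c}"
proof (induction n arbitrary: k)
  case 0
  have "sum (m 0) {..<Suc k} \<le> c"
    using sum_le_suminf[of "m 0" "{..<Suc k}"] root nonneg by (auto simp: sums_iff)
  moreover have "0 \<le> sum (m 0) {..<k}" by (intro sum_nonneg nonneg)
  ultimately show ?case by (auto simp: cell_def)
next
  case (Suc n)
  then show ?case using cell_subset_parent by blast
qed

text \<open>On \<open>[0, c)\<close> exactly one interval of each level contains \<open>u\<close>,
  so the labels of \<open>u\<close> form a branch of the tree; elsewhere the value is
  unspecified.\<close>

definition label :: "nat \<Rightarrow> real \<Rightarrow> nat" where
  "label n u = (THE k. u \<in> cell n k)"

lemma label_eq: "u \<in> cell n k \<Longrightarrow> label n u = k"
  unfolding label_def using cell_disjoint by blast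

lemma label_eq_iff: "u \<in> {0..<c} \<Longrightarrow> label n u = k \<longleftrightarrow> u \<in> cell n k"
  using cell_cover label_eq by metis

lemma parent_label: "u \<in> {0..<c} \<Longrightarrow> \<pi> (label (Suc n) u) = label n u"
  by (metis cell_cover cell_subset_parent label_eq subsetD)

abbreviation base :: "real measure" where
  "base \<equiv> restrict_space lborel {0..<c}"

lemma label_vimage: "{u \<in> {0..<c}. label n u = k} = cell n k"
proof (intro equalityI subsetI)
  fix u assume "u \<in> {u \<in> {0..<c}. label n u = k}"
  then show "u \<in> cell n k" using label_eq_iff[of u n k] by simp
next
  fix u assume "u \<in> cell n k"
  then show "u \<in> {u \<in> {0..<c}. label n u = k}"
    using label_eq[of u n k] cell_subset[of n k] by blast
qed

lemma label_measurable [measurable]: "label n \<in> base \<rightarrow>\<^sub>M count_space UNIV"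
proof (subst measurable_count_space_eq2_countable)
  show "label n \<in> space base \<rightarrow> UNIV \<and> (\<forall>a\<in>UNIV. label n -` {a} \<inter> space base \<in> sets base)"
  proof (intro conjI ballI)
    fix k
    have "label n -` {k} \<inter> space base = cell n k"
      unfolding label_vimage[of n k, symmetric] by (auto simp: space_restrict_space)
    moreover have "cell n k \<in> sets base"
      using cell_subset[of n k] by (simp add: sets_restrict_space_iff) (simp add: cell_def)
    ultimately show "label n -` {k} \<inter> space base \<in> sets base" by simp
  qed auto
qed

lemma measure_label: "measure base {u \<in> space base. label n u = k} = m n k"
proof -
  have "{u \<in> space base. label n u = k} = cell n k"
    using label_vimage by (simp add: space_restrict_space)
  then show ?thesis
    using nonneg[of n k] cell_subset[of n k]
    by (simp add: measure_restrict_space) (simp add: cell_def)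
qed

lemma finite_measure_base: "finite_measure base"
proof (rule finite_measureI)
  have "emeasure base (space base) = emeasure lborel {0..<c}"
    by (simp add: space_restrict_space emeasure_restrict_space)
  also have "\<dots> \<noteq> \<infinity>" by (cases "0 \<le> c") auto
  finally show "emeasure base (space base) \<noteq> \<infinity>" .
qed

lemma measure_base: "measure base (space base) = c"
proof -
  have "0 \<le> c" using sums_le[OF _ sums_zero root] nonneg by auto
  then show ?thesis by (simp add: space_restrict_space measure_restrict_space)
qed

end

section \<open>Convergence of integrals of functions of a discrete label\<close>

lemma tendsto_approx:
  fixes y :: "nat \<Rightarrow> 'a::real_normed_vector"
  assumes "\<And>\<epsilon>. \<epsilon> > 0 \<Longrightarrow> \<exists>z l. z \<longlonglongrightarrow> l \<and> norm (l - L) \<le> \<epsilon> \<and> (\<forall>\<^sub>F i in sequentially. norm (y i - z i) \<le> \<epsilon>)"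
  shows "y \<longlonglongrightarrow> L"
proof (rule tendstoI)
  fix e :: real assume "e > 0"
  then obtain z l where z: "z \<longlonglongrightarrow> l" "norm (l - L) \<le> e/4"
     "\<forall>\<^sub>F i in sequentially. norm (y i - z i) \<le> e/4" using assms[of "e/4"] by auto
  have "\<forall>\<^sub>F i in sequentially. dist (z i) l < e/4" using z(1) \<open>e > 0\<close> by (intro tendstoD) auto
  with z(3) show "\<forall>\<^sub>F i in sequentially. dist (y i) L < e"
  proof eventually_elim
    case (elim i)
    have "y i - L = (y i - z i) + (z i - l) + (l - L)" by simp
    then have "norm (y i - L) \<le> norm (y i - z i) + norm (z i - l) + norm (l - L)"
      by (metis norm_triangle_ineq norm_triangle_mono order_refl)
    then show ?case using elim z(2) \<open>e > 0\<close> by (auto simp: dist_norm)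
  qed
qed

text \<open>Convergence of all atoms would allow mass to escape to large labels. Since the total
  masses converge to the sum of the limit weights, the mass on labels from \<open>N\<close> on is
  the total minus finitely many atoms, and this converges to the small tail of the limit.\<close>

lemma discrete_weak_convergence:
  fixes \<nu> :: "nat \<Rightarrow> 'a measure" and f :: "nat \<Rightarrow> 'a \<Rightarrow> nat" and h :: "nat \<Rightarrow> real"
  assumes fin: "\<And>i. finite_measure (\<nu> i)"
    and meas [measurable]: "\<And>i. f i \<in> \<nu> i \<rightarrow>\<^sub>M count_space UNIV"
    and lim: "\<And>k. (\<lambda>i. measure (\<nu> i) {x \<in> space (\<nu> i). f i x = k}) \<longlonglongrightarrow> m k"
    and total: "(\<lambda>i. measure (\<nu> i) (space (\<nu> i))) \<longlonglongrightarrow> c"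
    and m: "m sums c"
    and h: "\<And>k. \<bar>h k\<bar> \<le> B"
  shows "(\<lambda>i. \<integral>x. h (f i x) \<partial>\<nu> i) \<longlonglongrightarrow> (\<Sum>k. h k * m k)"
proof (rule tendsto_approx)
  have m_nonneg: "0 \<le> m k" for k
    by (rule tendsto_lowerbound[OF lim]) auto
  have B: "0 \<le> B" using h[of 0] by auto
  have summ: "summable (\<lambda>k. h k * m k)"
  proof (rule summable_comparison_test')
    show "summable (\<lambda>k. B * m k)" using m by (intro summable_mult) (auto simp: sums_iff)
    show "norm (h k * m k) \<le> B * m k" for k
      using h[of k] m_nonneg[of k] by (auto simp: abs_mult intro!: mult_right_mono)
  qed
  fix \<epsilon> :: real assume \<epsilon>: "\<epsilon> > 0"
  \<comment> \<open>The truncation \<open>N\<close> is chosen from the limit weights alone, hence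
    independently of \<open>i\<close>.\<close>
  have "(\<lambda>N. B * (c - sum m {..<N})) \<longlonglongrightarrow> B * (c - c)"
    using m unfolding sums_def by (intro tendsto_intros)
  then have "\<forall>\<^sub>F N in sequentially. B * (c - sum m {..<N}) < \<epsilon>"
    using \<epsilon> by (intro order_tendstoD) auto
  moreover have "\<forall>\<^sub>F N in sequentially. dist (\<Sum>k<N. h k * m k) (\<Sum>k. h k * m k) < \<epsilon>"
    using summable_LIMSEQ[OF summ] \<epsilon> by (rule tendstoD)
  ultimately have "\<forall>\<^sub>F N in sequentially. B * (c - sum m {..<N}) < \<epsilon> \<and> dist (\<Sum>k<N. h k * m k) (\<Sum>k. h k * m k) < \<epsilon>"
    by eventually_elim auto
  then obtain N where N: "B * (c - sum m {..<N}) < \<epsilon>" "dist (\<Sum>k<N. h k * m k) (\<Sum>k. h k * m k) < \<epsilon>"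
    by (auto simp: eventually_sequentially)
  let ?q = "\<lambda>i k. measure (\<nu> i) {x \<in> space (\<nu> i). f i x = k}"
  have bound: "norm ((\<integral>x. h (f i x) \<partial>\<nu> i) - (\<Sum>k<N. h k * ?q i k)) \<le>
      B * (measure (\<nu> i) (space (\<nu> i)) - sum (?q i) {..<N})" for i
  proof -
    interpret finite_measure "\<nu> i" by (rule fin)
    have int: "integrable (\<nu> i) (\<lambda>x. g (f i x))" if "\<And>k. \<bar>g k\<bar> \<le> D" for g :: "nat \<Rightarrow> real" and D
      using that by (intro integrable_const_bound[of _ D]) auto
    have fin_sum: "(\<integral>x. (\<Sum>k<N. g k * indicator {x \<in> space (\<nu> i). f i x = k} x) \<partial>\<nu> i)
       = (\<Sum>k<N. g k * ?q i k)" for g :: "nat \<Rightarrow> real"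
    proof (subst Bochner_Integration.integral_sum)
      show "integrable (\<nu> i) (\<lambda>x. g k * indicator {x \<in> space (\<nu> i). f i x = k} x)" for k
        by (intro integrable_mult_right integrable_real_indicator) (auto simp: emeasure_eq_measure)
      show "(\<Sum>k<N. \<integral>x. g k * indicator {x \<in> space (\<nu> i). f i x = k} x \<partial>\<nu> i) = (\<Sum>k<N. g k * ?q i k)"
        by (intro sum.cong refl) (simp add: Int_absorb2)
    qed
    have pt: "(\<Sum>k<N. g k * indicator {x \<in> space (\<nu> i). f i x = k} x) = (if f i x < N then g (f i x) else 0)"
       if "x \<in> space (\<nu> i)" for x and g :: "nat \<Rightarrow> real"
    proof -
      have "(\<Sum>k<N. g k * indicator {x \<in> space (\<nu> i). f i x = k} x)
          = (\<Sum>k<N. if k = f i x then g k else 0)"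
        using that by (intro sum.cong) (auto simp: indicator_def)
      also have "\<dots> = (if f i x < N then g (f i x) else 0)"
        using sum.delta[of "{..<N}" "f i x" g] by (simp only: finite_lessThan lessThan_iff if_True)
      finally show ?thesis .
    qed
    have eq: "(\<Sum>k<N. g k * ?q i k) = (\<integral>x. (if f i x < N then g (f i x) else 0) \<partial>\<nu> i)"
      for g :: "nat \<Rightarrow> real"
      unfolding fin_sum[symmetric] by (intro Bochner_Integration.integral_cong refl pt)
    have i1: "integrable (\<nu> i) (\<lambda>x. if f i x < N then h (f i x) else 0)"
      by (rule int[of "\<lambda>k. if k < N then h k else 0" B]) (use h B in auto)
    have i2: "integrable (\<nu> i) (\<lambda>x. if f i x < N then 1 else 0 :: real)"
      by (rule int[of "\<lambda>k. if k < N then 1 else 0" 1]) auto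
    have "norm ((\<integral>x. h (f i x) \<partial>\<nu> i) - (\<Sum>k<N. h k * ?q i k))
        = norm (\<integral>x. h (f i x) - (if f i x < N then h (f i x) else 0) \<partial>\<nu> i)"
      by (subst eq[of h], subst Bochner_Integration.integral_diff[OF int[OF h] i1]) (rule refl)
    also have "\<dots> \<le> (\<integral>x. norm (h (f i x) - (if f i x < N then h (f i x) else 0)) \<partial>\<nu> i)"
      by (rule integral_norm_bound)
    also have "\<dots> \<le> (\<integral>x. B * (1 - (if f i x < N then 1 else 0)) \<partial>\<nu> i)"
    proof (rule integral_mono)
      show "integrable (\<nu> i) (\<lambda>x. norm (h (f i x) - (if f i x < N then h (f i x) else 0)))"
        by (intro integrable_norm Bochner_Integration.integrable_diff int[OF h] i1)
      show "integrable (\<nu> i) (\<lambda>x. B * (1 - (if f i x < N then 1 else 0)))"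
        by (intro integrable_mult_right Bochner_Integration.integrable_diff i2) simp
    qed (use h in auto)
    also have "\<dots> = B * (measure (\<nu> i) (space (\<nu> i)) - (\<Sum>k<N. 1 * ?q i k))"
      by (subst eq[of "\<lambda>_. 1"]) (simp add: i2)
    finally show ?thesis by simp
  qed
  show "\<exists>z l. z \<longlonglongrightarrow> l \<and> norm (l - (\<Sum>k. h k * m k)) \<le> \<epsilon> \<and>
           (\<forall>\<^sub>F i in sequentially. norm ((\<integral>x. h (f i x) \<partial>\<nu> i) - z i) \<le> \<epsilon>)"
  proof (intro exI conjI)
    show "(\<lambda>i. \<Sum>k<N. h k * ?q i k) \<longlonglongrightarrow> (\<Sum>k<N. h k * m k)"
      by (intro tendsto_intros lim)
    show "norm ((\<Sum>k<N. h k * m k) - (\<Sum>k. h k * m k)) \<le> \<epsilon>"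
      using N(2) by (simp add: dist_norm)
    have "(\<lambda>i. B * (measure (\<nu> i) (space (\<nu> i)) - sum (?q i) {..<N})) \<longlonglongrightarrow> B * (c - sum m {..<N})"
      by (intro tendsto_intros lim total)
    then have "\<forall>\<^sub>F i in sequentially. B * (measure (\<nu> i) (space (\<nu> i)) - sum (?q i) {..<N}) < \<epsilon>"
      using N(1) by (rule order_tendstoD)
    then show "\<forall>\<^sub>F i in sequentially. norm ((\<integral>x. h (f i x) \<partial>\<nu> i) - (\<Sum>k<N. h k * ?q i k)) \<le> \<epsilon>"
      by (rule eventually_mono) (use order_trans[OF bound less_imp_le] in blast)
  qed
qed

section \<open>Dyadic patterns and the compact sets that fit them\<close>

definition closed_cell :: "nat \<Rightarrow> int \<Rightarrow> real set" where
  "closed_cell n k = {real_of_int k / 2 ^ n .. (real_of_int k + 1) / 2 ^ n}"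

definition pattern :: "nat \<Rightarrow> real set \<Rightarrow> int set" where
  "pattern n M = (\<lambda>x. \<lfloor>2 ^ n * x\<rfloor>) ` M"

text \<open>Closed cells make this relation survive nested intersections. Adjacent cells share an
  endpoint, so one set may fit several patterns of the same level; \<open>pattern\<close> picks one
  of them by the floor function.\<close>

definition fits :: "nat \<Rightarrow> int set \<Rightarrow> real set \<Rightarrow> bool" where
  "fits n P A \<longleftrightarrow> A \<subseteq> (\<Union>k\<in>P. closed_cell n k) \<and> (\<forall>k\<in>P. A \<inter> closed_cell n k \<noteq> {})"

lemma floor_mem_closed_cell: "x \<in> closed_cell n \<lfloor>2 ^ n * x\<rfloor>"
proof -
  have "real_of_int \<lfloor>2 ^ n * x\<rfloor> \<le> 2 ^ n * x" "2 ^ n * x \<le> real_of_int \<lfloor>2 ^ n * x\<rfloor> + 1"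
    by linarith+
  then show ?thesis by (simp add: closed_cell_def field_simps)
qed

lemma fits_pattern: "fits n (pattern n M) M"
  using floor_mem_closed_cell by (auto simp: fits_def pattern_def)

lemma closed_cell_dist: "x \<in> closed_cell n k \<Longrightarrow> y \<in> closed_cell n k \<Longrightarrow> dist x y \<le> 1 / 2 ^ n"
  by (auto simp: closed_cell_def dist_real_def add_divide_distrib)

text \<open>Every point of \<open>B\<close> lies in a cell of the pattern, and that cell also
  contains a point of \<open>A\<close>, at distance at most the length of the cell.\<close>

lemma infdist_fits_le:
  assumes "fits n P A" "fits n P B" "P \<noteq> {}"
  shows "infdist x A \<le> infdist x B + 1 / 2 ^ n"
proof -
  have ne: "A \<noteq> {}" "B \<noteq> {}" using assms by (auto simp: fits_def)
  have "infdist x A - 1 / 2 ^ n \<le> dist x b" if "b \<in> B" for b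
  proof -
    obtain k where k: "k \<in> P" "b \<in> closed_cell n k"
      using \<open>b \<in> B\<close> assms(2) unfolding fits_def by blast
    then obtain a where a: "a \<in> A" "a \<in> closed_cell n k"
      using assms(1) unfolding fits_def by blast
    have "infdist x A \<le> dist x a" using a(1) by (rule infdist_le)
    also have "\<dots> \<le> dist x b + dist b a" by (rule dist_triangle)
    also have "dist b a \<le> 1 / 2 ^ n" using k a closed_cell_dist by blast
    finally show ?thesis by simp
  qed
  then have "infdist x A - 1 / 2 ^ n \<le> infdist x B"
    using ne unfolding infdist_def[of x B] by (auto intro!: cINF_greatest)
  then show ?thesis by simp
qed

lemma compacts_dist_fits:
  assumes "fits n P A" "fits n P B" "compact A" "compact B"
  shows "compacts_dist (Compacts A) (Compacts B) \<le> 1 / 2 ^ n"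
proof (cases "P = {}")
  case True
  then have "A = {}" "B = {}" using assms by (auto simp: fits_def)
  then show ?thesis by (simp add: compacts_dist_def Compacts_inverse)
next
  case False
  then have ne: "A \<noteq> {}" "B \<noteq> {}" using assms by (auto simp: fits_def)
  have "(SUP x. \<bar>infdist x A - infdist x B\<bar>) \<le> 1 / 2 ^ n"
  proof (rule cSUP_least)
    fix x show "\<bar>infdist x A - infdist x B\<bar> \<le> 1 / 2 ^ n"
      using infdist_fits_le[OF assms(1,2) False, of x] infdist_fits_le[OF assms(2,1) False, of x] by simp
  qed simp
  with ne assms(3,4) show ?thesis by (simp add: compacts_dist_def Compacts_inverse Let_def)
qed

text \<open>All sets fitting the pattern of \<open>A\<close> on level \<open>n\<close> are within
  \<open>1 / 2 ^ n\<close> of \<open>A\<close>, so a fine pattern forces membership in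
  \<open>U\<close>. This yields both measurability of the limit map and continuity of test functions
  along a branch.\<close>

lemma open_fits_nbhd:
  assumes "open U" "Compacts A \<in> U" "compact A" "\<And>n. fits n (P n) A"
  shows "\<exists>N. \<forall>n\<ge>N. \<forall>B. fits n (P n) B \<longrightarrow> compact B \<longrightarrow> Compacts B \<in> U"
proof -
  obtain e where e: "e > 0" "\<And>L. compacts_dist (Compacts A) L < e \<Longrightarrow> L \<in> U"
    using assms(1,2) unfolding open_compacts_def by blast
  obtain N where N: "1 / 2 ^ N < e"
    using real_arch_pow_inv[OF e(1), of "1/2"] by (auto simp: power_one_over)
  show ?thesis
  proof (intro exI allI impI)
    fix n B assume *: "N \<le> n" "fits n (P n) B" "compact B"
    have "compacts_dist (Compacts A) (Compacts B) \<le> 1 / 2 ^ n"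
      using assms * by (intro compacts_dist_fits) auto
    also have "\<dots> \<le> 1 / 2 ^ N"
      using *(1) by (simp add: frac_le)
    finally show "Compacts B \<in> U" using N e(2) by simp
  qed
qed

definition limit_set :: "(nat \<Rightarrow> int set) \<Rightarrow> real set" where
  "limit_set P = (\<Inter>n. \<Union>k\<in>P n. closed_cell n k)"

lemma compact_limit_set:
  assumes "\<And>n. finite (P n)"
  shows "compact (limit_set P)"
proof -
  have c: "compact (\<Union>k\<in>P n. closed_cell n k)" for n
    using assms by (intro compact_UN) (auto simp: closed_cell_def)
  show ?thesis unfolding limit_set_def
    by (rule compact_Inter) (use c in auto)
qed

lemma closed_cell_child:
  "closed_cell (Suc n) k \<subseteq> closed_cell n (k div 2)"
proof -
  have "real_of_int (2 * (k div 2)) \<le> real_of_int k" "real_of_int k + 1 \<le> real_of_int (2 * (k div 2) + 2)"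
    by linarith+
  then have "real_of_int (k div 2) * 2 \<le> real_of_int k" "real_of_int k + 1 \<le> (real_of_int (k div 2) + 1) * 2"
    by simp_all
  moreover have "x \<in> closed_cell i j \<longleftrightarrow> real_of_int j \<le> x * 2 ^ i \<and> x * 2 ^ i \<le> real_of_int j + 1" for x i j
    by (simp add: closed_cell_def pos_divide_le_eq pos_le_divide_eq)
  moreover have "x * 2 ^ Suc n = (x * 2 ^ n) * 2" for x :: real by simp
  ultimately show ?thesis by (intro subsetI) simp
qed

text \<open>The point is that every cell of every pattern meets the limit set. An index always has a
  child in the next pattern, so dependent choice gives a chain of nested closed cells starting at
  \<open>k\<close>; their common point lies in the unions of all later levels, and in those of
  earlier levels because the unions decrease.\<close>

lemma fits_limit_set:
  assumes step: "\<And>n. (\<lambda>k. k div 2) ` P (Suc n) = P n"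
  shows "fits n (P n) (limit_set P)"
  unfolding fits_def
proof (intro conjI ballI)
  show "limit_set P \<subseteq> (\<Union>k\<in>P n. closed_cell n k)" by (auto simp: limit_set_def)
next
  fix k assume k: "k \<in> P n"
  have "\<exists>f. \<forall>j. (f j \<in> P (n + j) \<and> (j = 0 \<longrightarrow> f j = k)) \<and> f j = f (Suc j) div 2"
  proof (rule dependent_nat_choice)
    show "\<exists>x. x \<in> P (n + 0) \<and> (0 = 0 \<longrightarrow> x = k)" using k by auto
    fix x j assume "x \<in> P (n + j) \<and> (j = 0 \<longrightarrow> x = k)"
    then have "x \<in> (\<lambda>k. k div 2) ` P (Suc (n + j))" using step by auto
    then show "\<exists>y. (y \<in> P (n + Suc j) \<and> (Suc j = 0 \<longrightarrow> y = k)) \<and> x = y div 2" by auto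
  qed
  then obtain f where f: "\<And>j. f j \<in> P (n + j)" "f 0 = k" "\<And>j. f j = f (Suc j) div 2" by blast
  have nested: "closed_cell (n + Suc j) (f (Suc j)) \<subseteq> closed_cell (n + j) (f j)" for j
    using closed_cell_child[of "n + j" "f (Suc j)"] f(3)[of j] by simp
  have "(\<Inter>j. closed_cell (n + j) (f j)) \<noteq> {}"
  proof (rule compact_nest)
    show "compact (closed_cell (n + j) (f j))" "closed_cell (n + j) (f j) \<noteq> {}" for j
      by (auto simp: closed_cell_def divide_le_cancel)
    show "closed_cell (n + j) (f j) \<subseteq> closed_cell (n + i) (f i)" if "i \<le> j" for i j
      using lift_Suc_antimono_le[of "\<lambda>j. closed_cell (n + j) (f j)" i j] nested that by auto
  qed
  then obtain x where x: "\<And>j. x \<in> closed_cell (n + j) (f j)" by auto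
  have "x \<in> (\<Union>k\<in>P j. closed_cell j k)" for j
  proof (cases "n \<le> j")
    case True
    then show ?thesis using x[of "j - n"] f(1)[of "j - n"] by auto
  next
    case False
    have "(\<Union>k\<in>P (Suc j). closed_cell (Suc j) k) \<subseteq> (\<Union>k\<in>P j. closed_cell j k)" for j
    proof -
      have "(\<Union>k\<in>P (Suc j). closed_cell (Suc j) k) \<subseteq> (\<Union>k\<in>P (Suc j). closed_cell j (k div 2))"
        using closed_cell_child by fast
      also have "\<dots> = (\<Union>k\<in>(\<lambda>k. k div 2) ` P (Suc j). closed_cell j k)" by simp
      finally show ?thesis unfolding step .
    qed
    then have "(\<Union>k\<in>P n. closed_cell n k) \<subseteq> (\<Union>k\<in>P j. closed_cell j k)"
      using lift_Suc_antimono_le[of "\<lambda>j. \<Union>k\<in>P j. closed_cell j k" j n] False by auto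
    moreover have "x \<in> (\<Union>k\<in>P n. closed_cell n k)" using x[of 0] f(2) k by auto
    ultimately show ?thesis by blast
  qed
  then have "x \<in> limit_set P" by (auto simp: limit_set_def)
  with x[of 0] f(2) show "limit_set P \<inter> closed_cell n k \<noteq> {}" by auto
qed

section \<open>Patterns as natural numbers, the nodes of the tree\<close>

definition int_set_code :: "int set \<Rightarrow> nat" where
  "int_set_code P = set_encode (int_encode ` P)"

definition int_set_decode :: "nat \<Rightarrow> int set" where
  "int_set_decode k = int_decode ` set_decode k"

lemma finite_int_set_decode: "finite (int_set_decode k)"
  by (simp add: int_set_decode_def)

lemma int_set_code_inverse: "finite P \<Longrightarrow> int_set_decode (int_set_code P) = P"
  by (simp add: int_set_decode_def int_set_code_def set_encode_inverse image_image)

lemma int_set_decode_inverse: "int_set_code (int_set_decode k) = k"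
  by (simp add: int_set_decode_def int_set_code_def set_decode_inverse image_image)

lemma int_set_code_eq_iff: "finite P \<Longrightarrow> int_set_code P = k \<longleftrightarrow> P = int_set_decode k"
  by (auto simp: int_set_code_inverse int_set_decode_inverse)

definition parent_code :: "nat \<Rightarrow> nat" where
  "parent_code k = int_set_code ((\<lambda>j. j div 2) ` int_set_decode k)"

lemma pattern_parent: "(\<lambda>k. k div 2) ` pattern (Suc n) M = pattern n M"
proof -
  have "\<lfloor>2 * 2 ^ n * x\<rfloor> div 2 = \<lfloor>2 ^ n * x\<rfloor>" for x :: real
    using floor_divide_real_eq_div[of 2 "2 * 2 ^ n * x"] by simp
  then show ?thesis by (auto simp: pattern_def image_image)
qed

lemma parent_code_pattern:
  "finite M \<Longrightarrow> parent_code (int_set_code (pattern (Suc n) M)) = int_set_code (pattern n M)"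
  unfolding parent_code_def
  by (subst int_set_code_inverse) (auto simp: pattern_parent, simp add: pattern_def)

text \<open>The indices of a child pattern have the form \<open>2 * a\<close> or
  \<open>2 * a + 1\<close> with \<open>a\<close> in the parent pattern. Since a node has finitely
  many children, limits of weights may be taken termwise in the sum over them.\<close>

lemma finite_parent_code_vimage: "finite {j. parent_code j = k}"
proof (rule finite_subset)
  let ?E = "(\<lambda>a. 2 * a) ` int_set_decode k \<union> (\<lambda>a. 2 * a + 1) ` int_set_decode k"
  show "finite (int_set_code ` Pow ?E)" by (simp add: finite_int_set_decode)
  show "{j. parent_code j = k} \<subseteq> int_set_code ` Pow ?E"
  proof
    fix j assume "j \<in> {j. parent_code j = k}"
    then have *: "(\<lambda>j. j div 2) ` int_set_decode j = int_set_decode k"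
      unfolding parent_code_def mem_Collect_eq
      by (subst (asm) int_set_code_eq_iff) (auto simp: finite_int_set_decode)
    have "i \<in> ?E" if "i \<in> int_set_decode j" for i
    proof -
      have "i div 2 \<in> int_set_decode k" using * that by blast
      moreover have "i = 2 * (i div 2) \<or> i = 2 * (i div 2) + 1" by presburger
      ultimately show ?thesis by blast
    qed
    then have "int_set_decode j \<in> Pow ?E" by blast
    then show "j \<in> int_set_code ` Pow ?E" by (intro image_eqI[of j int_set_code "int_set_decode j"]) (simp_all add: int_set_decode_inverse)
  qed
qed

text \<open>On level \<open>n\<close> a test function is replaced by its value at a representative
  of the pattern. The error is at most the oscillation over finite sets with that pattern, which
  again depends on the pattern only, so its integrals converge too. Along each branch the
  oscillation tends to 0, and dominated convergence makes its limit integral small for a suitable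
  \<open>n\<close>.\<close>

theorem weak_limit_of_pattern_convergence:
  fixes \<nu> :: "nat \<Rightarrow> real set measure"
  assumes fin: "\<And>i. finite_measure (\<nu> i)"
    and finM: "\<And>i M. M \<in> space (\<nu> i) \<Longrightarrow> finite M"
    and sets: "\<And>i. sets (\<nu> i) = Pow (space (\<nu> i))"
    and conv: "\<And>n S. convergent (\<lambda>i. measure (\<nu> i) {M \<in> space (\<nu> i). pattern n M \<subseteq> S})"
    and tight: "\<And>\<epsilon>. \<epsilon> > 0 \<Longrightarrow> \<exists>R::nat. \<forall>\<^sub>F i in sequentially.
        measure (\<nu> i) {M \<in> space (\<nu> i). \<not> M \<subseteq> {- real R..<real R}} \<le> \<epsilon>"
  shows "\<exists>\<mu> :: compacts measure. sets \<mu> = sets borel \<and> finite_measure \<mu> \<and>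
    (\<forall>g :: compacts \<Rightarrow> real. continuous_on UNIV g \<and> bounded (range g) \<longrightarrow>
      (\<lambda>i. \<integral>M. g (Compacts M) \<partial>\<nu> i) \<longlonglongrightarrow> (\<integral>K. g K \<partial>\<mu>))"
proof -
  define code where "code n M = int_set_code (pattern n M)" for n M
  define q where "q i Q = measure (\<nu> i) {M \<in> space (\<nu> i). Q M}" for i Q
  have any_set [simp, measurable]: "{M \<in> space (\<nu> i). Q M} \<in> sets (\<nu> i)" for i Q
    by (auto simp: sets)
  have any_fun: "f \<in> \<nu> i \<rightarrow>\<^sub>M N" if "range f \<subseteq> space N" for i and f :: "real set \<Rightarrow> 'x" and N
    using that by (auto simp: measurable_def sets)
  have fin_pattern: "finite (pattern n M)" if "M \<in> space (\<nu> i)" for n M i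
    using finM[OF that] by (simp add: pattern_def)
  have q_mono: "q i Q \<le> q i Q'" if "\<And>M. M \<in> space (\<nu> i) \<Longrightarrow> Q M \<Longrightarrow> Q' M" for i Q Q'
  proof -
    interpret finite_measure "\<nu> i" by (rule fin)
    show ?thesis unfolding q_def by (intro finite_measure_mono) (use that in auto)
  qed
  have q_split: "q i (\<lambda>M. f M \<in> A) = (\<Sum>a\<in>A. q i (\<lambda>M. f M = a))" if "finite A" for i A and f :: "real set \<Rightarrow> 'x"
  proof -
    interpret finite_measure "\<nu> i" by (rule fin)
    have "{M \<in> space (\<nu> i). f M \<in> A} = (\<Union>a\<in>A. {M \<in> space (\<nu> i). f M = a})" by auto
    then show ?thesis unfolding q_def using that
      by (simp only:) (intro finite_measure_finite_Union, auto simp: disjoint_family_on_def)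
  qed
  \<comment> \<open>Inclusion-exclusion in recursive form: the mass at \<open>P\<close> is the mass
    of patterns contained in \<open>P\<close> minus the masses at its proper subsets.\<close>
  have atom: "convergent (\<lambda>i. q i (\<lambda>M. pattern n M = P))" if "finite P" for n P
    using that
  proof (induction P rule: finite_psubset_induct)
    case (psubset P)
    have fP: "finite (Pow P - {P})" using psubset.hyps by simp
    have "q i (\<lambda>M. pattern n M = P) = q i (\<lambda>M. pattern n M \<subseteq> P) - (\<Sum>Q\<in>Pow P - {P}. q i (\<lambda>M. pattern n M = Q))" for i
    proof -
      have "q i (\<lambda>M. pattern n M \<in> Pow P) = (\<Sum>Q\<in>Pow P. q i (\<lambda>M. pattern n M = Q))"
        using psubset.hyps by (intro q_split) auto
      also have "\<dots> = q i (\<lambda>M. pattern n M = P) + (\<Sum>Q\<in>Pow P - {P}. q i (\<lambda>M. pattern n M = Q))"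
        using psubset.hyps by (intro sum.remove) auto
      finally show ?thesis by simp
    qed
    moreover have "convergent (\<lambda>i. q i (\<lambda>M. pattern n M \<subseteq> P) - (\<Sum>Q\<in>Pow P - {P}. q i (\<lambda>M. pattern n M = Q)))"
      unfolding q_def[of _ "\<lambda>M. pattern n M \<subseteq> P"]
      by (intro convergent_diff convergent_sum conv psubset.IH) auto
    ultimately show ?case by simp
  qed
  define m where "m n k = lim (\<lambda>i. q i (\<lambda>M. code n M = k))" for n k
  have code_iff: "code n M = k \<longleftrightarrow> pattern n M = int_set_decode k" if "M \<in> space (\<nu> i)" for n M k i
    unfolding code_def using fin_pattern[OF that] by (rule int_set_code_eq_iff)
  have m_lim: "(\<lambda>i. q i (\<lambda>M. code n M = k)) \<longlonglongrightarrow> m n k" for n k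
  proof -
    have "q i (\<lambda>M. code n M = k) = q i (\<lambda>M. pattern n M = int_set_decode k)" for i
      unfolding q_def by (simp add: code_iff cong: conj_cong)
    then show ?thesis unfolding m_def using atom[of "int_set_decode k" n]
      by (simp add: finite_int_set_decode convergent_LIMSEQ_iff)
  qed
  have m_nonneg: "0 \<le> m n k" for n k
    by (rule tendsto_lowerbound[OF m_lim]) (auto simp: q_def)
  \<comment> \<open>The total mass is the case of the trivial restriction \<open>S = UNIV\<close>;
    any level would do.\<close>
  obtain c where c: "(\<lambda>i. q i (\<lambda>M. True)) \<longlonglongrightarrow> c"
    using conv[of 0 UNIV] unfolding q_def convergent_def by auto
  have total: "(\<lambda>i. measure (\<nu> i) (space (\<nu> i))) \<longlonglongrightarrow> c"
    using c by (simp add: q_def)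
  \<comment> \<open>Tightness enters here. A set inside \<open>[-R, R)\<close> has on level
    \<open>n\<close> one of finitely many patterns, so the codes below some \<open>N\<close> carry
    all but \<open>r / 2\<close> of the mass for every large \<open>i\<close>, and the limit weights
    keep it.\<close>
  have m_sums: "m n sums c" for n
    unfolding sums_def
  proof (rule LIMSEQ_I)
    fix r :: real assume "0 < r"
    then obtain R where R: "\<forall>\<^sub>F i in sequentially. q i (\<lambda>M. \<not> M \<subseteq> {- real R..<real R}) \<le> r / 2"
      using tight[of "r/2"] unfolding q_def by auto
    define F where "F = Pow {- (int R * 2 ^ n)..<int R * 2 ^ n}"
    obtain N where N: "\<And>k. k \<in> int_set_code ` F \<Longrightarrow> k < N"
      using finite_nat_set_iff_bounded[of "int_set_code ` F"] by (auto simp: F_def)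
    have in_F: "pattern n M \<in> F" if M: "M \<subseteq> {- real R..<real R}" for M
    proof -
      have "\<lfloor>2 ^ n * x\<rfloor> \<in> {- (int R * 2 ^ n)..<int R * 2 ^ n}" if "x \<in> M" for x
      proof -
        have x: "- real R \<le> x" "x < real R" using that M by auto
        have "2 ^ n * (- real R) \<le> 2 ^ n * x" "2 ^ n * x < 2 ^ n * real R"
          by (rule mult_left_mono[OF x(1)], simp) (rule mult_strict_left_mono[OF x(2)], simp)
        then show ?thesis by (simp add: le_floor_iff floor_less_iff mult.commute)
      qed
      then show ?thesis unfolding F_def pattern_def by auto
    qed
    have "norm (sum (m n) {..<N'} - c) < r" if "N \<le> N'" for N'
    proof -
      have lim: "(\<lambda>i. q i (\<lambda>M. code n M < N')) \<longlonglongrightarrow> sum (m n) {..<N'}"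
        using tendsto_sum[of "{..<N'}" "\<lambda>k i. q i (\<lambda>M. code n M = k)", OF m_lim]
          q_split[of "{..<N'}" _ "code n"] by simp
      have "sum (m n) {..<N'} \<le> c"
        by (rule LIMSEQ_le[OF lim c]) (intro exI[of _ 0] allI impI q_mono TrueI)
      moreover have "c \<le> sum (m n) {..<N'} + r / 2"
      proof (rule tendsto_le[OF _ tendsto_add[OF lim tendsto_const] c])
        show "\<forall>\<^sub>F i in sequentially. q i (\<lambda>M. True) \<le> q i (\<lambda>M. code n M < N') + r / 2"
          using R
        proof eventually_elim
          case (elim i)
          interpret finite_measure "\<nu> i" by (rule fin)
          have "q i (\<lambda>M. True) \<le> q i (\<lambda>M. code n M < N' \<or> \<not> M \<subseteq> {- real R..<real R})"
          proof (rule q_mono)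
            fix M
            have "code n M < N" if "M \<subseteq> {- real R..<real R}"
              unfolding code_def using N[OF imageI[OF in_F[OF that]]] .
            then show "code n M < N' \<or> \<not> M \<subseteq> {- real R..<real R}"
              using \<open>N \<le> N'\<close> by (meson less_le_trans)
          qed
          also have "\<dots> \<le> q i (\<lambda>M. code n M < N') + q i (\<lambda>M. \<not> M \<subseteq> {- real R..<real R})"
          proof -
            have "{M \<in> space (\<nu> i). code n M < N' \<or> \<not> M \<subseteq> {- real R..<real R}} =
              {M \<in> space (\<nu> i). code n M < N'} \<union> {M \<in> space (\<nu> i). \<not> M \<subseteq> {- real R..<real R}}" by auto
            then show ?thesis unfolding q_def by (simp only:) (intro measure_Un_le any_set)
          qed
          finally show ?case using elim by simp
        qed
      qed simp
      ultimately show ?thesis using \<open>0 < r\<close> by simp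
    qed
    then show "\<exists>no. \<forall>N'\<ge>no. norm (sum (m n) {..<N'} - c) < r" by blast
  qed
  have children: "(\<lambda>j. if parent_code j = k then m (Suc n) j else 0) sums m n k" for n k
  proof -
    let ?A = "{j. parent_code j = k}"
    have "q i (\<lambda>M. code n M = k) = q i (\<lambda>M. code (Suc n) M \<in> ?A)" for i
      using finM by (intro antisym q_mono) (auto simp: code_def parent_code_pattern)
    then have "(\<lambda>i. \<Sum>j\<in>?A. q i (\<lambda>M. code (Suc n) M = j)) \<longlonglongrightarrow> m n k"
      using m_lim[of n k] q_split[OF finite_parent_code_vimage, of _ "code (Suc n)" k] by simp
    moreover have "(\<lambda>i. \<Sum>j\<in>?A. q i (\<lambda>M. code (Suc n) M = j)) \<longlonglongrightarrow> (\<Sum>j\<in>?A. m (Suc n) j)"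
      by (intro tendsto_sum m_lim)
    ultimately have "m n k = (\<Sum>j\<in>?A. m (Suc n) j)" by (rule LIMSEQ_unique)
    then show ?thesis
      using sums_If_finite_set[OF finite_parent_code_vimage, of k "m (Suc n)"] by simp
  qed
  interpret T: weight_tree m parent_code c
    by unfold_locales (use m_nonneg m_sums children in auto)
  let ?P = "\<lambda>u n. int_set_decode (T.label n u)"
  define L where "L u = limit_set (?P u)" for u
  have compact_L: "compact (L u)" for u
    unfolding L_def by (intro compact_limit_set finite_int_set_decode)
  have fits_L: "fits n (?P u n) (L u)" if "u \<in> {0..<c}" for n u
    unfolding L_def
  proof (rule fits_limit_set)
    fix n
    have "int_set_code ((\<lambda>j. j div 2) ` ?P u (Suc n)) = T.label n u"
      using T.parent_label[OF that, of n] by (simp add: parent_code_def)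
    then show "(\<lambda>j. j div 2) ` ?P u (Suc n) = ?P u n"
      by (subst (asm) int_set_code_eq_iff) (auto simp: finite_int_set_decode)
  qed
  have K_measurable [measurable]: "(\<lambda>u. Compacts (L u)) \<in> T.base \<rightarrow>\<^sub>M borel"
  proof (rule borel_measurableI)
    fix U :: "compacts set" assume U: "open U"
    \<comment> \<open>The nodes all of whose branches lead into \<open>U\<close>. By
      \<open>open_fits_nbhd\<close> each branch with limit in \<open>U\<close> passes through such a
      node, so the preimage is a countable union of intervals.\<close>
    define I where "I = {(n, k). \<forall>u\<in>{0..<c}. T.label n u = k \<longrightarrow> Compacts (L u) \<in> U}"
    have "(\<lambda>u. Compacts (L u)) -` U \<inter> space T.base = (\<Union>(n, k)\<in>I. {u \<in> space T.base. T.label n u = k})"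
    proof (intro equalityI subsetI)
      fix u assume "u \<in> (\<lambda>u. Compacts (L u)) -` U \<inter> space T.base"
      then have u: "u \<in> {0..<c}" "Compacts (L u) \<in> U" by (auto simp: space_restrict_space)
      obtain N where N: "\<And>n B. n \<ge> N \<Longrightarrow> fits n (?P u n) B \<Longrightarrow> compact B \<Longrightarrow> Compacts B \<in> U"
        using open_fits_nbhd[OF U u(2) compact_L, of "?P u"] fits_L[OF u(1)] by blast
      have "Compacts (L v) \<in> U" if "v \<in> {0..<c}" "T.label N v = T.label N u" for v
        using N[OF order_refl _ compact_L, of v] fits_L[OF that(1), of N] that(2) by simp
      then have "(N, T.label N u) \<in> I" by (simp add: I_def)
      then show "u \<in> (\<Union>(n, k)\<in>I. {u \<in> space T.base. T.label n u = k})"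
        using u by (auto simp: space_restrict_space)
    next
      fix u assume "u \<in> (\<Union>(n, k)\<in>I. {u \<in> space T.base. T.label n u = k})"
      then obtain n where "(n, T.label n u) \<in> I" "u \<in> space T.base" by blast
      then show "u \<in> (\<lambda>u. Compacts (L u)) -` U \<inter> space T.base"
        by (simp add: I_def space_restrict_space)
    qed
    also have "\<dots> \<in> sets T.base"
    proof (rule sets.countable_UN')
      have "{u \<in> space T.base. T.label n u = k} \<in> sets T.base" for n k by measurable
      then show "(\<lambda>(n, k). {u \<in> space T.base. T.label n u = k}) ` I \<subseteq> sets T.base"
        by (intro image_subsetI) (simp add: split_beta)
    qed (rule countableI_type)
    finally show "(\<lambda>u. Compacts (L u)) -` U \<inter> space T.base \<in> sets T.base" .
  qed
  define \<mu> where "\<mu> = distr T.base borel (\<lambda>u. Compacts (L u))"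
  interpret base: finite_measure T.base by (rule T.finite_measure_base)
  have main: "(\<lambda>i. \<integral>M. g (Compacts M) \<partial>\<nu> i) \<longlonglongrightarrow> (\<integral>K. g K \<partial>\<mu>)"
    if g: "continuous_on UNIV g" "bounded (range g)" for g :: "compacts \<Rightarrow> real"
  proof -
    obtain B where B: "\<And>K. \<bar>g K\<bar> \<le> B" using g(2) by (auto simp: bounded_iff)
    have g_meas [measurable]: "g \<in> borel_measurable borel"
      by (rule borel_measurable_continuous_onI[OF g(1)])
    \<comment> \<open>The left endpoints of the cells: a finite set whose pattern is exactly the
      decoded one.\<close>
    define rep where "rep n k = (\<lambda>j. real_of_int j / 2 ^ n) ` int_set_decode k" for n k
    have pattern_rep: "pattern n (rep n k) = int_set_decode k" for n k
      by (simp add: rep_def pattern_def image_image)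
    have finite_rep: "finite (rep n k)" for n k
      by (simp add: rep_def finite_int_set_decode)
    define G where "G n k = g (Compacts (rep n k))" for n k
    define Z where "Z n k = {M. finite M \<and> pattern n M = int_set_decode k}" for n k
    \<comment> \<open>The supremum runs over finite sets having the pattern. The limit set
      \<open>L u\<close> merely fits its patterns, so it is compared with such sets through
      \<open>fits\<close> in \<open>near\<close>.\<close>
    define osc where "osc n k = (SUP M\<in>Z n k. \<bar>g (Compacts M) - G n k\<bar>)" for n k
    have Z_ne: "rep n k \<in> Z n k" for n k by (simp add: Z_def finite_rep pattern_rep)
    have diff_le: "\<bar>g K - g K'\<bar> \<le> 2 * B" for K K' using B[of K] B[of K'] by linarith
    have bdd: "bdd_above ((\<lambda>M. \<bar>g (Compacts M) - G n k\<bar>) ` Z n k)" for n k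
      by (rule bdd_aboveI[of _ "2 * B"]) (auto simp: G_def diff_le)
    have osc_upper: "\<bar>g (Compacts M) - G n k\<bar> \<le> osc n k" if "M \<in> Z n k" for M n k
      unfolding osc_def by (rule cSUP_upper[OF that bdd])
    have osc_nonneg: "0 \<le> osc n k" for n k
      using osc_upper[OF Z_ne] abs_ge_zero order_trans by blast
    have osc_le: "osc n k \<le> 2 * B" for n k
      unfolding osc_def using Z_ne by (intro cSUP_least) (auto simp: G_def diff_le)
    have near: "\<exists>N. \<forall>n\<ge>N. \<forall>M\<in>Z n (T.label n u). \<bar>g (Compacts M) - g (Compacts (L u))\<bar> < e"
      if u: "u \<in> {0..<c}" and e: "e > 0" for u e
    proof -
      let ?U = "g -` ball (g (Compacts (L u))) e"
      have "open ?U" using g(1) by (intro open_vimage) auto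
      moreover have "Compacts (L u) \<in> ?U" using e by simp
      ultimately obtain N where N: "\<And>n B. n \<ge> N \<Longrightarrow> fits n (?P u n) B \<Longrightarrow> compact B \<Longrightarrow> Compacts B \<in> ?U"
        using open_fits_nbhd[of ?U "L u" "?P u"] compact_L fits_L[OF u] by blast
      have "\<bar>g (Compacts M) - g (Compacts (L u))\<bar> < e" if "N \<le> n" "M \<in> Z n (T.label n u)" for n M
        using N[OF that(1), of M] fits_pattern[of n M] that(2)
        by (auto simp: Z_def finite_imp_compact dist_real_def)
      then show ?thesis by blast
    qed
    have G_lim: "(\<lambda>n. G n (T.label n u)) \<longlonglongrightarrow> g (Compacts (L u))" if u: "u \<in> {0..<c}" for u
    proof (rule LIMSEQ_I)
      fix e :: real assume "e > 0"
      from near[OF u this] show "\<exists>N. \<forall>n\<ge>N. norm (G n (T.label n u) - g (Compacts (L u))) < e"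
        unfolding G_def real_norm_def using Z_ne by meson
    qed
    have osc_lim: "(\<lambda>n. osc n (T.label n u)) \<longlonglongrightarrow> 0" if u: "u \<in> {0..<c}" for u
    proof (rule LIMSEQ_I)
      fix e :: real assume e: "e > 0"
      then obtain N where N: "\<And>n M. n \<ge> N \<Longrightarrow> M \<in> Z n (T.label n u) \<Longrightarrow> \<bar>g (Compacts M) - g (Compacts (L u))\<bar> < e / 4"
        using near[OF u, of "e/4"] by auto
      have "norm (osc n (T.label n u) - 0) < e" if "n \<ge> N" for n
      proof -
        have "osc n (T.label n u) \<le> e / 2"
          unfolding osc_def
        proof (rule cSUP_least)
          fix M assume "M \<in> Z n (T.label n u)"
          then show "\<bar>g (Compacts M) - G n (T.label n u)\<bar> \<le> e / 2"
            using N[OF that, of M] N[OF that Z_ne] unfolding G_def by linarith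
        qed (use Z_ne in blast)
        then show ?thesis using osc_nonneg[of n "T.label n u"] e by simp
      qed
      then show "\<exists>N. \<forall>n\<ge>N. norm (osc n (T.label n u) - 0) < e" by blast
    qed
    have int_lim: "(\<lambda>n. \<integral>u. H n (T.label n u) \<partial>T.base) \<longlonglongrightarrow> (\<integral>u. h u \<partial>T.base)"
      if "\<And>u. u \<in> {0..<c} \<Longrightarrow> (\<lambda>n. H n (T.label n u)) \<longlonglongrightarrow> h u" "\<And>n k. \<bar>H n k\<bar> \<le> D"
        "h \<in> borel_measurable T.base" for H :: "nat \<Rightarrow> nat \<Rightarrow> real" and h and D
    proof (rule integral_dominated_convergence[where w = "\<lambda>_. D"])
      show "(\<lambda>u. H n (T.label n u)) \<in> borel_measurable T.base" for n by measurable
      show "AE u in T.base. (\<lambda>n. H n (T.label n u)) \<longlonglongrightarrow> h u"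
        using that(1) by (intro AE_I2) (simp add: space_restrict_space)
    qed (use that in auto)
    have disc: "(\<lambda>i. \<integral>M. H (code n M) \<partial>\<nu> i) \<longlonglongrightarrow> (\<integral>u. H (T.label n u) \<partial>T.base)"
      if H: "\<And>k. \<bar>H k\<bar> \<le> D" for H :: "nat \<Rightarrow> real" and D n
    proof -
      \<comment> \<open>The convergence lemma applied to a constant sequence of measures: it
        expresses the integral over the base interval as the series of weights.\<close>
      have "(\<lambda>i::nat. \<integral>u. H (T.label n u) \<partial>T.base) \<longlonglongrightarrow> (\<Sum>k. H k * m n k)"
        by (rule discrete_weak_convergence[where c = c])
           (use T.finite_measure_base T.measure_label T.measure_base H m_sums in auto)
      then have "(\<integral>u. H (T.label n u) \<partial>T.base) = (\<Sum>k. H k * m n k)"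
        by (simp add: LIMSEQ_const_iff)
      moreover have "(\<lambda>i. \<integral>M. H (code n M) \<partial>\<nu> i) \<longlonglongrightarrow> (\<Sum>k. H k * m n k)"
        by (rule discrete_weak_convergence[where c = c])
           (use fin total H m_sums m_lim[unfolded q_def] in \<open>auto intro!: any_fun\<close>)
      ultimately show ?thesis by simp
    qed
    have "(\<integral>K. g K \<partial>\<mu>) = (\<integral>u. g (Compacts (L u)) \<partial>T.base)"
      unfolding \<mu>_def by (rule integral_distr) measurable
    moreover have "(\<lambda>i. \<integral>M. g (Compacts M) \<partial>\<nu> i) \<longlonglongrightarrow> (\<integral>u. g (Compacts (L u)) \<partial>T.base)"
    proof (rule tendsto_approx)
      fix \<epsilon> :: real assume \<epsilon>: "\<epsilon> > 0"
      have "(\<lambda>n. \<integral>u. G n (T.label n u) \<partial>T.base) \<longlonglongrightarrow> (\<integral>u. g (Compacts (L u)) \<partial>T.base)"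
        by (rule int_lim[of G _ B]) (use G_lim B in \<open>auto simp: G_def\<close>)
      then have "\<forall>\<^sub>F n in sequentially. dist (\<integral>u. G n (T.label n u) \<partial>T.base) (\<integral>u. g (Compacts (L u)) \<partial>T.base) < \<epsilon>"
        using \<epsilon> by (rule tendstoD)
      moreover have "(\<lambda>n. \<integral>u. osc n (T.label n u) \<partial>T.base) \<longlonglongrightarrow> (\<integral>u. 0 \<partial>T.base)"
        by (rule int_lim[of osc _ "2 * B"]) (use osc_lim osc_nonneg osc_le in auto)
      then have "\<forall>\<^sub>F n in sequentially. (\<integral>u. osc n (T.label n u) \<partial>T.base) < \<epsilon>"
        using \<epsilon> by (intro order_tendstoD) auto
      ultimately have "\<forall>\<^sub>F n in sequentially. dist (\<integral>u. G n (T.label n u) \<partial>T.base) (\<integral>u. g (Compacts (L u)) \<partial>T.base) < \<epsilon>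
         \<and> (\<integral>u. osc n (T.label n u) \<partial>T.base) < \<epsilon>"
        by eventually_elim auto
      then obtain n where n: "dist (\<integral>u. G n (T.label n u) \<partial>T.base) (\<integral>u. g (Compacts (L u)) \<partial>T.base) < \<epsilon>"
         "(\<integral>u. osc n (T.label n u) \<partial>T.base) < \<epsilon>"
        by (auto simp: eventually_sequentially)
      show "\<exists>z l. z \<longlonglongrightarrow> l \<and> norm (l - (\<integral>u. g (Compacts (L u)) \<partial>T.base)) \<le> \<epsilon> \<and>
           (\<forall>\<^sub>F i in sequentially. norm ((\<integral>M. g (Compacts M) \<partial>\<nu> i) - z i) \<le> \<epsilon>)"
      proof (intro exI conjI)
        show "(\<lambda>i. \<integral>M. G n (code n M) \<partial>\<nu> i) \<longlonglongrightarrow> (\<integral>u. G n (T.label n u) \<partial>T.base)"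
          by (rule disc[of _ B]) (auto simp: G_def B)
        show "norm ((\<integral>u. G n (T.label n u) \<partial>T.base) - (\<integral>u. g (Compacts (L u)) \<partial>T.base)) \<le> \<epsilon>"
          using n(1) by (simp add: dist_norm)
        have "(\<lambda>i. \<integral>M. osc n (code n M) \<partial>\<nu> i) \<longlonglongrightarrow> (\<integral>u. osc n (T.label n u) \<partial>T.base)"
          by (rule disc[of _ "2 * B"]) (auto simp: osc_nonneg osc_le)
        then have "\<forall>\<^sub>F i in sequentially. (\<integral>M. osc n (code n M) \<partial>\<nu> i) < \<epsilon>"
          using n(2) by (rule order_tendstoD)
        then show "\<forall>\<^sub>F i in sequentially. norm ((\<integral>M. g (Compacts M) \<partial>\<nu> i) - (\<integral>M. G n (code n M) \<partial>\<nu> i)) \<le> \<epsilon>"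
        proof eventually_elim
          case (elim i)
          interpret finite_measure "\<nu> i" by (rule fin)
          have int: "integrable (\<nu> i) f" if "\<And>M. \<bar>f M\<bar> \<le> D" for f :: "real set \<Rightarrow> real" and D
            using that by (intro integrable_const_bound[of _ D] any_fun AE_I2) auto
          have i1: "integrable (\<nu> i) (\<lambda>M. g (Compacts M))" by (rule int[of _ B]) (rule B)
          have i2: "integrable (\<nu> i) (\<lambda>M. G n (code n M))" by (rule int[of _ B]) (simp add: G_def B)
          have i3: "integrable (\<nu> i) (\<lambda>M. osc n (code n M))"
            by (rule int[of _ "2 * B"]) (simp add: osc_nonneg osc_le)
          have "norm ((\<integral>M. g (Compacts M) \<partial>\<nu> i) - (\<integral>M. G n (code n M) \<partial>\<nu> i))
            = norm (\<integral>M. g (Compacts M) - G n (code n M) \<partial>\<nu> i)"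
            by (subst Bochner_Integration.integral_diff[OF i1 i2]) (rule refl)
          also have "\<dots> \<le> (\<integral>M. norm (g (Compacts M) - G n (code n M)) \<partial>\<nu> i)"
            by (rule integral_norm_bound)
          also have "\<dots> \<le> (\<integral>M. osc n (code n M) \<partial>\<nu> i)"
          proof (rule integral_mono[OF integrable_norm[OF Bochner_Integration.integrable_diff[OF i1 i2]] i3])
            fix M assume "M \<in> space (\<nu> i)"
            then have "M \<in> Z n (code n M)" using code_iff[of M i n "code n M"] finM by (auto simp: Z_def)
            then show "norm (g (Compacts M) - G n (code n M)) \<le> osc n (code n M)"
              using osc_upper by simp
          qed
          finally show ?case using elim by simp
        qed
      qed
    qed
    ultimately show ?thesis by simp
  qed
  have "finite_measure \<mu>"
    unfolding \<mu>_def by (rule base.finite_measure_distr) measurable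
  with main show ?thesis by (intro exI[of _ \<mu>]) (auto simp: \<mu>_def)
qed

section \<open>Spectral measures\<close>

text \<open>Rounding up to the grid is what makes the windows exact: a grid point is at or after the
  instant if and only if it is at or after \<open>k / 2 ^ n\<close>. So windows cut the grid along
  half-open dyadic intervals for every positive \<open>i\<close>.\<close>

definition dyadic_instant :: "nat \<Rightarrow> int \<Rightarrow> nat \<Rightarrow> real" where
  "dyadic_instant n k i = real_of_int \<lceil>real_of_int k / 2 ^ n * real i\<rceil> / real i"

lemma dyadic_instant_mono: "k \<le> l \<Longrightarrow> dyadic_instant n k i \<le> dyadic_instant n l i"
  unfolding dyadic_instant_def
  by (intro divide_right_mono of_int_le_iff[THEN iffD2] ceiling_mono mult_right_mono) simp_all

lemma coarse_instant_dyadic: "coarse_instant (dyadic_instant n k)"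
  unfolding coarse_instant_def
proof (intro conjI allI impI)
  fix i :: nat
  show "dyadic_instant n k i \<in> grid i" by (auto simp: dyadic_instant_def grid_def)
next
  let ?x = "real_of_int k / 2 ^ n"
  have "dyadic_instant n k \<longlonglongrightarrow> ?x"
  proof (rule tendsto_sandwich)
    show "\<forall>\<^sub>F i in sequentially. ?x \<le> dyadic_instant n k i"
      using eventually_ge_at_top[of 1]
    proof eventually_elim
      case (elim i)
      then show ?case unfolding dyadic_instant_def by (subst pos_le_divide_eq) (auto intro: le_of_int_ceiling)
    qed
    show "\<forall>\<^sub>F i in sequentially. dyadic_instant n k i \<le> ?x + 1 / real i"
      using eventually_ge_at_top[of 1]
    proof eventually_elim
      case (elim i)
      have "real_of_int \<lceil>?x * real i\<rceil> \<le> (?x + 1 / real i) * real i"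
        using elim of_int_ceiling_le_add_one[of "?x * real i"] by (simp add: distrib_right)
      then show ?case unfolding dyadic_instant_def using elim by (subst pos_divide_le_eq) auto
    qed
    show "(\<lambda>i. ?x + 1 / real i) \<longlonglongrightarrow> ?x"
      using tendsto_add[OF tendsto_const[of ?x] lim_1_over_n[where 'a = real]] by simp
  qed simp
  then show "convergent (dyadic_instant n k)" by (auto simp: convergent_def)
qed

lemma coarse_time_interval_dyadic:
  "k \<le> l \<Longrightarrow> coarse_time_interval (dyadic_instant n k) (dyadic_instant n l)"
  unfolding coarse_time_interval_def using coarse_instant_dyadic dyadic_instant_mono by blast

lemma window_dyadic:
  assumes "i \<ge> 1"
  shows "window (dyadic_instant n k) (dyadic_instant n l) i = grid i \<inter> {real_of_int k / 2 ^ n..<real_of_int l / 2 ^ n}"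
proof -
  have "dyadic_instant n k i \<le> x \<longleftrightarrow> real_of_int k / 2 ^ n \<le> x" if "x \<in> grid i" for x k
  proof -
    obtain m where x: "x = real_of_int m / real i" using \<open>x \<in> grid i\<close> by (auto simp: grid_def)
    have "dyadic_instant n k i \<le> x \<longleftrightarrow> \<lceil>real_of_int k / 2 ^ n * real i\<rceil> \<le> m"
      unfolding x dyadic_instant_def using assms by (simp add: divide_le_cancel)
    also have "\<dots> \<longleftrightarrow> real_of_int k / 2 ^ n * real i \<le> real_of_int m" by (rule ceiling_le_iff)
    also have "\<dots> \<longleftrightarrow> real_of_int k / 2 ^ n \<le> x" unfolding x using assms by (subst pos_le_divide_eq) auto
    finally show ?thesis .
  qed
  note le = this
  have "x < dyadic_instant n l i \<longleftrightarrow> x < real_of_int l / 2 ^ n" if "x \<in> grid i" for x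
    using le[OF that, of l] by linarith
  with le show ?thesis unfolding window_def by auto
qed

definition dyadic_cells :: "nat \<Rightarrow> int set \<Rightarrow> real set" where
  "dyadic_cells n S = {x. \<lfloor>2 ^ n * x\<rfloor> \<in> S}"

lemma pattern_subset_iff: "pattern n M \<subseteq> S \<longleftrightarrow> M \<subseteq> dyadic_cells n S"
  by (auto simp: pattern_def dyadic_cells_def)

lemma spectral_form_eq_integral:
  assumes "walsh_poly i W f" "walsh_poly i W g" "W \<in> finite_subsets i"
  shows "spectral_form i W f g = (\<integral>\<omega>. f \<omega> * cnj (g \<omega>) \<partial>dyadic_space i)"
  unfolding spectral_form_def by (rule walsh_parseval[OF assms])

section \<open>Spectral masses controlled by finite sums of squared coefficients\<close>

lemma point_measure_bounds:
  fixes w :: "'a \<Rightarrow> real"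
  assumes A: "countable A" and w: "\<And>x. 0 \<le> w x" and B: "\<And>T. finite T \<Longrightarrow> T \<subseteq> A \<Longrightarrow> sum w T \<le> B"
  shows "finite_measure (point_measure A (\<lambda>x. ennreal (w x)))"
    and "\<And>T X. finite T \<Longrightarrow> T \<subseteq> X \<Longrightarrow> X \<subseteq> A \<Longrightarrow> sum w T \<le> measure (point_measure A (\<lambda>x. ennreal (w x))) X"
    and "\<And>X b. X \<subseteq> A \<Longrightarrow> (\<And>T. finite T \<Longrightarrow> T \<subseteq> X \<Longrightarrow> sum w T \<le> b) \<Longrightarrow>
      measure (point_measure A (\<lambda>x. ennreal (w x))) X \<le> b"
proof -
  let ?P = "point_measure A (\<lambda>x. ennreal (w x))"
  have fin: "emeasure ?P T = ennreal (sum w T)" if "finite T" "T \<subseteq> A" for T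
    using that w by (subst emeasure_point_measure_finite2) (auto simp: sum_ennreal)
  have upper: "emeasure ?P X \<le> ennreal b" if X: "X \<subseteq> A" and b: "\<And>T. finite T \<Longrightarrow> T \<subseteq> X \<Longrightarrow> sum w T \<le> b" for X b
  proof -
    have cX: "countable X" using A X countable_subset by blast
    \<comment> \<open>An increasing exhaustion of \<open>X\<close> by finite sets along an
      enumeration; continuity from below transfers the bound for finite sums.\<close>
    define Y where "Y n = {x \<in> X. to_nat_on X x < n}" for n
    have finY: "finite (Y n)" for n
    proof (rule finite_imageD)
      show "finite (to_nat_on X ` Y n)" by (rule finite_subset[of _ "{..<n}"]) (auto simp: Y_def)
      show "inj_on (to_nat_on X) (Y n)" by (rule inj_on_subset[OF inj_on_to_nat_on[OF cX]]) (auto simp: Y_def)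
    qed
    have "X = (\<Union>n. Y n)" by (auto simp: Y_def)
    moreover have "(SUP n. emeasure ?P (Y n)) = emeasure ?P (\<Union>n. Y n)"
      using X by (intro SUP_emeasure_incseq) (auto simp: Y_def sets_point_measure incseq_def)
    moreover have "(SUP n. emeasure ?P (Y n)) \<le> ennreal b"
    proof (rule SUP_least)
      fix n
      have "Y n \<subseteq> X" by (auto simp: Y_def)
      then show "emeasure ?P (Y n) \<le> ennreal b"
        using fin[OF finY, of n] b[OF finY, of n] X by (simp add: ennreal_leI)
    qed
    ultimately show ?thesis by simp
  qed
  have "emeasure ?P (space ?P) \<le> ennreal B"
    unfolding space_point_measure by (rule upper) (use B in auto)
  then show F: "finite_measure ?P" by (intro finite_measureI) (auto simp: top_unique)
  show "sum w T \<le> measure ?P X" if "finite T" "T \<subseteq> X" "X \<subseteq> A" for T X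
  proof -
    interpret finite_measure ?P by (rule F)
    have "measure ?P T = sum w T"
      using fin[of T] that w by (simp add: measure_def sum_nonneg)
    then show ?thesis using finite_measure_mono[of T X] that by (simp add: sets_point_measure)
  qed
  show "measure ?P X \<le> b" if "X \<subseteq> A" "\<And>T. finite T \<Longrightarrow> T \<subseteq> X \<Longrightarrow> sum w T \<le> b" for X b
  proof -
    have "0 \<le> b" using that(2)[of "{}"] by simp
    then show ?thesis using upper[OF that] unfolding measure_def by (simp add: enn2real_leI)
  qed
qed

lemma countable_finite_subsets: "countable (finite_subsets i)"
  unfolding finite_subsets_def by (rule countable_Collect_finite_subset) (simp add: grid_def)

context
  fixes i :: nat and f :: "(real \<Rightarrow> real) \<Rightarrow> complex"
  assumes f: "square_integrable (dyadic_space i) f"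
begin

lemma spectral_measure_finite: "finite_measure (spectral_measure i f)"
  unfolding spectral_measure_def
  by (rule point_measure_bounds(1)[OF countable_finite_subsets _ bessel[OF f]]) simp_all

text \<open>Square roots of masses are compared with Euclidean norms of coefficient families, so
  that perturbations can be handled by Minkowski's inequality.\<close>

lemma spectral_measure_lower:
  assumes "finite T" "T \<subseteq> X" "X \<subseteq> finite_subsets i"
  shows "L2_set (\<lambda>M. cmod (walsh_coeff i f M)) T \<le> sqrt (measure (spectral_measure i f) X)"
  unfolding spectral_measure_def L2_set_def
  by (intro real_sqrt_le_mono point_measure_bounds(2)[OF countable_finite_subsets _ bessel[OF f]] assms) simp_all

lemma spectral_measure_upper:
  assumes "X \<subseteq> finite_subsets i" "\<And>T. finite T \<Longrightarrow> T \<subseteq> X \<Longrightarrow> L2_set (\<lambda>M. cmod (walsh_coeff i f M)) T \<le> b"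
  shows "sqrt (measure (spectral_measure i f) X) \<le> b"
proof -
  have b: "0 \<le> b" using assms(2)[of "{}"] by simp
  have "measure (spectral_measure i f) X \<le> b\<^sup>2"
    unfolding spectral_measure_def
  proof (rule point_measure_bounds(3)[OF countable_finite_subsets _ bessel[OF f] assms(1)])
    fix T assume "finite T" "T \<subseteq> X"
    from assms(2)[OF this] have "(L2_set (\<lambda>M. cmod (walsh_coeff i f M)) T)\<^sup>2 \<le> b\<^sup>2"
      by (intro power_mono L2_set_nonneg)
    then show "(\<Sum>M\<in>T. (cmod (walsh_coeff i f M))\<^sup>2) \<le> b\<^sup>2"
      by (simp add: L2_set_def sum_nonneg)
  qed simp_all
  with b show ?thesis by (simp add: real_le_lsqrt)
qed

end

text \<open>Minkowski's inequality for the coefficients, followed by Bessel's inequality for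
  \<open>f - g\<close>.\<close>

lemma L2_coeff_le:
  assumes f: "square_integrable (dyadic_space i) f" and g: "square_integrable (dyadic_space i) g"
    and T: "finite T" "T \<subseteq> finite_subsets i"
  shows "L2_set (\<lambda>M. cmod (walsh_coeff i f M)) T \<le> L2_set (\<lambda>M. cmod (walsh_coeff i g M)) T
    + l2_norm (dyadic_space i) (\<lambda>\<omega>. f \<omega> - g \<omega>)"
proof -
  have d: "square_integrable (dyadic_space i) (\<lambda>\<omega>. f \<omega> - g \<omega>)"
    using square_integrable_lin(1)[OF f g, of 1 "-1"] by simp
  have "L2_set (\<lambda>M. cmod (walsh_coeff i f M)) T \<le>
    L2_set (\<lambda>M. cmod (walsh_coeff i g M) + cmod (walsh_coeff i (\<lambda>\<omega>. f \<omega> - g \<omega>) M)) T"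
  proof (rule L2_set_mono)
    fix M assume "M \<in> T"
    then have "walsh_coeff i (\<lambda>\<omega>. f \<omega> - g \<omega>) M = walsh_coeff i f M - walsh_coeff i g M"
      using T(2) by (intro walsh_coeff_diff square_integrable_integrable f g) auto
    then show "cmod (walsh_coeff i f M) \<le> cmod (walsh_coeff i g M) + cmod (walsh_coeff i (\<lambda>\<omega>. f \<omega> - g \<omega>) M)"
      using norm_triangle_sub[of "walsh_coeff i f M" "walsh_coeff i g M"] by simp
  qed simp
  also have "\<dots> \<le> L2_set (\<lambda>M. cmod (walsh_coeff i g M)) T + L2_set (\<lambda>M. cmod (walsh_coeff i (\<lambda>\<omega>. f \<omega> - g \<omega>) M)) T"
    by (rule L2_set_triangle_ineq)
  also have "\<dots> \<le> L2_set (\<lambda>M. cmod (walsh_coeff i g M)) T + l2_norm (dyadic_space i) (\<lambda>\<omega>. f \<omega> - g \<omega>)"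
    by (intro add_left_mono bessel_l2 d T)
  finally show ?thesis .
qed

lemma l2_norm_minus_commute: "l2_norm M (\<lambda>\<omega>. f \<omega> - g \<omega>) = l2_norm M (\<lambda>\<omega>. g \<omega> - f \<omega>)"
  by (simp add: l2_norm_def norm_minus_commute)

text \<open>The root of the mass of \<open>{M. M \<subseteq> E}\<close> is 1-Lipschitz in the
  function. For \<open>g\<close>, only subsets of \<open>W\<close> carry coefficients, so its mass
  reduces to the finite sum over subsets of \<open>W \<inter> E\<close>.\<close>

lemma spectral_measure_approx:
  assumes f: "square_integrable (dyadic_space i) f" and g: "walsh_poly i W g" and W: "W \<in> finite_subsets i"
  shows "\<bar>sqrt (measure (spectral_measure i f) {M \<in> finite_subsets i. M \<subseteq> E})
      - sqrt (cmod (spectral_form i (W \<inter> E) g g))\<bar> \<le> l2_norm (dyadic_space i) (\<lambda>\<omega>. f \<omega> - g \<omega>)"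
proof -
  let ?X = "{M \<in> finite_subsets i. M \<subseteq> E}" and ?P = "Pow (W \<inter> E)"
  let ?d = "l2_norm (dyadic_space i) (\<lambda>\<omega>. f \<omega> - g \<omega>)"
  note g2 = walsh_poly_square_integrable[OF g W]
  have WE: "W \<inter> E \<in> finite_subsets i" by (rule finite_subsets_mono[OF W]) blast
  have P: "finite ?P" "?P \<subseteq> ?X" "?X \<subseteq> finite_subsets i"
    using finite_Pow_subsets[OF WE] finite_subsets_mono[OF WE] by auto
  have "spectral_form i (W \<inter> E) g g = complex_of_real (\<Sum>M\<in>?P. (cmod (walsh_coeff i g M))\<^sup>2)"
    unfolding spectral_form_def complex_norm_square[symmetric] of_real_sum ..
  then have "cmod (spectral_form i (W \<inter> E) g g) = (\<Sum>M\<in>?P. (cmod (walsh_coeff i g M))\<^sup>2)"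
    by (simp only: norm_of_real abs_of_nonneg[OF sum_nonneg] zero_le_power2)
  then have z: "sqrt (cmod (spectral_form i (W \<inter> E) g g)) = L2_set (\<lambda>M. cmod (walsh_coeff i g M)) ?P"
    by (simp add: L2_set_def)
  have "L2_set (\<lambda>M. cmod (walsh_coeff i g M)) ?P \<le> L2_set (\<lambda>M. cmod (walsh_coeff i f M)) ?P + ?d"
    using L2_coeff_le[OF g2 f P(1)] P l2_norm_minus_commute[of "dyadic_space i" f g] by auto
  also have "L2_set (\<lambda>M. cmod (walsh_coeff i f M)) ?P \<le> sqrt (measure (spectral_measure i f) ?X)"
    by (rule spectral_measure_lower[OF f P])
  finally have 1: "L2_set (\<lambda>M. cmod (walsh_coeff i g M)) ?P \<le> sqrt (measure (spectral_measure i f) ?X) + ?d" by simp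
  have 2: "sqrt (measure (spectral_measure i f) ?X) \<le> L2_set (\<lambda>M. cmod (walsh_coeff i g M)) ?P + ?d"
  proof (rule spectral_measure_upper[OF f P(3)])
    fix T assume T: "finite T" "T \<subseteq> ?X"
    have "L2_set (\<lambda>M. cmod (walsh_coeff i f M)) T \<le> L2_set (\<lambda>M. cmod (walsh_coeff i g M)) T + ?d"
      using T by (intro L2_coeff_le f g2) auto
    also have "L2_set (\<lambda>M. cmod (walsh_coeff i g M)) T \<le> L2_set (\<lambda>M. cmod (walsh_coeff i g M)) ?P"
      unfolding L2_set_def
    proof (rule real_sqrt_le_mono)
      have "(\<Sum>M\<in>T. (cmod (walsh_coeff i g M))\<^sup>2) = (\<Sum>M\<in>T \<inter> ?P. (cmod (walsh_coeff i g M))\<^sup>2)"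
        using T walsh_poly_coeff_0[OF g W] by (intro sum.mono_neutral_right) auto
      also have "\<dots> \<le> (\<Sum>M\<in>?P. (cmod (walsh_coeff i g M))\<^sup>2)"
        by (intro sum_mono2 P(1)) auto
      finally show "(\<Sum>M\<in>T. (cmod (walsh_coeff i g M))\<^sup>2) \<le> (\<Sum>M\<in>?P. (cmod (walsh_coeff i g M))\<^sup>2)" .
    qed
    finally show "L2_set (\<lambda>M. cmod (walsh_coeff i f M)) T \<le> L2_set (\<lambda>M. cmod (walsh_coeff i g M)) ?P + ?d" by simp
  qed
  show ?thesis unfolding z using 1 2 by linarith
qed

text \<open>At sets not contained in \<open>E\<close> the function \<open>g\<close> has zero
  coefficients, so those of \<open>f\<close> there are coefficients of \<open>f - g\<close>.\<close>

lemma spectral_measure_tail: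
  assumes f: "square_integrable (dyadic_space i) f" and g: "walsh_poly i W g" and W: "W \<in> finite_subsets i"
    and E: "W \<subseteq> E"
  shows "measure (spectral_measure i f) {M \<in> finite_subsets i. \<not> M \<subseteq> E} \<le> (l2_norm (dyadic_space i) (\<lambda>\<omega>. f \<omega> - g \<omega>))\<^sup>2"
proof -
  let ?X = "{M \<in> finite_subsets i. \<not> M \<subseteq> E}"
  have "sqrt (measure (spectral_measure i f) ?X) \<le> l2_norm (dyadic_space i) (\<lambda>\<omega>. f \<omega> - g \<omega>)"
  proof (rule spectral_measure_upper[OF f])
    fix T assume T: "finite T" "T \<subseteq> ?X"
    have "L2_set (\<lambda>M. cmod (walsh_coeff i g M)) T = 0"
      using T(2) walsh_poly_coeff_0[OF g W] E by (subst L2_set_eq_0_iff[OF T(1)]) auto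
    moreover have "L2_set (\<lambda>M. cmod (walsh_coeff i f M)) T \<le> L2_set (\<lambda>M. cmod (walsh_coeff i g M)) T
        + l2_norm (dyadic_space i) (\<lambda>\<omega>. f \<omega> - g \<omega>)"
      using T by (intro L2_coeff_le f walsh_poly_square_integrable[OF g W]) auto
    ultimately show "L2_set (\<lambda>M. cmod (walsh_coeff i f M)) T \<le> l2_norm (dyadic_space i) (\<lambda>\<omega>. f \<omega> - g \<omega>)" by simp
  qed auto
  then have "(sqrt (measure (spectral_measure i f) ?X))\<^sup>2 \<le> (l2_norm (dyadic_space i) (\<lambda>\<omega>. f \<omega> - g \<omega>))\<^sup>2"
    by (intro power_mono) auto
  then show ?thesis by simp
qed

section \<open>Convergence on unions of dyadic cells and density of bounded windows\<close>

context dyadic_factorization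
begin

lemma preimage_field_poly:
  assumes "A \<in> preimage_field s t" "i \<ge> 1"
  shows "walsh_poly i (window s t i) (ind A i)"
  using assms(1) walsh_poly_window_preimage[OF assms(2)] unfolding preimage_field_def by blast

lemma ind_span_poly:
  assumes "f \<in> ind_span (preimage_field s t)" "i \<ge> 1"
  shows "walsh_poly i (window s t i) (f i)"
  using assms(1)
proof induction
  case (ind A)
  then show ?case by (rule preimage_field_poly[OF _ assms(2)])
next
  case (lin f g a b)
  show ?case by (rule walsh_poly_lin[OF lin.IH])
qed

lemma form_convergent_inside:
  assumes "\<And>i. i \<ge> 1 \<Longrightarrow> window s t i \<subseteq> E"
  shows "form_convergent E s t"
  unfolding form_convergent_def
proof (intro ballI)
  fix A B assume A: "A \<in> preimage_field s t" and B: "B \<in> preimage_field s t"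
  have AB: "A \<inter> B \<in> \<A>"
    using coarse_algebraD(3)[OF preimage_field_algebra A B] preimage_field_subset by blast
  have "\<forall>\<^sub>F i in sequentially. spectral_form i (window s t i \<inter> E) (ind A i) (ind B i) =
      complex_of_real (measure (dyadic_space i) ((A \<inter> B) `` {i}))"
    using eventually_ge_at_top[of 1]
  proof eventually_elim
    case (elim i)
    have eq: "window s t i \<inter> E = window s t i" using assms[OF elim] by blast
    have "spectral_form i (window s t i \<inter> E) (ind A i) (ind B i) = (\<integral>\<omega>. ind A i \<omega> * cnj (ind B i \<omega>) \<partial>dyadic_space i)"
      unfolding eq by (intro spectral_form_eq_integral preimage_field_poly A B elim window_finite_subsets)
    also have "\<dots> = (\<integral>\<omega>. ind (A \<inter> B) i \<omega> \<partial>dyadic_space i)"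
      by (intro Bochner_Integration.integral_cong refl) (simp add: indicator_def)
    also have "\<dots> = complex_of_real (measure (dyadic_space i) ((A \<inter> B) `` {i}))"
      by (rule ind_integral[OF sets_\<A>[OF AB] elim])
    finally show ?case .
  qed
  then show "convergent (\<lambda>i. spectral_form i (window s t i \<inter> E) (ind A i) (ind B i))"
    by (subst convergent_cong) (auto intro!: convergent_of_real convergent_\<A>[OF AB])
qed

lemma form_convergent_outside:
  assumes "\<And>i. i \<ge> 1 \<Longrightarrow> window s t i \<inter> E = {}"
  shows "form_convergent E s t"
  unfolding form_convergent_def
proof (intro ballI)
  fix A B assume "A \<in> preimage_field s t" "B \<in> preimage_field s t"
  then have AB: "A \<in> \<A>" "B \<in> \<A>" using preimage_field_subset by auto
  have "\<forall>\<^sub>F i in sequentially. spectral_form i (window s t i \<inter> E) (ind A i) (ind B i) =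
      complex_of_real (measure (dyadic_space i) (A `` {i})) * complex_of_real (measure (dyadic_space i) (B `` {i}))"
    using eventually_ge_at_top[of 1]
  proof eventually_elim
    case (elim i)
    show ?case
      unfolding assms[OF elim] spectral_form_def using ind_coeff_empty[OF sets_\<A>[OF AB(1)] elim] ind_coeff_empty[OF sets_\<A>[OF AB(2)] elim] by simp
  qed
  then show "convergent (\<lambda>i. spectral_form i (window s t i \<inter> E) (ind A i) (ind B i))"
    by (subst convergent_cong) (auto intro!: convergent_mult convergent_of_real convergent_\<A> AB)
qed

text \<open>One cell is appended on the right at a time. On the grid, the window of a single cell
  lies either entirely inside or entirely outside \<open>dyadic_cells n S\<close>.\<close>

lemma form_convergent_dyadic_cells:
  "form_convergent (dyadic_cells n S) (dyadic_instant n k) (dyadic_instant n (k + int l))"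
proof (induction l)
  case 0
  show ?case by (rule form_convergent_outside) (simp add: window_def)
next
  case (Suc l)
  have "form_convergent (dyadic_cells n S) (dyadic_instant n j) (dyadic_instant n (j + 1))" for j
  proof -
    have cell: "\<lfloor>2 ^ n * x\<rfloor> = j" if "x \<in> window (dyadic_instant n j) (dyadic_instant n (j + 1)) i" "i \<ge> 1" for x i
    proof -
      have "real_of_int j / 2 ^ n \<le> x" "x < (real_of_int j + 1) / 2 ^ n"
        using that by (auto simp: window_dyadic)
      then show ?thesis by (intro floor_unique) (simp_all add: field_simps)
    qed
    show ?thesis
    proof (cases "j \<in> S")
      case True
      then show ?thesis by (intro form_convergent_inside subsetI) (auto simp: dyadic_cells_def cell)
    next
      case False
      then show ?thesis by (intro form_convergent_outside) (auto simp: dyadic_cells_def cell)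
    qed
  qed
  from form_convergent_trans[OF coarse_time_interval_dyadic coarse_time_interval_dyadic Suc.IH this[of "k + int l"]]
  show ?case by (simp add: add_ac)
qed

lemma preimage_field_mono:
  assumes "\<And>i. i \<ge> 1 \<Longrightarrow> window s t i \<subseteq> window s' t' i"
  shows "preimage_field s t \<subseteq> preimage_field s' t'"
proof
  fix A assume A: "A \<in> preimage_field s t"
  then obtain A' where A': "A = window_preimage s t A'" "A' \<in> window_field \<A> s t"
    by (auto simp: preimage_field_def)
  define B where "B = {(i, \<rho>) \<in> coarse_union (window_space s' t'). (i, restrict \<rho> (window s t i)) \<in> A'}"
  have "(i, restrict \<omega> (window s' t' i)) \<in> B \<longleftrightarrow> (i, restrict \<omega> (window s t i)) \<in> A'"
    if "(i, \<omega>) \<in> coarse_union dyadic_space" for i \<omega>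
  proof -
    have i: "i \<ge> 1" and \<omega>: "\<omega> \<in> space (dyadic_space i)" using that by (auto simp: coarse_union_def)
    have "restrict (restrict \<omega> (window s' t' i)) (window s t i) = restrict \<omega> (window s t i)"
      using assms[OF i] by (simp add: Int_absorb1)
    moreover have "(i, restrict \<omega> (window s' t' i)) \<in> coarse_union (window_space s' t')"
      using i restrict_window_space[OF \<omega>] by (simp add: coarse_union_def)
    ultimately show ?thesis by (simp add: B_def)
  qed
  then have "A = window_preimage s' t' B" unfolding A'(1) window_preimage_def by blast
  moreover have "B \<subseteq> coarse_union (window_space s' t')" by (auto simp: B_def)
  ultimately have "B \<in> window_field \<A> s' t'"
    using A preimage_field_subset by (auto simp: window_field_def)
  then show "A \<in> preimage_field s' t'" unfolding preimage_field_def using \<open>A = window_preimage s' t' B\<close> by blast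
qed

text \<open>The window is \<open>[-R, R)\<close>, with endpoints written as multiples of
  \<open>1 / 2 ^ n\<close> so that it is composed of whole cells of level \<open>n\<close>.\<close>

definition bounded_field :: "nat \<Rightarrow> nat \<Rightarrow> (nat \<times> (real \<Rightarrow> real)) set set" where
  "bounded_field n R = preimage_field (dyadic_instant n (- (int R * 2 ^ n))) (dyadic_instant n (int R * 2 ^ n))"

abbreviation bounded_window :: "nat \<Rightarrow> nat \<Rightarrow> nat \<Rightarrow> real set" where
  "bounded_window n R \<equiv> window (dyadic_instant n (- (int R * 2 ^ n))) (dyadic_instant n (int R * 2 ^ n))"

lemma bounded_window_eq: "i \<ge> 1 \<Longrightarrow> bounded_window n R i = grid i \<inter> {- real R..<real R}"
  by (simp add: window_dyadic)

lemma bounded_field_mono: "R \<le> R' \<Longrightarrow> bounded_field n R \<subseteq> bounded_field n R'"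
  unfolding bounded_field_def by (rule preimage_field_mono) (auto simp: bounded_window_eq)

text \<open>Convergent instants are bounded, so the field of any coarse time interval is part of
  some bounded field. The bounded fields increase with \<open>R\<close>, hence their union is an
  algebra; its limits form a closed collection and contain the hull.\<close>

lemma dense_bounded_fields: "\<A> \<subseteq> approximable dyadic_space (\<Union>R. bounded_field n R)"
proof -
  let ?G = "\<Union>R. bounded_field n R"
  have common: "\<exists>R. A \<in> bounded_field n R \<and> B \<in> bounded_field n R" if "A \<in> ?G" "B \<in> ?G" for A B
  proof -
    obtain R R' where "A \<in> bounded_field n R" "B \<in> bounded_field n R'"
      using \<open>A \<in> ?G\<close> \<open>B \<in> ?G\<close> by blast
    then show ?thesis using bounded_field_mono[of R "max R R'" n] bounded_field_mono[of R' "max R R'" n] by auto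
  qed
  have alg_R: "coarse_algebra dyadic_space (bounded_field n R)" for R
    unfolding bounded_field_def by (rule preimage_field_algebra)
  note D = coarse_algebraD[OF alg_R]
  have alg: "coarse_algebra dyadic_space ?G"
    unfolding coarse_algebra_def
  proof (intro conjI ballI)
    show "coarse_set dyadic_space A" if "A \<in> ?G" for A using that D(1) by blast
    show "{} \<in> ?G" using D(2) by blast
    fix A B assume "A \<in> ?G" "B \<in> ?G"
    then obtain R where "A \<in> bounded_field n R" "B \<in> bounded_field n R" using common by blast
    from D(3)[OF this] D(4)[OF this] D(5)[OF this(1)]
    show "A \<inter> B \<in> ?G" "A \<union> B \<in> ?G" "coarse_union dyadic_space - A \<in> ?G" by blast+
  qed
  have gen: "A \<in> ?G" if st: "coarse_time_interval s t" and A: "A \<in> preimage_field s t" for s t A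
  proof -
    have "Bseq s" "Bseq t"
      using st by (auto simp: coarse_time_interval_def coarse_instant_def intro: convergent_imp_Bseq)
    then obtain K L where K: "\<And>i. norm (s i) \<le> K" and L: "\<And>i. norm (t i) \<le> L"
      by (auto simp: Bseq_def)
    obtain R :: nat where R: "max K L \<le> real R" using real_arch_simple by blast
    have "preimage_field s t \<subseteq> bounded_field n R"
      unfolding bounded_field_def
    proof (rule preimage_field_mono)
      fix i :: nat assume i: "1 \<le> i"
      have "- real R \<le> s i" "t i \<le> real R" using K[of i] L[of i] R by auto
      then show "window s t i \<subseteq> bounded_window n R i"
        unfolding bounded_window_eq[OF i] by (auto simp: window_def)
    qed
    with A show ?thesis by blast
  qed
  have hull: "coarse_closed dyadic_space hull
       {window_preimage s t A |s t A. coarse_time_interval s t \<and> A \<in> window_field \<A> s t} = \<A>"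
    using factorization[unfolded dyadic_coarse_factorization_def, THEN conjunct2, THEN conjunct2] .
  have "{window_preimage s t A |s t A. coarse_time_interval s t \<and> A \<in> window_field \<A> s t}
      \<subseteq> approximable dyadic_space ?G"
  proof
    fix X assume "X \<in> {window_preimage s t A |s t A. coarse_time_interval s t \<and> A \<in> window_field \<A> s t}"
    then obtain s t where "coarse_time_interval s t" "X \<in> preimage_field s t"
      unfolding preimage_field_def by blast
    from gen[OF this] have "X \<in> ?G" .
    then show "X \<in> approximable dyadic_space ?G"
      by (rule dyadic.approximable_base[OF coarse_algebraD(1)[OF alg]]) (rule \<open>X \<in> ?G\<close>)
  qed
  from hull_minimal[where S = "coarse_closed dyadic_space", OF this dyadic.approximable_closed[OF alg]]
  show ?thesis unfolding hull .
qed

lemma ind_span_approx: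
  assumes "f \<in> ind_span \<A>" "\<epsilon> > 0"
  shows "\<exists>R. \<exists>g\<in>ind_span (bounded_field n R). \<forall>\<^sub>F i in sequentially.
    (\<integral>\<omega>. (cmod (f i \<omega> - g i \<omega>))\<^sup>2 \<partial>dyadic_space i) < \<epsilon>"
  using assms
proof (induction arbitrary: \<epsilon>)
  case (ind A)
  have "A \<in> approximable dyadic_space (\<Union>R. bounded_field n R)"
    using ind.hyps dense_bounded_fields by blast
  then obtain G where "G \<in> (\<Union>R. bounded_field n R)" and G: "\<forall>\<^sub>F i in sequentially. coarse_dist dyadic_space i A G < \<epsilon>"
    using ind.prems by (rule dyadic.approximableE)
  then obtain R where R: "G \<in> bounded_field n R" by blast
  then have G_set: "coarse_set dyadic_space G"
    unfolding bounded_field_def by (rule coarse_algebraD(1)[OF preimage_field_algebra])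
  have "\<forall>\<^sub>F i in sequentially. (\<integral>\<omega>. (cmod (ind A i \<omega> - ind G i \<omega>))\<^sup>2 \<partial>dyadic_space i) < \<epsilon>"
    using G eventually_ge_at_top[of 1]
  proof eventually_elim
    case (elim i)
    then show ?case using ind_diff_l2[OF sets_\<A>[OF ind.hyps] G_set elim(2)] by (simp only:)
  qed
  then show ?case by (intro exI[of _ R] bexI[of _ "ind G"] ind_span.ind[OF R])
next
  case (lin f g a b)
  \<comment> \<open>The coefficients of the squared errors come from
    \<open>square_integrable_lin\<close>; the summand 1 keeps \<open>K\<close> positive and the
    final inequality strict.\<close>
  define K where "K = 1 + 2 * (cmod a)\<^sup>2 + 2 * (cmod b)\<^sup>2"
  have K: "K > 0" unfolding K_def by (simp add: add_pos_nonneg)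
  define \<delta> where "\<delta> = \<epsilon> / K"
  have \<delta>: "\<delta> > 0" using K lin.prems by (simp add: \<delta>_def)
  obtain R f' where f': "f' \<in> ind_span (bounded_field n R)"
    "\<forall>\<^sub>F i in sequentially. (\<integral>\<omega>. (cmod (f i \<omega> - f' i \<omega>))\<^sup>2 \<partial>dyadic_space i) < \<delta>"
    using lin.IH(1)[OF \<delta>] by blast
  obtain R' g' where g': "g' \<in> ind_span (bounded_field n R')"
    "\<forall>\<^sub>F i in sequentially. (\<integral>\<omega>. (cmod (g i \<omega> - g' i \<omega>))\<^sup>2 \<partial>dyadic_space i) < \<delta>"
    using lin.IH(2)[OF \<delta>] by blast
  let ?R = "max R R'"
  have span: "f' \<in> ind_span (bounded_field n ?R)" "g' \<in> ind_span (bounded_field n ?R)"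
    by (rule ind_span_mono[OF f'(1) bounded_field_mono[OF max.cobounded1]]
        ind_span_mono[OF g'(1) bounded_field_mono[OF max.cobounded2]])+
  have sets: "coarse_set dyadic_space A" if "A \<in> bounded_field n ?R" for A
    using that unfolding bounded_field_def by (rule coarse_algebraD(1)[OF preimage_field_algebra])
  have "\<forall>\<^sub>F i in sequentially. (\<integral>\<omega>. (cmod ((a * f i \<omega> + b * g i \<omega>) - (a * f' i \<omega> + b * g' i \<omega>)))\<^sup>2 \<partial>dyadic_space i) < \<epsilon>"
    using f'(2) g'(2) eventually_ge_at_top[of 1]
  proof eventually_elim
    case (elim i)
    have sf: "square_integrable (dyadic_space i) (\<lambda>\<omega>. f i \<omega> - f' i \<omega>)"
      using square_integrable_lin(1)[OF ind_span_square_integrable[OF lin.hyps(1) sets_\<A> elim(3)]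
        ind_span_square_integrable[OF span(1) sets elim(3)], of 1 "-1"] by simp
    have sg: "square_integrable (dyadic_space i) (\<lambda>\<omega>. g i \<omega> - g' i \<omega>)"
      using square_integrable_lin(1)[OF ind_span_square_integrable[OF lin.hyps(2) sets_\<A> elim(3)]
        ind_span_square_integrable[OF span(2) sets elim(3)], of 1 "-1"] by simp
    have "(\<integral>\<omega>. (cmod ((a * f i \<omega> + b * g i \<omega>) - (a * f' i \<omega> + b * g' i \<omega>)))\<^sup>2 \<partial>dyadic_space i)
      = (\<integral>\<omega>. (cmod (a * (f i \<omega> - f' i \<omega>) + b * (g i \<omega> - g' i \<omega>)))\<^sup>2 \<partial>dyadic_space i)"
      by (simp add: algebra_simps)
    also have "\<dots> \<le> 2 * (cmod a)\<^sup>2 * (\<integral>\<omega>. (cmod (f i \<omega> - f' i \<omega>))\<^sup>2 \<partial>dyadic_space i)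
      + 2 * (cmod b)\<^sup>2 * (\<integral>\<omega>. (cmod (g i \<omega> - g' i \<omega>))\<^sup>2 \<partial>dyadic_space i)"
      by (rule square_integrable_lin(2)[OF sf sg])
    also have "\<dots> \<le> 2 * (cmod a)\<^sup>2 * \<delta> + 2 * (cmod b)\<^sup>2 * \<delta>"
      using elim(1,2) by (intro add_mono mult_left_mono) auto
    also have "\<dots> < K * \<delta>" using \<delta> by (simp add: K_def algebra_simps)
    also have "\<dots> = \<epsilon>" using K by (simp add: \<delta>_def)
    finally show ?case .
  qed
  then show ?case
    by (intro exI[of _ ?R] bexI[of _ "\<lambda>i \<omega>. a * f' i \<omega> + b * g' i \<omega>"] ind_span.lin[OF span])
qed

lemma indicator_span_subset: "indicator_span \<A> \<subseteq> ind_span \<A>"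
proof
  fix f assume "f \<in> indicator_span \<A>"
  then obtain S c where S: "finite S" "S \<subseteq> \<A>" and f: "f = (\<lambda>i \<omega>. \<Sum>A\<in>S. c A * ind A i \<omega>)"
    by (auto simp: indicator_span_def)
  show "f \<in> ind_span \<A>" unfolding f using S
  proof (induction S)
    case empty
    have "{} \<in> \<A>" by (rule coarse_algebraD(2)[OF algebra_\<A>])
    from ind_span.lin[OF ind_span.ind[OF this] ind_span.ind[OF this], of 0 0] show ?case by simp
  next
    case (insert A S)
    have "ind A \<in> ind_span \<A>" using insert.prems by (intro ind_span.ind) auto
    moreover have "(\<lambda>i \<omega>. \<Sum>A\<in>S. c A * ind A i \<omega>) \<in> ind_span \<A>" using insert by blast
    ultimately have "(\<lambda>i \<omega>. c A * ind A i \<omega> + 1 * (\<Sum>A\<in>S. c A * ind A i \<omega>)) \<in> ind_span \<A>"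
      by (rule ind_span.lin)
    then show ?case unfolding sum.insert[OF insert.hyps(1,2)] mult_1 .
  qed
qed

context
  fixes x :: "nat \<Rightarrow> (real \<Rightarrow> real) \<Rightarrow> complex"
  assumes x: "x \<in> coarse_L2 dyadic_space \<A>"
begin

lemma x_square_integrable: "i \<ge> 1 \<Longrightarrow> square_integrable (dyadic_space i) (x i)"
  using x by (simp add: coarse_L2_def)

lemma coarse_L2_approx:
  assumes "\<epsilon> > 0"
  obtains R g where "g \<in> ind_span (bounded_field n R)"
    "\<forall>\<^sub>F i in sequentially. l2_norm (dyadic_space i) (\<lambda>\<omega>. x i \<omega> - g i \<omega>) < \<epsilon>"
proof -
  have "\<epsilon> / 2 > 0" using assms by simp
  then obtain f where f: "f \<in> indicator_span \<A>"
    and fx: "coarse_norm dyadic_space (\<lambda>i \<omega>. x i \<omega> - f i \<omega>) < ereal (\<epsilon> / 2)"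
    using x unfolding coarse_L2_def by blast
  have f': "f \<in> ind_span \<A>" using f indicator_span_subset by blast
  have fx': "l2_norm (dyadic_space i) (\<lambda>\<omega>. x i \<omega> - f i \<omega>) < \<epsilon> / 2" if "i \<ge> 1" for i
  proof -
    have "ereal (l2_norm (dyadic_space i) (\<lambda>\<omega>. x i \<omega> - f i \<omega>)) \<le> coarse_norm dyadic_space (\<lambda>i \<omega>. x i \<omega> - f i \<omega>)"
      unfolding coarse_norm_def using that by (intro SUP_upper) auto
    then have "ereal (l2_norm (dyadic_space i) (\<lambda>\<omega>. x i \<omega> - f i \<omega>)) < ereal (\<epsilon> / 2)"
      using fx by (rule le_less_trans)
    then show ?thesis by simp
  qed
  \<comment> \<open>Two squared errors below this bound, each counted twice by the inequality for
    the square of a sum, add up to less than the square of \<epsilon>.\<close>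
  have "\<epsilon>\<^sup>2 / 4 > 0" using assms by simp
  then obtain R g where g: "g \<in> ind_span (bounded_field n R)"
    "\<forall>\<^sub>F i in sequentially. (\<integral>\<omega>. (cmod (f i \<omega> - g i \<omega>))\<^sup>2 \<partial>dyadic_space i) < \<epsilon>\<^sup>2 / 4"
    using ind_span_approx[OF f', of "\<epsilon>\<^sup>2 / 4" n] by blast
  have sets: "coarse_set dyadic_space A" if "A \<in> bounded_field n R" for A
    using that unfolding bounded_field_def by (rule coarse_algebraD(1)[OF preimage_field_algebra])
  have "\<forall>\<^sub>F i in sequentially. l2_norm (dyadic_space i) (\<lambda>\<omega>. x i \<omega> - g i \<omega>) < \<epsilon>"
    using g(2) eventually_ge_at_top[of 1]
  proof eventually_elim
    case (elim i)
    note sf = ind_span_square_integrable[OF f' sets_\<A> elim(2)]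
    note sg = ind_span_square_integrable[OF g(1) sets elim(2)]
    have sxf: "square_integrable (dyadic_space i) (\<lambda>\<omega>. x i \<omega> - f i \<omega>)"
      using square_integrable_lin(1)[OF x_square_integrable[OF elim(2)] sf, of 1 "-1"] by simp
    have sfg: "square_integrable (dyadic_space i) (\<lambda>\<omega>. f i \<omega> - g i \<omega>)"
      using square_integrable_lin(1)[OF sf sg, of 1 "-1"] by simp
    have "(l2_norm (dyadic_space i) (\<lambda>\<omega>. x i \<omega> - f i \<omega>))\<^sup>2 < (\<epsilon> / 2)\<^sup>2"
      using fx'[OF elim(2)] by (intro power_strict_mono) auto
    then have "(\<integral>\<omega>. (cmod (x i \<omega> - f i \<omega>))\<^sup>2 \<partial>dyadic_space i) < \<epsilon>\<^sup>2 / 4"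
      by (simp add: l2_norm_def power_divide)
    moreover have "(\<integral>\<omega>. (cmod (x i \<omega> - g i \<omega>))\<^sup>2 \<partial>dyadic_space i) \<le>
      2 * (\<integral>\<omega>. (cmod (x i \<omega> - f i \<omega>))\<^sup>2 \<partial>dyadic_space i) + 2 * (\<integral>\<omega>. (cmod (f i \<omega> - g i \<omega>))\<^sup>2 \<partial>dyadic_space i)"
      using square_integrable_lin(2)[OF sxf sfg, of 1 1] by simp
    ultimately have "(\<integral>\<omega>. (cmod (x i \<omega> - g i \<omega>))\<^sup>2 \<partial>dyadic_space i) < \<epsilon>\<^sup>2"
      using elim(1) by linarith
    then show ?case unfolding l2_norm_def using assms by (intro real_less_lsqrt) auto
  qed
  with g(1) show thesis by (rule that)
qed

lemma convergent_spectral_measure: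
  "convergent (\<lambda>i. measure (spectral_measure i (x i)) {M \<in> finite_subsets i. M \<subseteq> dyadic_cells n S})"
    (is "convergent ?q")
proof -
  \<comment> \<open>The root of the mass is Lipschitz in the L2 norm, so it is approximated first;
    convergence of the mass follows by squaring.\<close>
  have "convergent (\<lambda>i. sqrt (?q i))"
  proof (rule convergent_approx)
    fix \<epsilon> :: real assume "\<epsilon> > 0"
    then obtain R g where g: "g \<in> ind_span (bounded_field n R)"
      "\<forall>\<^sub>F i in sequentially. l2_norm (dyadic_space i) (\<lambda>\<omega>. x i \<omega> - g i \<omega>) < \<epsilon>"
      by (rule coarse_L2_approx)
    let ?z = "\<lambda>i. spectral_form i (bounded_window n R i \<inter> dyadic_cells n S) (g i) (g i)"
    \<comment> \<open>The interval \<open>[-R, R)\<close> consists of \<open>2 * R * 2 ^ n\<close>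
      cells of level \<open>n\<close>, counted from its left end.\<close>
    have "form_convergent (dyadic_cells n S) (dyadic_instant n (- (int R * 2 ^ n))) (dyadic_instant n (int R * 2 ^ n))"
      using form_convergent_dyadic_cells[of n S "- (int R * 2 ^ n)" "2 * R * 2 ^ n"] by simp
    then have "convergent ?z"
    proof (intro convergent_spectral_form_span[OF _ _ window_Int_finite_subsets g(1) g(1)])
      fix A B assume "A \<in> bounded_field n R" "B \<in> bounded_field n R"
        "form_convergent (dyadic_cells n S) (dyadic_instant n (- (int R * 2 ^ n))) (dyadic_instant n (int R * 2 ^ n))"
      then show "convergent (\<lambda>i. spectral_form i (bounded_window n R i \<inter> dyadic_cells n S) (ind A i) (ind B i))"
        unfolding form_convergent_def bounded_field_def by simp
    next
      fix A assume "A \<in> bounded_field n R"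
      then show "coarse_set dyadic_space A"
        unfolding bounded_field_def by (rule coarse_algebraD(1)[OF preimage_field_algebra])
    qed
    then obtain l where "?z \<longlonglongrightarrow> l" by (auto simp: convergent_def)
    then have "(\<lambda>i. sqrt (cmod (?z i))) \<longlonglongrightarrow> sqrt (cmod l)"
      by (intro tendsto_real_sqrt tendsto_norm)
    then have "convergent (\<lambda>i. sqrt (cmod (?z i)))" by (auto simp: convergent_def)
    moreover have "\<forall>\<^sub>F i in sequentially. norm (sqrt (?q i) - sqrt (cmod (?z i))) \<le> \<epsilon>"
      using g(2) eventually_ge_at_top[of 1]
    proof eventually_elim
      case (elim i)
      have "walsh_poly i (bounded_window n R i) (g i)"
        using g(1) elim(2) unfolding bounded_field_def by (rule ind_span_poly)
      from spectral_measure_approx[OF x_square_integrable[OF elim(2)] this window_finite_subsets, of "dyadic_cells n S"] elim(1)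
      show ?case by simp
    qed
    ultimately show "\<exists>z. convergent z \<and> (\<forall>\<^sub>F i in sequentially. norm (sqrt (?q i) - z i) \<le> \<epsilon>)" by blast
  qed
  from convergent_mult[OF this this] show ?thesis by simp
qed

lemma tight_spectral_measure:
  assumes "\<epsilon> > 0"
  shows "\<exists>R::nat. \<forall>\<^sub>F i in sequentially.
    measure (spectral_measure i (x i)) {M \<in> finite_subsets i. \<not> M \<subseteq> {- real R..<real R}} \<le> \<epsilon>"
proof -
  have "sqrt \<epsilon> > 0" using assms by simp
  \<comment> \<open>Level 0 is an arbitrary choice: for positive \<open>i\<close> the bounded
    windows with the same \<open>R\<close> coincide on all levels.\<close>
  then obtain R g where g: "g \<in> ind_span (bounded_field 0 R)"
    "\<forall>\<^sub>F i in sequentially. l2_norm (dyadic_space i) (\<lambda>\<omega>. x i \<omega> - g i \<omega>) < sqrt \<epsilon>"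
    by (rule coarse_L2_approx)
  have "\<forall>\<^sub>F i in sequentially.
    measure (spectral_measure i (x i)) {M \<in> finite_subsets i. \<not> M \<subseteq> {- real R..<real R}} \<le> \<epsilon>"
    using g(2) eventually_ge_at_top[of 1]
  proof eventually_elim
    case (elim i)
    have "walsh_poly i (bounded_window 0 R i) (g i)"
      using g(1) elim(2) unfolding bounded_field_def by (rule ind_span_poly)
    moreover have "bounded_window 0 R i \<subseteq> {- real R..<real R}"
      unfolding bounded_window_eq[OF elim(2)] by blast
    ultimately have "measure (spectral_measure i (x i)) {M \<in> finite_subsets i. \<not> M \<subseteq> {- real R..<real R}}
      \<le> (l2_norm (dyadic_space i) (\<lambda>\<omega>. x i \<omega> - g i \<omega>))\<^sup>2"
      by (rule spectral_measure_tail[OF x_square_integrable[OF elim(2)] _ window_finite_subsets])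
    also have "\<dots> \<le> (sqrt \<epsilon>)\<^sup>2" using elim(1) by (intro power_mono) auto
    finally show ?case using assms by simp
  qed
  then show ?thesis by blast
qed

end

end

lemma integral_spectral_borel_measure:
  assumes "continuous_on UNIV (g :: compacts \<Rightarrow> real)"
  shows "(\<integral>K. g K \<partial>spectral_borel_measure i f) = (\<integral>M. g (Compacts M) \<partial>spectral_measure i f)"
  unfolding spectral_borel_measure_def
proof (rule integral_distr)
  show "Compacts \<in> spectral_measure i f \<rightarrow>\<^sub>M borel"
    unfolding spectral_measure_def by (simp add: measurable_point_measure_eq1)
  show "g \<in> borel_measurable borel" by (rule borel_measurable_continuous_onI[OF assms])
qed

theorem theorem3p3p5:
  fixes \<A> :: "(nat \<times> (real \<Rightarrow> real)) set set"
    and x :: "nat \<Rightarrow> (real \<Rightarrow> real) \<Rightarrow> complex"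
  assumes "dyadic_coarse_factorization \<A>"
    and "x \<in> coarse_L2 dyadic_space \<A>"
  shows "\<exists>\<mu> :: compacts measure.
           sets \<mu> = sets borel \<and> finite_measure \<mu> \<and>
           weakly_converges (\<lambda>i. spectral_borel_measure i (x i)) \<mu>"
proof -
  interpret dyadic_factorization \<A> by (rule dyadic_factorization.intro[OF assms(1)])
  \<comment> \<open>Nothing is known about \<open>x 0\<close>.\<close>
  let ?\<nu> = "\<lambda>i. spectral_measure (Suc i) (x (Suc i))"
  have space: "space (?\<nu> i) = finite_subsets (Suc i)" for i
    by (simp add: spectral_measure_def space_point_measure)
  have "\<exists>\<mu> :: compacts measure. sets \<mu> = sets borel \<and> finite_measure \<mu> \<and>
    (\<forall>g :: compacts \<Rightarrow> real. continuous_on UNIV g \<and> bounded (range g) \<longrightarrow>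
      (\<lambda>i. \<integral>M. g (Compacts M) \<partial>?\<nu> i) \<longlonglongrightarrow> (\<integral>K. g K \<partial>\<mu>))"
  proof (rule weak_limit_of_pattern_convergence)
    show "finite_measure (?\<nu> i)" for i
      by (rule spectral_measure_finite[OF x_square_integrable[OF assms(2)]]) simp
    show "finite M" if "M \<in> space (?\<nu> i)" for i M
      using that finite_subsetsD(1) unfolding space by blast
    show "sets (?\<nu> i) = Pow (space (?\<nu> i))" for i
      by (simp add: spectral_measure_def space_point_measure sets_point_measure)
    show "convergent (\<lambda>i. measure (?\<nu> i) {M \<in> space (?\<nu> i). pattern n M \<subseteq> S})" for n S
      unfolding space pattern_subset_iff
      using convergent_spectral_measure[OF assms(2), of n S]
      by (rule convergent_Suc_iff[where f = "\<lambda>i. measure (spectral_measure i (x i)) {M \<in> finite_subsets i. M \<subseteq> dyadic_cells n S}", THEN iffD2])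
    fix \<epsilon> :: real assume "\<epsilon> > 0"
    from tight_spectral_measure[OF assms(2) this]
    show "\<exists>R::nat. \<forall>\<^sub>F i in sequentially.
        measure (?\<nu> i) {M \<in> space (?\<nu> i). \<not> M \<subseteq> {- real R..<real R}} \<le> \<epsilon>"
      unfolding space
        eventually_sequentially_Suc[of "\<lambda>i. measure (spectral_measure i (x i)) {M \<in> finite_subsets i. \<not> M \<subseteq> {- real R..<real R}} \<le> \<epsilon>" for R] .
  qed
  then obtain \<mu> :: "compacts measure" where \<mu>: "sets \<mu> = sets borel" "finite_measure \<mu>"
    "\<And>g :: compacts \<Rightarrow> real. continuous_on UNIV g \<Longrightarrow> bounded (range g) \<Longrightarrow>
      (\<lambda>i. \<integral>M. g (Compacts M) \<partial>?\<nu> i) \<longlonglongrightarrow> (\<integral>K. g K \<partial>\<mu>)"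
    by blast
  have "weakly_converges (\<lambda>i. spectral_borel_measure i (x i)) \<mu>"
    unfolding weakly_converges_def
  proof (intro allI impI)
    fix g :: "compacts \<Rightarrow> real" assume g: "continuous_on UNIV g \<and> bounded (range g)"
    have "(\<lambda>i. \<integral>K. g K \<partial>spectral_borel_measure (Suc i) (x (Suc i))) \<longlonglongrightarrow> (\<integral>K. g K \<partial>\<mu>)"
      unfolding integral_spectral_borel_measure[OF conjunct1[OF g]] using \<mu>(3) g by blast
    then show "(\<lambda>i. \<integral>K. g K \<partial>spectral_borel_measure i (x i)) \<longlonglongrightarrow> (\<integral>K. g K \<partial>\<mu>)"
      by (rule LIMSEQ_imp_Suc)
  qed
  with \<mu> show ?thesis by blast
qed

end
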